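(* Let $0<\beta<1$, let $k\ge 1$ and let $(j_i,l_i)$, $1\le i\le k$, be a fixed family of pairs of replica indexes with $1\le j_i<l_i$. Then for any integer $n\ge \left[\frac{k+1}{2}\right]$ there exist constants $C(\beta,j)$, not depending on $N$ (they may depend on the family of indexes), such that, as $N\to\infty$, $$\nu\left(\prod_{i=1}^k \sigma_N^{j_i}\sigma_N^{l_i}R_{j_i,l_i}\right)=\sum_{j=\left[\frac{k+1}{2}\right]}^n\frac{C(\beta,j)}{N^j}+O\left(\frac{1}{N^{n+1}}\right).$$
   Context: Sherrington-Kirkpatrick model. For $N\ge1$ let $\Sigma_N=\{-1,1\}^N$, and for $\sigma=(\sigma_1,\dots,\sigma_N)\in\Sigma_N$ let $$-H_N(\sigma)=\frac{1}{N^{1/2}}\sum_{1\le i<j\le N}g_{i,j}\sigma_i\sigma_j,$$ where $\{g_{i,j};1\le i<j\le N\}$ are independent standard Gaussian random variables on a probability space, with expectation denoted $\mathbf{E}$. For the inverse temperature $\beta>0$ let $Z_N=\sum_{\sigma\in\Sigma_N}\exp(-\beta H_N(\sigma))$. For $n\ge1$ and $f:\Sigma_N^n\to\mathbb{R}$ put $$\langle f\rangle=Z_N^{-n}\sum_{\sigma^1,\dots,\sigma^n\in\Sigma_N}f(\sigma^1,\dots,\sigma^n)\exp\Big(-\beta\sum_{l\le n}H_N(\sigma^l)\Big),\qquad \nu(f)=\mathbf{E}\langle f\rangle.$$ The overlap of two replicas $\sigma^l,\sigma^{l'}$ ($l<l'$) is $R_{l,l'}=\frac1N\sum_{i\le N}\sigma_i^l\sigma_i^{l'}$;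 $\sigma_N^l$ is the last spin of the $l$-th replica. $[x]$ denotes the integer part of $x$. The constant in the $O(\cdot)$ does not depend on $N$ (it may depend on $\beta$, $n$ and the indexes). *)

theory Defs
  imports "HOL-Probability.Probability" "HOL-Library.Landau_Symbols"
begin

text \<open>Spins and replicas are numbered from 1. A configuration is a function on \<open>{1..N}\<close> and an
  \<open>n\<close>-tuple of replicas a function on \<open>{1..n}\<close>, both extended by \<^const>\<open>undefined\<close>, so that these
  sets are finite.\<close>

definition sk_configs :: "nat \<Rightarrow> (nat \<Rightarrow> real) set" where
  "sk_configs N = {1..N} \<rightarrow>\<^sub>E {-1, 1}"

definition sk_replicas :: "nat \<Rightarrow> nat \<Rightarrow> (nat \<Rightarrow> nat \<Rightarrow> real) set" where
  "sk_replicas N n = {1..n} \<rightarrow>\<^sub>E sk_configs N"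

definition sk_pairs :: "nat \<Rightarrow> (nat \<times> nat) set" where
  "sk_pairs N = {(i, j). 1 \<le> i \<and> i < j \<and> j \<le> N}"

definition sk_disorder :: "nat \<Rightarrow> 'w measure \<Rightarrow> (nat \<times> nat \<Rightarrow> 'w \<Rightarrow> real) \<Rightarrow> bool" where
  "sk_disorder N M g \<longleftrightarrow>
     prob_space M \<and>
     prob_space.indep_vars M (\<lambda>_. borel) g (sk_pairs N) \<and>
     (\<forall>p \<in> sk_pairs N. distributed M lborel (g p) (\<lambda>x. ennreal (std_normal_density x)))"

text \<open>In the next three definitions \<open>x\<close> is one realization of the couplings.\<close>

definition sk_hamiltonian :: "(nat \<times> nat \<Rightarrow> real) \<Rightarrow> nat \<Rightarrow> (nat \<Rightarrow> real) \<Rightarrow> real" where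
  "sk_hamiltonian x N \<sigma> = - (1 / sqrt (real N) * (\<Sum>(i, j) \<in> sk_pairs N. x (i, j) * \<sigma> i * \<sigma> j))"

definition sk_partition :: "(nat \<times> nat \<Rightarrow> real) \<Rightarrow> real \<Rightarrow> nat \<Rightarrow> real" where
  "sk_partition x \<beta> N = (\<Sum>\<sigma> \<in> sk_configs N. exp (- \<beta> * sk_hamiltonian x N \<sigma>))"

definition sk_gibbs ::
  "(nat \<times> nat \<Rightarrow> real) \<Rightarrow> real \<Rightarrow> nat \<Rightarrow> nat \<Rightarrow> ((nat \<Rightarrow> nat \<Rightarrow> real) \<Rightarrow> real) \<Rightarrow> real" where
  "sk_gibbs x \<beta> N n f =
     (\<Sum>s \<in> sk_replicas N n. f s * exp (- \<beta> * (\<Sum>l = 1..n. sk_hamiltonian x N (s l))))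
       / sk_partition x \<beta> N ^ n"

definition sk_nu ::
  "'w measure \<Rightarrow> (nat \<times> nat \<Rightarrow> 'w \<Rightarrow> real) \<Rightarrow> real \<Rightarrow> nat \<Rightarrow> nat \<Rightarrow>
     ((nat \<Rightarrow> nat \<Rightarrow> real) \<Rightarrow> real) \<Rightarrow> real" where
  "sk_nu M g \<beta> N n f = (\<integral>\<omega>. sk_gibbs (\<lambda>p. g p \<omega>) \<beta> N n f \<partial>M)"

definition sk_overlap :: "nat \<Rightarrow> (nat \<Rightarrow> nat \<Rightarrow> real) \<Rightarrow> nat \<Rightarrow> nat \<Rightarrow> real" where
  "sk_overlap N s l l' = 1 / real N * (\<Sum>i = 1..N. s l i * s l' i)"

end

theory Submission
  imports Defs "HOL-Real_Asymp.Real_Asymp"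
begin

text \<open>
  Write \<open>u = E Z\<^sub>N / Z\<^sub>N\<close>. For \<open>\<beta> < 1\<close> the annealed second moment of \<open>exp (c N R\<^sup>2)\<close> is bounded, and
  Gaussian integration by parts together with Young's inequality shows that \<open>E u\<^sup>q\<close> stays bounded along
  inverse temperatures \<open>b \<le> \<beta>\<close> if \<open>q\<close> decreases exponentially fast in \<open>b\<close>. A small moment of \<open>u\<close> is
  enough to transfer the annealed bound to \<open>\<nu>\<close>, so that \<open>\<nu> (exp (\<delta> N R\<^sup>2))\<close> is bounded in \<open>N\<close>.

  For the expansion, the couplings of the last spin are multiplied by \<open>\<surd>t\<close>, \<open>0 \<le> t \<le> 1\<close>. Each derivative in
  \<open>t\<close> produces one more overlap, which is of order \<open>N\<^sup>-\<^sup>1\<^sup>/\<^sup>2\<close>, and at \<open>t = 0\<close> the last spin is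
  independent of the rest. Give \<open>N\<^sup>-\<^sup>a\<close> times the average of a product of \<open>k\<close> overlaps the weight
  \<open>2 a + k\<close>. Modulo larger weights and modulo the same weight with smaller \<open>k\<close>, Taylor's formula and
  the symmetry between sites give \<open>X = \<beta>\<^sup>2 X\<close>, which can be solved as \<open>\<beta> < 1\<close>. The expansion follows by
  downward induction on the weight; the a priori bound \<open>O(N\<^sup>-\<^sup>k\<^sup>/\<^sup>2)\<close> kills the coefficients
  below \<open>(k + 1) div 2\<close>.
\<close>

section \<open>Expansions in powers of 1/N\<close>

text \<open>Multiplying an average over two replicas by the square of Z / E Z clears its
  denominators. The annealed computation therefore bounds u^-2 times a Gibbs average, and the
  obstacle is the event that Z lies far below its mean. With a constant exponent q, the temperature
  derivative of E u^q is bounded only through E (u^q ln u), which E u^q does not control; a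
  decreasing exponent contributes the same term with the opposite sign.

  Both sides of X = \<beta>^2 X come from one identity: by symmetry between sites, one overlap in a
  product may be traded for the last spins of its two replicas. The untouched product keeps, to
  leading order, its value X at t = 0. The traded one vanishes at t = 0 and has first derivative
  \<beta>^2 X there. Symmetry needs full overlaps, the path needs overlaps without the last site.
  Their difference costs 1 / N, but the two spins it brings may cancel those already present; then
  the weight is unchanged and two overlaps are lost. Hence the second ordering, by the number of
  overlaps within one weight.\<close>

definition expandable :: "nat \<Rightarrow> (nat \<Rightarrow> real) \<Rightarrow> bool" where
  "expandable K f \<longleftrightarrow>
     (\<exists>c. (\<lambda>N. f N - (\<Sum>r\<le>K. c r / real N ^ r)) \<in> O(\<lambda>N. 1 / real N ^ (K + 1)))"

lemma expandable_bigo: "f \<in> O(\<lambda>N. 1 / real N ^ (K + 1)) \<Longrightarrow> expandable K f"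
  unfolding expandable_def by (rule exI[of _ "\<lambda>_. 0"]) simp

lemma expandable_add:
  assumes "expandable K f" "expandable K g"
  shows "expandable K (\<lambda>N. f N + g N)"
proof -
  obtain c d where
    c: "(\<lambda>N. f N - (\<Sum>r\<le>K. c r / real N ^ r)) \<in> O(\<lambda>N. 1 / real N ^ (K + 1))" and
    d: "(\<lambda>N. g N - (\<Sum>r\<le>K. d r / real N ^ r)) \<in> O(\<lambda>N. 1 / real N ^ (K + 1))"
    using assms unfolding expandable_def by blast
  have "(\<lambda>N. f N + g N - (\<Sum>r\<le>K. (c r + d r) / real N ^ r)) \<in> O(\<lambda>N. 1 / real N ^ (K + 1))"
    using sum_in_bigo(1)[OF c d] by (simp add: add_divide_distrib sum.distrib algebra_simps)
  then show ?thesis unfolding expandable_def by (intro exI[of _ "\<lambda>r. c r + d r"])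
qed

lemma expandable_cmult:
  assumes "expandable K f"
  shows "expandable K (\<lambda>N. a * f N)"
proof -
  obtain c where
    c: "(\<lambda>N. f N - (\<Sum>r\<le>K. c r / real N ^ r)) \<in> O(\<lambda>N. 1 / real N ^ (K + 1))"
    using assms unfolding expandable_def by blast
  have "(\<lambda>N. a * (f N - (\<Sum>r\<le>K. c r / real N ^ r))) \<in> O(\<lambda>N. 1 / real N ^ (K + 1))"
    using c by simp
  then have "(\<lambda>N. a * f N - (\<Sum>r\<le>K. (a * c r) / real N ^ r)) \<in> O(\<lambda>N. 1 / real N ^ (K + 1))"
    by (simp add: right_diff_distrib sum_distrib_left)
  then show ?thesis unfolding expandable_def by (intro exI[of _ "\<lambda>r. a * c r"])
qed

lemma expandable_diff:
  "expandable K f \<Longrightarrow> expandable K g \<Longrightarrow> expandable K (\<lambda>N. f N - g N)"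
  using expandable_add[of K f "\<lambda>N. -1 * g N"] expandable_cmult[of K g "-1"] by simp

lemma expandable_zero: "expandable K (\<lambda>_. 0)"
  by (rule expandable_bigo) simp

lemma expandable_sum:
  "(\<And>i. i \<in> I \<Longrightarrow> expandable K (f i)) \<Longrightarrow> expandable K (\<lambda>N. \<Sum>i\<in>I. f i N)"
  by (induction I rule: infinite_finite_induct) (auto intro: expandable_add expandable_zero)

lemma expandable_cong:
  assumes "expandable K f" "eventually (\<lambda>N. f N = g N) sequentially"
  shows "expandable K g"
proof -
  obtain c where
    c: "(\<lambda>N. f N - (\<Sum>r\<le>K. c r / real N ^ r)) \<in> O(\<lambda>N. 1 / real N ^ (K + 1))"
    using assms unfolding expandable_def by blast
  have "(\<lambda>N. g N - (\<Sum>r\<le>K. c r / real N ^ r)) \<in> O(\<lambda>N. 1 / real N ^ (K + 1)) \<longleftrightarrow>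
     (\<lambda>N. f N - (\<Sum>r\<le>K. c r / real N ^ r)) \<in> O(\<lambda>N. 1 / real N ^ (K + 1))"
    by (rule landau_o.big.in_cong) (use assms(2) in eventually_elim, simp)
  with c show ?thesis unfolding expandable_def by blast
qed

text \<open>Half-integer orders are needed because an overlap is of order N^(-1/2); powers of
  \<open>sqrt (real N)\<close> express them with natural exponents.\<close>

lemma inverse_power_bigo:
  assumes "b \<le> a"
  shows "(\<lambda>N. 1 / sqrt (real N) ^ a) \<in> O(\<lambda>N. 1 / sqrt (real N) ^ b)"
proof (rule bigoI[where c = 1])
  show "\<forall>\<^sub>F N in sequentially. norm (1 / sqrt (real N) ^ a) \<le> 1 * norm (1 / sqrt (real N) ^ b)"
    using eventually_ge_at_top[of 1]
  proof eventually_elim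
    case (elim N)
    then have "sqrt (real N) ^ b \<le> sqrt (real N) ^ a"
      using assms by (intro power_increasing) auto
    then show ?case using elim by (simp add: divide_simps)
  qed
qed

lemma sqrt_power_even: "sqrt (real N) ^ (2 * a) = real N ^ a"
  by (simp add: power_mult)

lemma expandable_power: "expandable K (\<lambda>N. 1 / real N ^ a)"
proof (cases "a \<le> K")
  case True
  have "(\<Sum>r\<le>K. (if r = a then 1 else 0) / real N ^ r) = 1 / real N ^ a" for N
  proof -
    have "(\<Sum>r\<le>K. (if r = a then 1 else 0) / real N ^ r)
      = (\<Sum>r\<le>K. if r = a then 1 / real N ^ r else 0)"
      by (intro sum.cong) auto
    then show ?thesis using True by simp
  qed
  then show ?thesis
    unfolding expandable_def by (intro exI[of _ "\<lambda>r. if r = a then 1 else 0"]) simp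
next
  case False
  then have "(\<lambda>N. 1 / sqrt (real N) ^ (2 * a)) \<in> O(\<lambda>N. 1 / sqrt (real N) ^ (2 * (K + 1)))"
    by (intro inverse_power_bigo) simp
  then show ?thesis
    unfolding sqrt_power_even by (rule expandable_bigo)
qed

text \<open>Multiply by \<open>N ^ r\<close> and let N grow: the coefficients below r vanish by
  induction, the terms above r tend to 0, and so does \<open>f N * N ^ r\<close>, so the limit
  \<open>c r\<close> is 0.\<close>

lemma expansion_coeff_zero:
  assumes exp: "(\<lambda>N. f N - (\<Sum>r\<le>K. c r / real N ^ r)) \<in> O(\<lambda>N. 1 / real N ^ (K + 1))"
    and f: "f \<in> O(\<lambda>N. 1 / sqrt (real N) ^ k)"
    and "r \<le> K" "2 * r < k"
  shows "c r = 0"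
  using assms(3,4)
proof (induction r rule: less_induct)
  case (less r)
  have tends_aux: "(\<lambda>N. g N * real N ^ r) \<longlonglongrightarrow> 0"
    if "g \<in> O(\<lambda>N. 1 / sqrt (real N) ^ q)" "2 * r < q" for g and q :: nat
  proof -
    have "(\<lambda>N. g N * real N ^ r) \<in> O(\<lambda>N. 1 / sqrt (real N) ^ q * real N ^ r)"
      by (rule landau_o.big.mult_right[OF that(1)])
    \<comment> \<open>As \<open>2 * r < q\<close> between integers, at least one factor
      \<open>sqrt (real N)\<close> is left in the denominator.\<close>
    also have "(\<lambda>N. 1 / sqrt (real N) ^ q * real N ^ r) \<in> O(\<lambda>N. 1 / sqrt (real N))"
    proof (rule bigoI[where c = 1])
      show "\<forall>\<^sub>F N in sequentially. norm (1 / sqrt (real N) ^ q * real N ^ r)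
          \<le> 1 * norm (1 / sqrt (real N))"
        using eventually_ge_at_top[of 1]
      proof eventually_elim
        case (elim N)
        have "real N ^ r * sqrt (real N) = sqrt (real N) ^ (2 * r + 1)"
          by (simp add: sqrt_power_even)
        also have "\<dots> \<le> sqrt (real N) ^ q"
          using elim that(2) by (intro power_increasing) auto
        finally show ?case using elim by (simp add: divide_simps)
      qed
    qed
    also have "(\<lambda>N. 1 / sqrt (real N)) \<in> o(\<lambda>_. 1)" by real_asymp
    finally show ?thesis by (rule smalloD_tendsto[where g = "\<lambda>_. 1", simplified])
  qed
  have "(\<lambda>N. f N * real N ^ r - (f N - (\<Sum>i\<le>K. c i / real N ^ i)) * real N ^ r) \<longlonglongrightarrow> 0 - 0"
  proof (intro tendsto_diff)
    show "(\<lambda>N. f N * real N ^ r) \<longlonglongrightarrow> 0"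
      using tends_aux[OF f] less.prems by simp
    show "(\<lambda>N. (f N - (\<Sum>i\<le>K. c i / real N ^ i)) * real N ^ r) \<longlonglongrightarrow> 0"
      using tends_aux[of _ "2 * (K + 1)", unfolded sqrt_power_even, OF exp] less.prems by simp
  qed
  then have A: "(\<lambda>N. (\<Sum>i\<le>K. c i / real N ^ i * real N ^ r)) \<longlonglongrightarrow> 0"
    by (simp add: algebra_simps sum_distrib_left sum_distrib_right)
  have B: "(\<lambda>N. (\<Sum>i\<le>K. c i / real N ^ i * real N ^ r)) \<longlonglongrightarrow> (\<Sum>i\<le>K. if i = r then c r else 0)"
  proof (rule tendsto_sum)
    fix i assume "i \<in> {..K}"
    consider "i < r" | "i = r" | "r < i" by linarith
    then show "(\<lambda>N. c i / real N ^ i * real N ^ r) \<longlonglongrightarrow> (if i = r then c r else 0)"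
    proof cases
      case 1
      with less show ?thesis by auto
    next
      case 2
      have "\<forall>\<^sub>F N in sequentially. c i / real N ^ i * real N ^ r = c r"
        using eventually_ge_at_top[of 1] by eventually_elim (simp add: 2)
      then show ?thesis using 2 by (simp add: tendsto_eventually)
    next
      case 3
      have "(\<lambda>N. c i / real N ^ i) \<in> O(\<lambda>N. 1 / sqrt (real N) ^ (2 * i))"
        unfolding sqrt_power_even by (rule bigoI[where c = "\<bar>c i\<bar>"]) simp
      from tends_aux[OF this] 3 show ?thesis by simp
    qed
  qed
  from LIMSEQ_unique[OF A B] less.prems show ?case by simp
qed

section \<open>Taylor's formula with derivatives in the open interval only\<close>

lemma mean_value_exists:
  fixes f :: "real \<Rightarrow> real"
  assumes "a < b" "continuous_on {a..b} f"
    and deriv: "\<And>x. a < x \<Longrightarrow> x < b \<Longrightarrow> (f has_real_derivative f' x) (at x)"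
  shows "\<exists>z>a. z < b \<and> f b - f a = (b - a) * f' z"
proof -
  obtain l z where z: "a < z" "z < b" "DERIV f z :> l" "f b - f a = (b - a) * l"
    using MVT[OF assms(1,2)] deriv real_differentiable_def by blast
  with deriv[of z] have "l = f' z" using DERIV_unique by blast
  with z show ?thesis by blast
qed

text \<open>The end point 0 is excluded from differentiability since the cavity path is used in the
  time \<open>u = s^2\<close>, and \<open>sqrt\<close> is not differentiable at 0. The remainder of
  order \<open>Suc K\<close> has as its derivative the remainder of order K of the shifted family,
  which the induction hypothesis bounds by B; the mean value theorem then bounds the remainder
  itself.\<close>

lemma taylor_iterated:
  fixes \<phi> :: "nat \<Rightarrow> real \<Rightarrow> real"
  assumes "\<And>r. r \<le> K \<Longrightarrow> continuous_on {0..1} (\<phi> r)"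
    and "\<And>r t. r \<le> K \<Longrightarrow> 0 < t \<Longrightarrow> t < 1 \<Longrightarrow> (\<phi> r has_real_derivative \<phi> (Suc r) t) (at t)"
    and "\<And>t. 0 \<le> t \<Longrightarrow> t \<le> 1 \<Longrightarrow> \<bar>\<phi> (Suc K) t\<bar> \<le> B"
    and "0 \<le> t" "t \<le> 1"
  shows "\<bar>\<phi> 0 t - (\<Sum>r\<le>K. \<phi> r 0 * t ^ r / fact r)\<bar> \<le> B"
  using assms
proof (induction K arbitrary: \<phi> t)
  case 0
  have B: "B \<ge> 0" using "0.prems"(3)[of 0] by linarith
  show ?case
  proof (cases "t = 0")
    case True then show ?thesis using B by simp
  next
    case False
    have "\<exists>z>0. z < t \<and> \<phi> 0 t - \<phi> 0 0 = (t - 0) * \<phi> (Suc 0) z"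
      by (rule mean_value_exists) (use False 0 in \<open>auto intro: continuous_on_subset\<close>)
    then obtain z where z: "z > 0" "z < t" "\<phi> 0 t - \<phi> 0 0 = t * \<phi> (Suc 0) z" by auto
    have "\<bar>t * \<phi> (Suc 0) z\<bar> \<le> 1 * B"
      unfolding abs_mult using 0 z B by (intro mult_mono) auto
    then show ?thesis using z by simp
  qed
next
  case (Suc K)
  have B: "B \<ge> 0" using Suc.prems(3)[of 0] by linarith
  define h where "h t = \<phi> 0 t - (\<Sum>r\<le>Suc K. \<phi> r 0 * t ^ r / fact r)" for t
  define h' where "h' t = \<phi> 1 t - (\<Sum>r\<le>K. \<phi> (Suc r) 0 * t ^ r / fact r)" for t
  have h0: "h 0 = 0"
    unfolding h_def by (subst sum.atMost_Suc_shift) simp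
  have h': "\<bar>h' t\<bar> \<le> B" if "0 \<le> t" "t \<le> 1" for t
    unfolding h'_def using Suc.IH[of "\<lambda>r. \<phi> (Suc r)" t] Suc.prems that by simp
  have deriv: "(h has_real_derivative h' t) (at t)" if t: "0 < t" "t < 1" for t
  proof -
    have h_eq: "h = (\<lambda>t. \<phi> 0 t - (\<phi> 0 0 + (\<Sum>r\<le>K. \<phi> (Suc r) 0 * t ^ Suc r / fact (Suc r))))"
      unfolding h_def by (subst sum.atMost_Suc_shift) simp
    have power_deriv: "((\<lambda>t. \<phi> (Suc r) 0 * t ^ Suc r / fact (Suc r)) has_real_derivative
        \<phi> (Suc r) 0 * t ^ r / fact r) (at t)" for r
    proof -
      define a where "a = \<phi> (Suc r) 0 / fact (Suc r)"
      have "((\<lambda>t. a * t ^ Suc r) has_real_derivative a * (real (Suc r) * t ^ r)) (at t)"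
        using DERIV_cmult[OF DERIV_pow[of "Suc r" t UNIV]] by (simp del: power_Suc of_nat_Suc)
      moreover have "a * (real (Suc r) * t ^ r) = \<phi> (Suc r) 0 * t ^ r / fact r"
        unfolding a_def by (simp add: fact_Suc del: of_nat_Suc)
      moreover have "(\<lambda>t. a * t ^ Suc r) = (\<lambda>t. \<phi> (Suc r) 0 * t ^ Suc r / fact (Suc r))"
        unfolding a_def by simp
      ultimately show ?thesis by simp
    qed
    have "((\<lambda>t. \<Sum>r\<le>K. \<phi> (Suc r) 0 * t ^ Suc r / fact (Suc r)) has_real_derivative
        (\<Sum>r\<le>K. \<phi> (Suc r) 0 * t ^ r / fact r)) (at t)"
      by (intro DERIV_sum power_deriv)
    from DERIV_diff[OF Suc.prems(2)[of 0 t] DERIV_add[OF DERIV_const[of "\<phi> 0 0"] this]] t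
    show ?thesis unfolding h_eq h'_def by simp
  qed
  have cont: "continuous_on {0..1} h"
    unfolding h_def using Suc.prems(1)[of 0] by (auto intro!: continuous_intros)
  have "\<bar>h t\<bar> \<le> B"
  proof (cases "t = 0")
    case True then show ?thesis using B h0 by simp
  next
    case False
    have "\<exists>z>0. z < t \<and> h t - h 0 = (t - 0) * h' z"
      by (rule mean_value_exists)
         (use False Suc.prems deriv in \<open>auto intro: continuous_on_subset[OF cont]\<close>)
    then obtain z where z: "z > 0" "z < t" "h t = t * h' z" using h0 by auto
    have "\<bar>t * h' z\<bar> \<le> 1 * B"
      unfolding abs_mult using Suc.prems z B h'[of z] by (intro mult_mono) auto
    then show ?thesis using z by simp
  qed
  then show ?case by (simp add: h_def)
qed

section \<open>Averages over replicas\<close>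

definition gibbs_weight :: "'c set \<Rightarrow> ('c \<Rightarrow> real) \<Rightarrow> 'c \<Rightarrow> real" where
  "gibbs_weight S h \<sigma> = exp (h \<sigma>) / (\<Sum>\<tau>\<in>S. exp (h \<tau>))"

text \<open>The index set is arbitrary, not an initial segment, so that replicas can be added and
  removed one at a time in inductions.\<close>

definition replica_avg ::
  "'c set \<Rightarrow> ('c \<Rightarrow> real) \<Rightarrow> nat set \<Rightarrow> ((nat \<Rightarrow> 'c) \<Rightarrow> real) \<Rightarrow> real" where
  "replica_avg S p I f = (\<Sum>s\<in>I \<rightarrow>\<^sub>E S. f s * (\<Prod>l\<in>I. p (s l)))"

text \<open>All functions are compared, not only extensional ones, so that updating a replica
  outside I needs no side condition on s.\<close>

definition depends_on :: "nat set \<Rightarrow> ((nat \<Rightarrow> 'c) \<Rightarrow> real) \<Rightarrow> bool" where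
  "depends_on I f \<longleftrightarrow> (\<forall>s s'. (\<forall>l\<in>I. s l = s' l) \<longrightarrow> f s = f s')"

lemma depends_onI: "(\<And>s s'. (\<And>l. l \<in> I \<Longrightarrow> s l = s' l) \<Longrightarrow> f s = f s') \<Longrightarrow> depends_on I f"
  unfolding depends_on_def by blast

lemma depends_on_mono: "depends_on I f \<Longrightarrow> I \<subseteq> J \<Longrightarrow> depends_on J f"
  unfolding depends_on_def by blast

lemma depends_on_upd: "depends_on I f \<Longrightarrow> a \<notin> I \<Longrightarrow> f (s(a := y)) = f s"
  unfolding depends_on_def by (metis fun_upd_apply)

lemma sum_PiE_insert:
  assumes "finite I" "finite S" "a \<notin> I"
  shows "(\<Sum>s\<in>insert a I \<rightarrow>\<^sub>E S. h s) = (\<Sum>s\<in>I \<rightarrow>\<^sub>E S. \<Sum>y\<in>S. h (s(a := y)))"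
proof -
  have "(\<Sum>s\<in>insert a I \<rightarrow>\<^sub>E S. h s) = (\<Sum>(y, s)\<in>S \<times> (I \<rightarrow>\<^sub>E S). h (s(a := y)))"
    unfolding PiE_insert_eq
    by (subst sum.reindex) (use assms inj_combinator[of a I "\<lambda>_. S"] in \<open>auto simp: case_prod_unfold\<close>)
  also have "\<dots> = (\<Sum>y\<in>S. \<Sum>s\<in>I \<rightarrow>\<^sub>E S. h (s(a := y)))"
    by (simp add: sum.cartesian_product)
  finally show ?thesis by (subst sum.swap)
qed

lemma replica_avg_empty: "replica_avg S p {} f = f (\<lambda>_. undefined)"
  by (simp add: replica_avg_def)

lemma replica_avg_insert:
  assumes "finite I" "finite S" "a \<notin> I"
  shows "replica_avg S p (insert a I) f = replica_avg S p I (\<lambda>s. \<Sum>y\<in>S. p y * f (s(a := y)))"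
proof -
  have "(\<Prod>l\<in>insert a I. p ((s(a := y)) l)) = p y * (\<Prod>l\<in>I. p (s l))" for s y
  proof -
    have "(\<Prod>l\<in>I. p (if l = a then y else s l)) = (\<Prod>l\<in>I. p (s l))"
      using assms by (intro prod.cong) auto
    then show ?thesis using assms by simp
  qed
  then show ?thesis
    unfolding replica_avg_def sum_PiE_insert[OF assms]
    by (intro sum.cong refl) (simp add: sum_distrib_left sum_distrib_right mult_ac)
qed

lemma replica_avg_cong:
  "(\<And>s. s \<in> I \<rightarrow>\<^sub>E S \<Longrightarrow> f s = g s) \<Longrightarrow> replica_avg S p I f = replica_avg S p I g"
  unfolding replica_avg_def by (intro sum.cong) auto

lemma replica_avg_sum:
  "replica_avg S p I (\<lambda>s. \<Sum>i\<in>A. f i s) = (\<Sum>i\<in>A. replica_avg S p I (f i))"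
  unfolding replica_avg_def by (simp add: sum_distrib_right) (rule sum.swap)

lemma replica_avg_add:
  "replica_avg S p I (\<lambda>s. f s + g s) = replica_avg S p I f + replica_avg S p I g"
  unfolding replica_avg_def by (simp add: distrib_right sum.distrib)

lemma replica_avg_cmult:
  "replica_avg S p I (\<lambda>s. c * f s) = c * replica_avg S p I f"
  unfolding replica_avg_def sum_distrib_left by (simp add: mult_ac)

lemma replica_avg_mult_right:
  "replica_avg S p I (\<lambda>s. f s * c) = replica_avg S p I f * c"
  unfolding replica_avg_def sum_distrib_right by (simp add: mult_ac)

lemma replica_avg_uminus:
  "replica_avg S p I (\<lambda>s. - f s) = - replica_avg S p I f"
  using replica_avg_cmult[of S p I "-1" f] by simp

lemma replica_avg_diff:
  "replica_avg S p I (\<lambda>s. f s - g s) = replica_avg S p I f - replica_avg S p I g"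
  using replica_avg_add[of S p I f "\<lambda>s. - g s"] by (simp add: replica_avg_uminus)

lemma replica_avg_mono:
  assumes "\<And>\<sigma>. \<sigma> \<in> S \<Longrightarrow> 0 \<le> p \<sigma>" "\<And>s. s \<in> I \<rightarrow>\<^sub>E S \<Longrightarrow> f s \<le> g s"
  shows "replica_avg S p I f \<le> replica_avg S p I g"
  unfolding replica_avg_def
  by (intro sum_mono mult_right_mono prod_nonneg) (use assms in \<open>auto simp: PiE_mem\<close>)

lemma replica_avg_abs:
  assumes "\<And>\<sigma>. \<sigma> \<in> S \<Longrightarrow> 0 \<le> p \<sigma>"
  shows "\<bar>replica_avg S p I f\<bar> \<le> replica_avg S p I (\<lambda>s. \<bar>f s\<bar>)"
proof -
  have "replica_avg S p I f \<le> replica_avg S p I (\<lambda>s. \<bar>f s\<bar>)"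
    by (rule replica_avg_mono) (use assms in auto)
  moreover have "replica_avg S p I (\<lambda>s. - f s) \<le> replica_avg S p I (\<lambda>s. \<bar>f s\<bar>)"
    by (rule replica_avg_mono) (use assms in auto)
  ultimately show ?thesis by (simp add: replica_avg_uminus)
qed

text \<open>A replica on which f does not depend is independent of the others, so its factor splits
  off as a single average.\<close>

lemma replica_avg_insert_mult:
  assumes "finite I" "finite S" "a \<notin> I" "depends_on I f"
  shows "replica_avg S p (insert a I) (\<lambda>s. f s * g (s a)) = replica_avg S p I f * (\<Sum>y\<in>S. p y * g y)"
  unfolding replica_avg_insert[OF assms(1-3)] depends_on_upd[OF assms(4,3)]
  by (simp add: replica_avg_sum sum_distrib_left mult.left_commute[of "p _"]
      flip: replica_avg_mult_right)

lemma replica_avg_marginal: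
  assumes "finite J" "finite S" "I \<subseteq> J" "depends_on I f" "(\<Sum>\<sigma>\<in>S. p \<sigma>) = 1"
  shows "replica_avg S p J f = replica_avg S p I f"
proof -
  have "finite (J - I)" using assms by auto
  then have "replica_avg S p (J - I \<union> I) f = replica_avg S p I f"
  proof (induction "J - I" arbitrary: J rule: finite_induct)
    case empty
    then show ?case by (metis Un_empty_left)
  next
    case (insert a F)
    have fin: "finite I" using assms finite_subset by blast
    have F: "F = (J - {a}) - I" and a: "a \<notin> F \<union> I" using insert by auto
    have "replica_avg S p (J - I \<union> I) f = replica_avg S p (insert a (F \<union> I)) (\<lambda>s. f s * 1)"
      using insert by (simp flip: insert(4))
    also have "\<dots> = replica_avg S p (F \<union> I) f * (\<Sum>y\<in>S. p y * 1)"
      using insert(1) fin a assms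
      by (intro replica_avg_insert_mult) (auto intro: depends_on_mono)
    also have "\<dots> = replica_avg S p (F \<union> I) f" using assms by simp
    also have "\<dots> = replica_avg S p I f" using insert.hyps(3)[OF F] F by simp
    finally show ?case .
  qed
  moreover have "J - I \<union> I = J" using assms by auto
  ultimately show ?thesis by simp
qed

text \<open>The empty index set is the marginal here: all replicas are summed out.\<close>

lemma replica_avg_const:
  assumes "finite I" "finite S" "(\<Sum>\<sigma>\<in>S. p \<sigma>) = 1"
  shows "replica_avg S p I (\<lambda>_. c) = c"
  using replica_avg_marginal[of I S "{}" "\<lambda>_. c" p] assms
  by (simp add: replica_avg_empty depends_on_def)

lemma replica_avg_two:
  assumes "finite I" "finite S" "(\<Sum>\<sigma>\<in>S. p \<sigma>) = 1" "l \<in> I" "l' \<in> I" "l \<noteq> l'"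
  shows "replica_avg S p I (\<lambda>s. g (s l) (s l')) = (\<Sum>\<sigma>\<in>S. \<Sum>\<tau>\<in>S. p \<sigma> * p \<tau> * g \<sigma> \<tau>)"
proof -
  have "replica_avg S p I (\<lambda>s. g (s l) (s l')) = replica_avg S p {l, l'} (\<lambda>s. g (s l) (s l'))"
    using assms by (intro replica_avg_marginal) (auto simp: depends_on_def)
  also have "\<dots> = (\<Sum>\<tau>\<in>S. p \<tau> * (\<Sum>\<sigma>\<in>S. p \<sigma> * g \<sigma> \<tau>))"
    using assms by (simp add: replica_avg_insert replica_avg_empty)
  also have "\<dots> = (\<Sum>\<tau>\<in>S. \<Sum>\<sigma>\<in>S. p \<sigma> * p \<tau> * g \<sigma> \<tau>)"
    unfolding sum_distrib_left by (simp add: mult_ac)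
  also have "\<dots> = (\<Sum>\<sigma>\<in>S. \<Sum>\<tau>\<in>S. p \<sigma> * p \<tau> * g \<sigma> \<tau>)" by (rule sum.swap)
  finally show ?thesis .
qed

section \<open>Gibbs weights and their derivatives\<close>

lemma gibbs_weight_pos: "finite S \<Longrightarrow> S \<noteq> {} \<Longrightarrow> 0 < gibbs_weight S h \<sigma>"
  unfolding gibbs_weight_def by (intro divide_pos_pos sum_pos) auto

lemma gibbs_weight_sum:
  assumes "finite S" "S \<noteq> {}"
  shows "(\<Sum>\<sigma>\<in>S. gibbs_weight S h \<sigma>) = 1"
proof -
  have "0 < (\<Sum>\<tau>\<in>S. exp (h \<tau>))" using assms by (intro sum_pos) auto
  then show ?thesis unfolding gibbs_weight_def by (simp flip: sum_divide_distrib)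
qed

lemma replica_avg_bound:
  assumes "finite I" "finite S" "S \<noteq> {}" "\<And>s. s \<in> I \<rightarrow>\<^sub>E S \<Longrightarrow> \<bar>f s\<bar> \<le> B"
  shows "\<bar>replica_avg S (gibbs_weight S h) I f\<bar> \<le> B"
proof -
  have pos: "0 \<le> gibbs_weight S h \<sigma>" for \<sigma>
    using gibbs_weight_pos[OF assms(2,3)] less_imp_le by blast
  have "\<bar>replica_avg S (gibbs_weight S h) I f\<bar> \<le> replica_avg S (gibbs_weight S h) I (\<lambda>s. \<bar>f s\<bar>)"
    by (rule replica_avg_abs) (rule pos)
  also have "\<dots> \<le> replica_avg S (gibbs_weight S h) I (\<lambda>_. B)"
    by (rule replica_avg_mono) (use pos assms in auto)
  also have "\<dots> = B" using assms by (simp add: replica_avg_const gibbs_weight_sum)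
  finally show ?thesis .
qed

lemma log_partition_deriv:
  fixes h :: "real \<Rightarrow> 'c \<Rightarrow> real"
  assumes "finite S" "S \<noteq> {}"
    and "\<And>\<sigma>. \<sigma> \<in> S \<Longrightarrow> ((\<lambda>y. h y \<sigma>) has_real_derivative d \<sigma>) (at y)"
  shows "((\<lambda>y. ln (\<Sum>\<sigma>\<in>S. exp (h y \<sigma>))) has_real_derivative
     (\<Sum>\<sigma>\<in>S. gibbs_weight S (h y) \<sigma> * d \<sigma>)) (at y)"
proof -
  have pos: "0 < (\<Sum>\<tau>\<in>S. exp (h y \<tau>))" using assms by (intro sum_pos) auto
  have "((\<lambda>y. \<Sum>\<sigma>\<in>S. exp (h y \<sigma>)) has_real_derivative (\<Sum>\<sigma>\<in>S. exp (h y \<sigma>) * d \<sigma>)) (at y)"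
    by (intro DERIV_sum) (auto intro!: derivative_eq_intros assms)
  then have "((\<lambda>y. ln (\<Sum>\<sigma>\<in>S. exp (h y \<sigma>))) has_real_derivative
      (\<Sum>\<sigma>\<in>S. exp (h y \<sigma>) * d \<sigma>) / (\<Sum>\<tau>\<in>S. exp (h y \<tau>))) (at y)"
    using pos assms(3) by (auto intro!: derivative_eq_intros)
  then show ?thesis by (simp add: gibbs_weight_def sum_divide_distrib)
qed

lemma gibbs_weight_deriv:
  fixes h :: "real \<Rightarrow> 'c \<Rightarrow> real"
  assumes "finite S" "S \<noteq> {}"
    and "\<And>\<sigma>. \<sigma> \<in> S \<Longrightarrow> ((\<lambda>y. h y \<sigma>) has_real_derivative d \<sigma>) (at y)" and "\<sigma> \<in> S"
  shows "((\<lambda>y. gibbs_weight S (h y) \<sigma>) has_real_derivative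
    gibbs_weight S (h y) \<sigma> * (d \<sigma> - (\<Sum>\<tau>\<in>S. gibbs_weight S (h y) \<tau> * d \<tau>))) (at y)"
proof -
  \<comment> \<open>As an exponential, the weight has a derivative in product form: the weight times
    the derivative of the exponent, which is d minus its own Gibbs mean.\<close>
  have eq: "gibbs_weight S (h y) \<sigma> = exp (h y \<sigma> - ln (\<Sum>\<tau>\<in>S. exp (h y \<tau>)))" for y \<sigma>
  proof -
    have "0 < (\<Sum>\<tau>\<in>S. exp (h y \<tau>))" using assms by (intro sum_pos) auto
    then show ?thesis by (simp add: gibbs_weight_def exp_diff)
  qed
  have "((\<lambda>y. exp (h y \<sigma> - ln (\<Sum>\<tau>\<in>S. exp (h y \<tau>)))) has_real_derivative
    exp (h y \<sigma> - ln (\<Sum>\<tau>\<in>S. exp (h y \<tau>))) * (d \<sigma> - (\<Sum>\<tau>\<in>S. gibbs_weight S (h y) \<tau> * d \<tau>))) (at y)"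
    by (rule derivative_eq_intros log_partition_deriv assms refl | assumption)+
  then show ?thesis by (simp flip: eq)
qed

text \<open>Differentiating a Gibbs average over \<open>n\<close> replicas adds one replica; the normalisation
  \<open>Z\<^sup>-\<^sup>n\<close> gives it the weight \<open>- n\<close>.\<close>

definition cav_coeff :: "nat \<Rightarrow> nat \<Rightarrow> real" where
  "cav_coeff n l = (if l \<le> n then 1 else - real n)"

lemma replica_avg_deriv:
  fixes h :: "real \<Rightarrow> 'c \<Rightarrow> real"
  assumes "finite S" "S \<noteq> {}" "depends_on {1..n} f"
    and d: "\<And>\<sigma>. \<sigma> \<in> S \<Longrightarrow> ((\<lambda>y. h y \<sigma>) has_real_derivative d \<sigma>) (at y)"
  shows "((\<lambda>y. replica_avg S (gibbs_weight S (h y)) {1..n} f) has_real_derivative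
    replica_avg S (gibbs_weight S (h y)) {1..Suc n}
      (\<lambda>s. f s * (\<Sum>l = 1..Suc n. cav_coeff n l * d (s l)))) (at y)"
proof -
  let ?p = "\<lambda>y. gibbs_weight S (h y)"
  \<comment> \<open>The Gibbs mean of d. It is realized below as the average of d on the independent
    replica \<open>Suc n\<close>.\<close>
  define m where "m = (\<Sum>\<tau>\<in>S. ?p y \<tau> * d \<tau>)"
  have prod: "((\<lambda>y. f s * (\<Prod>l\<in>{1..n}. ?p y (s l))) has_real_derivative
      f s * (\<Sum>l\<in>{1..n}. d (s l) - m) * (\<Prod>l\<in>{1..n}. ?p y (s l))) (at y)"
    if s: "s \<in> {1..n} \<rightarrow>\<^sub>E S" for s
  proof -
    have pos: "?p y (s l) \<noteq> 0" for l using gibbs_weight_pos[OF assms(1,2)] by (metis less_irrefl)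
    have "((\<lambda>y. \<Prod>l\<in>{1..n}. ?p y (s l)) has_real_derivative
        (\<Sum>l\<in>{1..n}. ?p y (s l) * (d (s l) - m) * (\<Prod>k\<in>{1..n} - {l}. ?p y (s k)))) (at y)"
      unfolding m_def
      by (intro has_field_derivative_prod gibbs_weight_deriv assms) (use s in auto)
    also have "(\<Sum>l\<in>{1..n}. ?p y (s l) * (d (s l) - m) * (\<Prod>k\<in>{1..n} - {l}. ?p y (s k)))
      = (\<Sum>l\<in>{1..n}. (d (s l) - m) * (\<Prod>k\<in>{1..n}. ?p y (s k)))"
      by (intro sum.cong refl) (simp add: prod.remove)
    also have "\<dots> = (\<Sum>l\<in>{1..n}. d (s l) - m) * (\<Prod>k\<in>{1..n}. ?p y (s k))"
      by (simp add: sum_distrib_right)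
    finally show ?thesis by (auto intro!: derivative_eq_intros simp: mult_ac)
  qed
  have "((\<lambda>y. replica_avg S (?p y) {1..n} f) has_real_derivative
      replica_avg S (?p y) {1..n} (\<lambda>s. f s * (\<Sum>l\<in>{1..n}. d (s l) - m))) (at y)"
    unfolding replica_avg_def by (intro DERIV_sum prod) auto
  moreover have "replica_avg S (?p y) {1..Suc n} (\<lambda>s. f s * (\<Sum>l = 1..Suc n. cav_coeff n l * d (s l)))
      = replica_avg S (?p y) {1..n} (\<lambda>s. f s * (\<Sum>l\<in>{1..n}. d (s l) - m))"
  proof -
    have ins: "{1..Suc n} = insert (Suc n) {1..n}" by auto
    have "replica_avg S (?p y) {1..Suc n} (\<lambda>s. f s * (\<Sum>l = 1..Suc n. cav_coeff n l * d (s l)))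
      = replica_avg S (?p y) {1..Suc n} (\<lambda>s. f s * (\<Sum>l = 1..n. d (s l)) - real n * (f s * d (s (Suc n))))"
    proof (rule replica_avg_cong)
      fix s
      have "(\<Sum>l = 1..n. cav_coeff n l * d (s l)) = (\<Sum>l = 1..n. d (s l))"
        by (intro sum.cong) (auto simp: cav_coeff_def)
      then show "f s * (\<Sum>l = 1..Suc n. cav_coeff n l * d (s l))
        = f s * (\<Sum>l = 1..n. d (s l)) - real n * (f s * d (s (Suc n)))"
        by (simp add: cav_coeff_def algebra_simps)
    qed
    also have "\<dots> = replica_avg S (?p y) {1..Suc n} (\<lambda>s. f s * (\<Sum>l = 1..n. d (s l)))
        - real n * replica_avg S (?p y) {1..Suc n} (\<lambda>s. f s * d (s (Suc n)))"
      by (simp only: replica_avg_diff replica_avg_cmult)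
    also have "replica_avg S (?p y) {1..Suc n} (\<lambda>s. f s * d (s (Suc n)))
        = replica_avg S (?p y) {1..n} f * m"
      unfolding ins m_def using assms by (intro replica_avg_insert_mult) auto
    also have "replica_avg S (?p y) {1..Suc n} (\<lambda>s. f s * (\<Sum>l = 1..n. d (s l)))
        = replica_avg S (?p y) {1..n} (\<lambda>s. f s * (\<Sum>l = 1..n. d (s l)))"
    proof (rule replica_avg_marginal)
      show "depends_on {1..n} (\<lambda>s. f s * (\<Sum>l = 1..n. d (s l)))"
      proof (rule depends_onI)
        fix s s' :: "nat \<Rightarrow> 'c" assume eq: "\<And>l. l \<in> {1..n} \<Longrightarrow> s l = s' l"
        then have "f s = f s'" using assms(3) unfolding depends_on_def by blast
        then show "f s * (\<Sum>l = 1..n. d (s l)) = f s' * (\<Sum>l = 1..n. d (s' l))"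
          using eq by simp
      qed
    qed (use assms gibbs_weight_sum in auto)
    finally show ?thesis
      by (simp add: sum_subtractf right_diff_distrib replica_avg_diff replica_avg_mult_right
          replica_avg_cmult mult_ac)
  qed
  ultimately show ?thesis by simp
qed

section \<open>Gaussian integration by parts\<close>

definition gauss :: "real measure" where
  "gauss = density lborel (\<lambda>x. ennreal (std_normal_density x))"

lemma sets_gauss [measurable_cong, simp]: "sets gauss = sets borel"
  by (simp add: gauss_def)

lemma space_gauss [simp]: "space gauss = UNIV"
  by (simp add: gauss_def)

lemma prob_space_gauss: "prob_space gauss"
  unfolding gauss_def by (rule prob_space_normal_density) simp

interpretation gauss: product_prob_space "\<lambda>_ :: 'i. gauss" UNIV
  by (simp add: product_prob_space_def product_sigma_finite_def product_prob_space_axioms_def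
      prob_space_gauss prob_space_imp_sigma_finite)

lemma prob_space_PiM_gauss: "prob_space (PiM P (\<lambda>_. gauss))"
  by (intro prob_space_PiM prob_space_gauss)

lemma gauss_integral:
  "f \<in> borel_measurable borel \<Longrightarrow> integral\<^sup>L gauss f = (\<integral>x. std_normal_density x * f x \<partial>lborel)"
  unfolding gauss_def by (subst integral_density) auto

lemma gauss_integrable:
  "f \<in> borel_measurable borel \<Longrightarrow>
     integrable gauss f \<longleftrightarrow> integrable lborel (\<lambda>x. std_normal_density x * f x)"
  unfolding gauss_def by (subst integrable_density) auto

text \<open>Serves both Gaussian integrals below: multiplied by the standard density, the integrand
  becomes a multiple c of another normal density, whose total mass is 1.\<close>

lemma
  assumes "\<And>x. std_normal_density x * f x = c * normal_density m v x" "0 < v"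
    and [measurable]: "f \<in> borel_measurable borel"
  shows gauss_integrable_reweight: "integrable gauss f"
    and gauss_integral_reweight: "integral\<^sup>L gauss f = c"
  using assms(2) integrable_normal_density[of v m] integral_normal_density[of v m]
  by (simp_all add: gauss_integrable gauss_integral assms(1))

lemma normal_density_exp_shift:
  "std_normal_density x * exp (a * x) = exp (a\<^sup>2 / 2) * normal_density a 1 x"
proof -
  have "- x\<^sup>2 / 2 + a * x = a\<^sup>2 / 2 + - (x - a)\<^sup>2 / 2"
    by (simp add: power2_eq_square field_simps)
  then show ?thesis by (simp add: normal_density_def flip: exp_add)
qed

lemma gauss_exp_integrable: "integrable gauss (\<lambda>x. exp (a * x))"
  by (rule gauss_integrable_reweight[OF normal_density_exp_shift]) auto

lemma gauss_exp: "(\<integral>x. exp (a * x) \<partial>gauss) = exp (a\<^sup>2 / 2)"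
  by (rule gauss_integral_reweight[OF normal_density_exp_shift]) auto

lemma normal_density_exp_square:
  assumes "\<kappa> < 1"
  shows "std_normal_density x * exp (\<kappa> * x\<^sup>2 / 2)
    = 1 / sqrt (1 - \<kappa>) * normal_density 0 (1 / sqrt (1 - \<kappa>)) x"
proof -
  have "- x\<^sup>2 / 2 + \<kappa> * x\<^sup>2 / 2 = - (x\<^sup>2 * (1 - \<kappa>)) / 2"
    by (simp add: field_simps)
  then show ?thesis using assms
    by (simp add: normal_density_def real_sqrt_divide real_sqrt_mult field_simps flip: exp_add)
qed

lemma gauss_exp_square_integrable: "\<kappa> < 1 \<Longrightarrow> integrable gauss (\<lambda>x. exp (\<kappa> * x\<^sup>2 / 2))"
  by (rule gauss_integrable_reweight[OF normal_density_exp_square]) auto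

lemma gauss_exp_square: "\<kappa> < 1 \<Longrightarrow> (\<integral>x. exp (\<kappa> * x\<^sup>2 / 2) \<partial>gauss) = 1 / sqrt (1 - \<kappa>)"
  by (rule gauss_integral_reweight[OF normal_density_exp_square]) auto

lemma gauss_exp_abs_integrable: "integrable gauss (\<lambda>x. exp (B * \<bar>x\<bar>))"
proof (rule Bochner_Integration.integrable_bound)
  show "integrable gauss (\<lambda>x. exp (B * x) + exp (- B * x))"
    by (intro Bochner_Integration.integrable_add gauss_exp_integrable)
  show "AE x in gauss. norm (exp (B * \<bar>x\<bar>)) \<le> norm (exp (B * x) + exp (- B * x))"
  proof (intro AE_I2)
    fix x :: real
    have "exp (B * \<bar>x\<bar>) \<le> exp (B * x) + exp (- B * x)" by (simp add: abs_if)
    also have "\<dots> \<le> norm (exp (B * x) + exp (- B * x))" by (simp add: abs_ge_self)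
    finally show "norm (exp (B * \<bar>x\<bar>)) \<le> norm (exp (B * x) + exp (- B * x))" by simp
  qed
qed simp

text \<open>The density times F has derivative density times \<open>F' - y * F\<close>. At most
  exponential growth makes both integrals finite and the two boundary values 0, so the integral of
  this derivative vanishes.\<close>

lemma gauss_integration_by_parts_1:
  assumes D: "\<And>y. (F has_real_derivative F' y) (at y)" and C: "\<And>y. isCont F' y"
    and bounds: "\<And>y. \<bar>F y\<bar> \<le> A * exp (B * \<bar>y\<bar>)" "\<And>y. \<bar>F' y\<bar> \<le> A * exp (B * \<bar>y\<bar>)"
  shows "(\<integral>y. y * F y \<partial>gauss) = integral\<^sup>L gauss F'"
proof -
  have [measurable]: "F \<in> borel_measurable borel" "F' \<in> borel_measurable borel"
    using D C by (auto intro!: borel_measurable_continuous_onI continuous_at_imp_continuous_on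
      intro: DERIV_isCont)
  have A: "0 \<le> A" using bounds(1)[of 0] by simp
  let ?e = "\<lambda>y. A * exp ((B + 1) * \<bar>y\<bar>)"
  have int_e: "integrable gauss ?e"
    by (intro integrable_mult_right gauss_exp_abs_integrable)
  have int1: "integrable gauss (\<lambda>y. y * F y)"
  proof (rule Bochner_Integration.integrable_bound[OF int_e])
    have "\<bar>y * F y\<bar> \<le> ?e y" for y
    proof -
      have "\<bar>y\<bar> * \<bar>F y\<bar> \<le> exp \<bar>y\<bar> * (A * exp (B * \<bar>y\<bar>))"
      proof (intro mult_mono bounds)
        show "\<bar>y\<bar> \<le> exp \<bar>y\<bar>" using exp_ge_add_one_self[of "\<bar>y\<bar>"] by linarith
      qed auto
      then show ?thesis by (simp add: abs_mult exp_add algebra_simps)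
    qed
    then show "AE y in gauss. norm (y * F y) \<le> norm (?e y)" using A by simp
  qed simp
  have int2: "integrable gauss F'"
  proof (rule Bochner_Integration.integrable_bound[OF int_e])
    have "\<bar>F' y\<bar> \<le> ?e y" for y
    proof (rule order_trans[OF bounds(2)])
      show "A * exp (B * \<bar>y\<bar>) \<le> ?e y" using A by (intro mult_left_mono) (auto simp: distrib_right)
    qed
    then show "AE y in gauss. norm (F' y) \<le> norm (?e y)" using A by simp
  qed simp
  define g where "g y = std_normal_density y * (F' y - y * F y)" for y
  have int_g: "integrable lborel g"
    using Bochner_Integration.integrable_diff[OF int2 int1]
    unfolding g_def by (subst (asm) gauss_integrable) auto
  have dens: "(std_normal_density has_real_derivative - y * std_normal_density y) (at y)" for y
  proof -
    have "((\<lambda>y. exp (- y\<^sup>2 / 2)) has_real_derivative - y * exp (- y\<^sup>2 / 2)) (at y)"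
      by (auto intro!: derivative_eq_intros)
    from DERIV_cmult[OF this, of "1 / sqrt (2 * pi)"] show ?thesis
      unfolding std_normal_density_def by (simp add: mult_ac)
  qed
  \<comment> \<open>The filter is left open so that one estimate serves both ends of the
    line.\<close>
  have lim: "((\<lambda>y. std_normal_density y * F y) \<longlongrightarrow> 0) Q"
    if "((\<lambda>y. exp (B * \<bar>y\<bar> - y\<^sup>2 / 2)) \<longlongrightarrow> 0) Q" for Q
  proof (rule tendsto_0_le[OF that, where K = "1 / sqrt (2 * pi) * A"])
    show "\<forall>\<^sub>F y in Q. norm (std_normal_density y * F y)
        \<le> norm (exp (B * \<bar>y\<bar> - y\<^sup>2 / 2)) * (1 / sqrt (2 * pi) * A)"
    proof (intro always_eventually allI)
      fix y
      have "std_normal_density y * \<bar>F y\<bar> \<le> std_normal_density y * (A * exp (B * \<bar>y\<bar>))"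
        by (intro mult_left_mono bounds) auto
      moreover have "exp (B * \<bar>y\<bar> - y\<^sup>2 / 2) = exp (B * \<bar>y\<bar>) * exp (- y\<^sup>2 / 2)"
        by (simp flip: exp_add)
      moreover have "norm (exp (B * \<bar>y\<bar> - y\<^sup>2 / 2)) = exp (B * \<bar>y\<bar> - y\<^sup>2 / 2)"
        "norm (std_normal_density y * F y) = std_normal_density y * \<bar>F y\<bar>"
        by (simp_all add: abs_mult)
      ultimately show "norm (std_normal_density y * F y)
        \<le> norm (exp (B * \<bar>y\<bar> - y\<^sup>2 / 2)) * (1 / sqrt (2 * pi) * A)"
        by (simp add: std_normal_density_def mult_ac)
    qed
  qed
  have "(LBINT y=-\<infinity>..\<infinity>. g y) = 0 - 0"
  proof (rule interval_integral_FTC_integrable)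
    fix y
    have "((\<lambda>y. std_normal_density y * F y) has_real_derivative g y) (at y)"
      unfolding g_def by (auto intro!: derivative_eq_intros dens D simp: algebra_simps)
    then show "((\<lambda>y. std_normal_density y * F y) has_vector_derivative g y) (at y)"
      by (simp add: has_real_derivative_iff_has_vector_derivative)
    have "isCont std_normal_density y" using dens by (rule DERIV_isCont)
    then show "isCont g y"
      unfolding g_def using C DERIV_isCont[OF D] by (intro continuous_intros) auto
  next
    show "set_integrable lborel (einterval (-\<infinity>) \<infinity>) g"
      using int_g by (simp add: set_integrable_def)
    have "((\<lambda>y::real. exp (B * \<bar>y\<bar> - y\<^sup>2 / 2)) \<longlongrightarrow> 0) at_top"
         "((\<lambda>y::real. exp (B * \<bar>y\<bar> - y\<^sup>2 / 2)) \<longlongrightarrow> 0) at_bot"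
      by real_asymp+
    from this[THEN lim] show
      "(((\<lambda>y. std_normal_density y * F y) \<circ> real_of_ereal) \<longlongrightarrow> 0) (at_right (-\<infinity>))"
      "(((\<lambda>y. std_normal_density y * F y) \<circ> real_of_ereal) \<longlongrightarrow> 0) (at_left \<infinity>)"
      by (simp_all add: ereal_tendsto_simps)
  qed simp
  then have "integral\<^sup>L lborel g = 0"
    by (simp add: interval_lebesgue_integral_def set_lebesgue_integral_def)
  also have "integral\<^sup>L lborel g = (\<integral>y. F' y - y * F y \<partial>gauss)"
    unfolding g_def by (subst gauss_integral) auto
  also have "\<dots> = integral\<^sup>L gauss F' - (\<integral>y. y * F y \<partial>gauss)"
    by (rule Bochner_Integration.integral_diff[OF int2 int1])
  finally show ?thesis by simp
qed

lemma PiM_gauss_exp_integrable: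
  assumes "finite P"
  shows "integrable (PiM P (\<lambda>_. gauss)) (\<lambda>x. exp (B * (\<Sum>p\<in>P. \<bar>x p\<bar>)))"
proof -
  have "integrable (PiM P (\<lambda>_. gauss)) (\<lambda>x. \<Prod>p\<in>P. exp (B * \<bar>x p\<bar>))"
    by (intro gauss.product_integrable_prod assms gauss_exp_abs_integrable)
  then show ?thesis using assms by (simp add: sum_distrib_left exp_sum)
qed

lemma PiM_gauss_integrable:
  assumes "finite P" "f \<in> borel_measurable (PiM P (\<lambda>_. gauss))"
    and "\<And>x. \<bar>f x\<bar> \<le> A * exp (B * (\<Sum>p\<in>P. \<bar>x p\<bar>))"
  shows "integrable (PiM P (\<lambda>_. gauss)) f"
proof (rule Bochner_Integration.integrable_bound)
  show "integrable (PiM P (\<lambda>_. gauss)) (\<lambda>x. A * exp (B * (\<Sum>p\<in>P. \<bar>x p\<bar>)))"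
    by (intro integrable_mult_right PiM_gauss_exp_integrable assms)
  show "AE x in PiM P (\<lambda>_. gauss). norm (f x) \<le> norm (A * exp (B * (\<Sum>p\<in>P. \<bar>x p\<bar>)))"
    by (intro AE_I2) (metis assms(3) abs_ge_self order_trans real_norm_def)
qed (rule assms)

lemma abs_le_exp_sum:
  fixes x :: "'p \<Rightarrow> real"
  assumes "finite P" "p \<in> P"
  shows "\<bar>x p\<bar> \<le> exp (\<Sum>q\<in>P. \<bar>x q\<bar>)"
proof -
  have "\<bar>x p\<bar> \<le> (\<Sum>q\<in>P. \<bar>x q\<bar>)" using assms by (intro member_le_sum) auto
  also have "\<dots> \<le> exp (\<Sum>q\<in>P. \<bar>x q\<bar>)" using exp_ge_add_one_self[of "\<Sum>q\<in>P. \<bar>x q\<bar>"] by linarith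
  finally show ?thesis .
qed

lemma PiM_gauss_mult_integrable:
  assumes P: "finite P" "p \<in> P" and [measurable]: "F \<in> borel_measurable (PiM P (\<lambda>_. gauss))"
    and bound: "\<And>x. \<bar>F x\<bar> \<le> A * exp (B * (\<Sum>p\<in>P. \<bar>x p\<bar>))"
  shows "integrable (PiM P (\<lambda>_. gauss)) (\<lambda>x. x p * F x)"
proof (rule PiM_gauss_integrable)
  fix x :: "'a \<Rightarrow> real"
  have "\<bar>x p\<bar> * \<bar>F x\<bar> \<le> exp (\<Sum>q\<in>P. \<bar>x q\<bar>) * (A * exp (B * (\<Sum>p\<in>P. \<bar>x p\<bar>)))"
    by (intro mult_mono abs_le_exp_sum bound P) auto
  then show "\<bar>x p * F x\<bar> \<le> A * exp ((B + 1) * (\<Sum>p\<in>P. \<bar>x p\<bar>))"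
    by (simp add: abs_mult exp_add algebra_simps)
qed (use P in auto)

lemma gauss_integration_by_parts:
  assumes P: "finite P" "p \<in> P"
    and [measurable]: "F \<in> borel_measurable (PiM P (\<lambda>_. gauss))" "F' \<in> borel_measurable (PiM P (\<lambda>_. gauss))"
    and D: "\<And>x y. ((\<lambda>y. F (x(p := y))) has_real_derivative F' (x(p := y))) (at y)"
    and C: "\<And>x y. isCont (\<lambda>y. F' (x(p := y))) y"
    and bounds: "\<And>x. \<bar>F x\<bar> \<le> A * exp (B * (\<Sum>p\<in>P. \<bar>x p\<bar>))" "\<And>x. \<bar>F' x\<bar> \<le> A * exp (B * (\<Sum>p\<in>P. \<bar>x p\<bar>))"
  shows "(\<integral>x. x p * F x \<partial>PiM P (\<lambda>_. gauss)) = integral\<^sup>L (PiM P (\<lambda>_. gauss)) F'"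
proof -
  define I where "I = P - {p}"
  have I: "finite I" "p \<notin> I" "P = insert p I" using P by (auto simp: I_def)
  have int1: "integrable (PiM (insert p I) (\<lambda>_. gauss)) (\<lambda>x. x p * F x)"
    unfolding I(3)[symmetric] by (intro PiM_gauss_mult_integrable[OF _ _ _ bounds(1)]) (use P in auto)
  have int2: "integrable (PiM (insert p I) (\<lambda>_. gauss)) F'"
    unfolding I(3)[symmetric] by (intro PiM_gauss_integrable[OF _ _ bounds(2)]) (use P in auto)
  have sum_upd: "(\<Sum>q\<in>P. \<bar>(x(p := y)) q\<bar>) = \<bar>y\<bar> + (\<Sum>q\<in>I. \<bar>x q\<bar>)" for x y
  proof -
    have "(\<Sum>q\<in>I. \<bar>if q = p then y else x q\<bar>) = (\<Sum>q\<in>I. \<bar>x q\<bar>)"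
      using I by (intro sum.cong) auto
    then show ?thesis using I by simp
  qed
  have "(\<integral>x. x p * F x \<partial>PiM P (\<lambda>_. gauss))
    = (\<integral>x. \<integral>y. (x(p := y)) p * F (x(p := y)) \<partial>gauss \<partial>PiM I (\<lambda>_. gauss))"
    unfolding I(3) by (rule gauss.product_integral_insert[OF I(1,2) int1])
  also have "\<dots> = (\<integral>x. \<integral>y. F' (x(p := y)) \<partial>gauss \<partial>PiM I (\<lambda>_. gauss))"
  proof (rule Bochner_Integration.integral_cong[OF refl])
    fix x :: "'a \<Rightarrow> real"
    have "(\<integral>y. y * F (x(p := y)) \<partial>gauss) = (\<integral>y. F' (x(p := y)) \<partial>gauss)"
    proof (rule gauss_integration_by_parts_1[where A = "A * exp (B * (\<Sum>q\<in>I. \<bar>x q\<bar>))" and B = B])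
      fix y show "\<bar>F (x(p := y))\<bar> \<le> A * exp (B * (\<Sum>q\<in>I. \<bar>x q\<bar>)) * exp (B * \<bar>y\<bar>)"
        using bounds(1)[of "x(p := y)"] unfolding sum_upd by (simp add: exp_add distrib_left mult_ac)
      show "\<bar>F' (x(p := y))\<bar> \<le> A * exp (B * (\<Sum>q\<in>I. \<bar>x q\<bar>)) * exp (B * \<bar>y\<bar>)"
        using bounds(2)[of "x(p := y)"] unfolding sum_upd by (simp add: exp_add distrib_left mult_ac)
    qed (use D C in auto)
    then show "(\<integral>y. (x(p := y)) p * F (x(p := y)) \<partial>gauss) = (\<integral>y. F' (x(p := y)) \<partial>gauss)"
      by simp
  qed
  also have "\<dots> = integral\<^sup>L (PiM P (\<lambda>_. gauss)) F'"
    unfolding I(3) by (rule gauss.product_integral_insert[OF I(1,2) int2, symmetric])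
  finally show ?thesis .
qed

text \<open>Differentiation under the integral: by the mean value inequality g dominates all
  difference quotients near s0, and dominated convergence applies along every sequence tending to
  s0.\<close>

lemma has_real_derivative_integral:
  fixes f :: "real \<Rightarrow> 'a \<Rightarrow> real"
  assumes d: "0 < d"
    and D: "\<And>s x. \<bar>s - s0\<bar> < d \<Longrightarrow> x \<in> space M \<Longrightarrow> ((\<lambda>s. f s x) has_real_derivative f' s x) (at s)"
    and B: "\<And>s x. \<bar>s - s0\<bar> < d \<Longrightarrow> x \<in> space M \<Longrightarrow> \<bar>f' s x\<bar> \<le> g x"
    and int: "integrable M g" "\<And>s. \<bar>s - s0\<bar> < d \<Longrightarrow> integrable M (f s)"
    and [measurable]: "f' s0 \<in> borel_measurable M"
  shows "((\<lambda>s. integral\<^sup>L M (f s)) has_real_derivative integral\<^sup>L M (f' s0)) (at s0)"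
  unfolding has_field_derivative_iff tendsto_at_iff_sequentially
proof (intro allI impI)
  fix X :: "nat \<Rightarrow> real" assume X: "\<forall>i. X i \<in> UNIV - {s0}" "X \<longlonglongrightarrow> s0"
  have "\<forall>\<^sub>F i in sequentially. \<bar>X i - s0\<bar> < d"
    using X(2) d by (auto dest: tendstoD simp: dist_real_def)
  then obtain n where n: "\<And>i. n \<le> i \<Longrightarrow> \<bar>X i - s0\<bar> < d" by (auto simp: eventually_sequentially)
  \<comment> \<open>Shifted so that every member, and not only almost all, lies in the neighbourhood
    where the hypotheses hold.\<close>
  define Y where "Y i = X (i + n)" for i
  have Y: "\<And>i. Y i \<noteq> s0" "Y \<longlonglongrightarrow> s0" "\<And>i. \<bar>Y i - s0\<bar> < d"
    unfolding Y_def using X n LIMSEQ_ignore_initial_segment by auto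
  have int_s0: "integrable M (f s0)" using int(2)[of s0] d by simp
  have "(\<lambda>i. \<integral>x. (f (Y i) x - f s0 x) / (Y i - s0) \<partial>M) \<longlonglongrightarrow> integral\<^sup>L M (f' s0)"
  proof (rule integral_dominated_convergence[where w = g])
    show "(\<lambda>x. (f (Y i) x - f s0 x) / (Y i - s0)) \<in> borel_measurable M" for i
      using int(2)[OF Y(3)[of i]] int_s0 by auto
    have "(\<lambda>i. (f (Y i) x - f s0 x) / (Y i - s0)) \<longlonglongrightarrow> f' s0 x" if "x \<in> space M" for x
    proof -
      have "((\<lambda>s. (f s x - f s0 x) / (s - s0)) \<longlongrightarrow> f' s0 x) (at s0)"
        using D[of s0 x] d that by (simp add: has_field_derivative_iff)
      with Y show ?thesis unfolding tendsto_at_iff_sequentially by (auto simp: comp_def)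
    qed
    then show "AE x in M. (\<lambda>i. (f (Y i) x - f s0 x) / (Y i - s0)) \<longlonglongrightarrow> f' s0 x" by simp
    have "\<bar>f (Y i) x - f s0 x\<bar> \<le> g x * \<bar>Y i - s0\<bar>" if x: "x \<in> space M" for i x
    proof -
      have "norm (f (Y i) x - f s0 x) \<le> g x * norm (Y i - s0)"
      proof (rule field_differentiable_bound[where S = "{s. \<bar>s - s0\<bar> < d}"])
        have "{s. \<bar>s - s0\<bar> < d} = ball s0 d" by (auto simp: dist_real_def)
        then show "convex {s. \<bar>s - s0\<bar> < d}" by simp
      qed (use D B x Y d in \<open>auto intro: DERIV_subset\<close>)
      then show ?thesis by simp
    qed
    then show "\<And>i. AE x in M. norm ((f (Y i) x - f s0 x) / (Y i - s0)) \<le> g x"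
      using Y(1) by (auto simp: divide_le_eq)
  qed (use int in auto)
  also have "(\<lambda>i. \<integral>x. (f (Y i) x - f s0 x) / (Y i - s0) \<partial>M)
      = (\<lambda>i. (integral\<^sup>L M (f (Y i)) - integral\<^sup>L M (f s0)) / (Y i - s0))"
    using int(2)[OF Y(3)] int_s0 by (simp add: fun_eq_iff)
  finally show "((\<lambda>y. (integral\<^sup>L M (f y) - integral\<^sup>L M (f s0)) / (y - s0)) \<circ> X)
      \<longlonglongrightarrow> integral\<^sup>L M (f' s0)"
    unfolding Y_def comp_def by (rule LIMSEQ_offset)
qed

section \<open>Gibbs averages with Gaussian couplings\<close>

definition cav_mult :: "('c \<Rightarrow> real) \<Rightarrow> nat \<Rightarrow> ((nat \<Rightarrow> 'c) \<Rightarrow> real) \<Rightarrow> (nat \<Rightarrow> 'c) \<Rightarrow> real" where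
  "cav_mult d n f s = f s * (\<Sum>l = 1..Suc n. cav_coeff n l * d (s l))"

lemma depends_on_cav_mult:
  assumes "depends_on {1..n} f"
  shows "depends_on {1..Suc n} (cav_mult d n f)"
proof (rule depends_onI)
  fix s s' :: "nat \<Rightarrow> 'a" assume eq: "\<And>l. l \<in> {1..Suc n} \<Longrightarrow> s l = s' l"
  then have "f s = f s'" using assms unfolding depends_on_def by auto
  then show "cav_mult d n f s = cav_mult d n f s'"
    unfolding cav_mult_def using eq by simp
qed

text \<open>The strengths c are arguments of \<open>energy\<close> and not locale parameters,
  because they vary with the temperature and along the cavity path.\<close>

locale gaussian_gibbs =
  fixes P :: "'p set" and S :: "'c set" and v :: "'p \<Rightarrow> 'c \<Rightarrow> real"
  assumes finite_P: "finite P" and finite_S: "finite S" and S_nonempty: "S \<noteq> {}"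
begin

abbreviation couplings :: "('p \<Rightarrow> real) measure" where
  "couplings \<equiv> PiM P (\<lambda>_. gauss)"

sublocale couplings: prob_space couplings
  by (rule prob_space_PiM_gauss)

definition energy :: "('p \<Rightarrow> real) \<Rightarrow> ('p \<Rightarrow> real) \<Rightarrow> 'c \<Rightarrow> real" where
  "energy c x \<sigma> = (\<Sum>p\<in>P. c p * x p * v p \<sigma>)"

definition bracket :: "('p \<Rightarrow> real) \<Rightarrow> ('p \<Rightarrow> real) \<Rightarrow> nat \<Rightarrow> ((nat \<Rightarrow> 'c) \<Rightarrow> real) \<Rightarrow> real" where
  "bracket c x n f = replica_avg S (gibbs_weight S (energy c x)) {1..n} f"

definition mean :: "('p \<Rightarrow> real) \<Rightarrow> nat \<Rightarrow> ((nat \<Rightarrow> 'c) \<Rightarrow> real) \<Rightarrow> real" where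
  "mean c n f = (\<integral>x. bracket c x n f \<partial>couplings)"

lemma energy_measurable [measurable]: "(\<lambda>x. energy c x \<sigma>) \<in> borel_measurable couplings"
  unfolding energy_def by measurable

lemma gibbs_weight_measurable [measurable]:
  "(\<lambda>x. gibbs_weight S (energy c x) \<sigma>) \<in> borel_measurable couplings"
  unfolding gibbs_weight_def by measurable

lemma bracket_measurable [measurable]: "(\<lambda>x. bracket c x n f) \<in> borel_measurable couplings"
  unfolding bracket_def replica_avg_def by measurable

lemma observable_bounded:
  fixes f :: "(nat \<Rightarrow> 'c) \<Rightarrow> real"
  shows "\<exists>B\<ge>0. \<forall>s\<in>{1..n} \<rightarrow>\<^sub>E S. \<bar>f s\<bar> \<le> B"
proof (intro exI conjI ballI)
  show "0 \<le> (\<Sum>s\<in>{1..n} \<rightarrow>\<^sub>E S. \<bar>f s\<bar>)" by (rule sum_nonneg) simp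
  show "\<bar>f s\<bar> \<le> (\<Sum>s\<in>{1..n} \<rightarrow>\<^sub>E S. \<bar>f s\<bar>)" if "s \<in> {1..n} \<rightarrow>\<^sub>E S" for s
    using that finite_S by (intro member_le_sum) (auto intro: finite_PiE)
qed

lemma bracket_bound:
  "(\<And>s. s \<in> {1..n} \<rightarrow>\<^sub>E S \<Longrightarrow> \<bar>f s\<bar> \<le> B) \<Longrightarrow> \<bar>bracket c x n f\<bar> \<le> B"
  unfolding bracket_def by (rule replica_avg_bound) (use finite_S S_nonempty in auto)

lemma bracket_integrable: "integrable couplings (\<lambda>x. bracket c x n f)"
proof -
  obtain B where B: "\<forall>s\<in>{1..n} \<rightarrow>\<^sub>E S. \<bar>f s\<bar> \<le> B" using observable_bounded by blast
  show ?thesis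
    by (rule couplings.integrable_const_bound[where B = B]) (use B bracket_bound in auto)
qed

lemma mean_add: "mean c n (\<lambda>s. f s + g s) = mean c n f + mean c n g"
  unfolding mean_def by (subst Bochner_Integration.integral_add[symmetric, OF bracket_integrable bracket_integrable])
    (simp add: bracket_def replica_avg_add)

lemma mean_sum: "mean c n (\<lambda>s. \<Sum>i\<in>A. f i s) = (\<Sum>i\<in>A. mean c n (f i))"
  unfolding mean_def by (subst Bochner_Integration.integral_sum[symmetric, OF bracket_integrable])
    (simp add: bracket_def replica_avg_sum)

lemma mean_cmult: "mean c n (\<lambda>s. a * f s) = a * mean c n f"
  unfolding mean_def bracket_def by (simp add: replica_avg_cmult)

lemma mean_const: "mean c n (\<lambda>_. a) = a"
  unfolding mean_def bracket_def
  by (simp add: replica_avg_const finite_S S_nonempty gibbs_weight_sum couplings.prob_space)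

lemma mean_cong: "(\<And>s. s \<in> {1..n} \<rightarrow>\<^sub>E S \<Longrightarrow> f s = g s) \<Longrightarrow> mean c n f = mean c n g"
  unfolding mean_def bracket_def using replica_avg_cong[of "{1..n}" S f g] by simp

lemma bracket_mono:
  "(\<And>s. s \<in> {1..n} \<rightarrow>\<^sub>E S \<Longrightarrow> f s \<le> g s) \<Longrightarrow> bracket c x n f \<le> bracket c x n g"
  unfolding bracket_def
  by (rule replica_avg_mono) (auto intro: less_imp_le gibbs_weight_pos finite_S S_nonempty)

lemma mean_mono:
  "(\<And>s. s \<in> {1..n} \<rightarrow>\<^sub>E S \<Longrightarrow> f s \<le> g s) \<Longrightarrow> mean c n f \<le> mean c n g"
  unfolding mean_def by (intro integral_mono bracket_integrable bracket_mono) auto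

lemma mean_abs: "\<bar>mean c n f\<bar> \<le> mean c n (\<lambda>s. \<bar>f s\<bar>)"
  using mean_mono[of n f "\<lambda>s. \<bar>f s\<bar>" c] mean_mono[of n "\<lambda>s. -1 * f s" "\<lambda>s. \<bar>f s\<bar>" c]
  unfolding mean_cmult by (auto simp: abs_le_iff)

lemma mean_marginal:
  assumes "depends_on {1..n} f" "n \<le> m"
  shows "mean c m f = mean c n f"
  unfolding mean_def bracket_def
  using assms by (subst replica_avg_marginal[where I = "{1..n}"]) (auto simp: finite_S S_nonempty gibbs_weight_sum)

lemma energy_upd:
  assumes "p \<in> P"
  shows "((\<lambda>y. energy c (x(p := y)) \<sigma>) has_real_derivative c p * v p \<sigma>) (at y)"
proof -
  have "energy c (x(p := y)) \<sigma> = c p * y * v p \<sigma> + (\<Sum>q\<in>P - {p}. c q * x q * v q \<sigma>)" for y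
  proof -
    have "(\<Sum>q\<in>P - {p}. c q * (x(p := y)) q * v q \<sigma>) = (\<Sum>q\<in>P - {p}. c q * x q * v q \<sigma>)"
      by (intro sum.cong) auto
    then show ?thesis unfolding energy_def
      using sum.remove[OF finite_P assms, of "\<lambda>q. c q * (x(p := y)) q * v q \<sigma>"] by simp
  qed
  then show ?thesis by (auto intro!: derivative_eq_intros)
qed

lemma bracket_deriv_coupling:
  assumes "p \<in> P" "depends_on {1..n} f"
  shows "((\<lambda>y. bracket c (x(p := y)) n f) has_real_derivative
    c p * bracket c (x(p := y)) (Suc n) (cav_mult (v p) n f)) (at y)"
proof -
  have "replica_avg S (gibbs_weight S (energy c (x(p := y)))) {1..Suc n}
      (\<lambda>s. f s * (\<Sum>l = 1..Suc n. cav_coeff n l * (c p * v p (s l))))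
    = c p * replica_avg S (gibbs_weight S (energy c (x(p := y)))) {1..Suc n} (cav_mult (v p) n f)"
    unfolding replica_avg_cmult[symmetric] cav_mult_def
    by (intro replica_avg_cong) (simp only: sum_distrib_left mult_ac)
  with replica_avg_deriv[OF finite_S S_nonempty assms(2), of "\<lambda>y. energy c (x(p := y))" "\<lambda>\<sigma>. c p * v p \<sigma>" y]
    energy_upd[OF assms(1)]
  show ?thesis unfolding bracket_def by simp
qed

text \<open>Integration by parts trades the factor \<open>x p\<close> for a derivative in that
  coupling, which adds a replica. Brackets are bounded uniformly in the couplings, hence the growth
  rate \<open>B = 0\<close>.\<close>

lemma integral_coupling_bracket:
  assumes "p \<in> P" "depends_on {1..n} f"
  shows "(\<integral>x. x p * bracket c x n f \<partial>couplings) = c p * mean c (Suc n) (cav_mult (v p) n f)"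
proof -
  let ?g = "cav_mult (v p) n f"
  obtain A where A: "A \<ge> 0" "\<forall>s\<in>{1..n} \<rightarrow>\<^sub>E S. \<bar>f s\<bar> \<le> A" using observable_bounded by blast
  obtain B where B: "B \<ge> 0" "\<forall>s\<in>{1..Suc n} \<rightarrow>\<^sub>E S. \<bar>?g s\<bar> \<le> B" using observable_bounded by blast
  have "(\<integral>x. x p * bracket c x n f \<partial>couplings) = (\<integral>x. c p * bracket c x (Suc n) ?g \<partial>couplings)"
  proof (rule gauss_integration_by_parts[where A = "A + \<bar>c p\<bar> * B" and B = 0])
    show "\<bar>bracket c x n f\<bar> \<le> (A + \<bar>c p\<bar> * B) * exp (0 * (\<Sum>p\<in>P. \<bar>x p\<bar>))" for x
    proof -
      have "\<bar>bracket c x n f\<bar> \<le> A" by (rule bracket_bound) (use A in auto)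
      moreover have "0 \<le> \<bar>c p\<bar> * B" using B by simp
      ultimately show ?thesis by simp
    qed
    show "\<bar>c p * bracket c x (Suc n) ?g\<bar> \<le> (A + \<bar>c p\<bar> * B) * exp (0 * (\<Sum>p\<in>P. \<bar>x p\<bar>))" for x
    proof -
      have "\<bar>bracket c x (Suc n) ?g\<bar> \<le> B" by (rule bracket_bound) (use B in auto)
      then have "\<bar>c p\<bar> * \<bar>bracket c x (Suc n) ?g\<bar> \<le> \<bar>c p\<bar> * B" by (intro mult_left_mono) auto
      then show ?thesis using A by (simp add: abs_mult)
    qed
    show "isCont (\<lambda>y. c p * bracket c (x(p := y)) (Suc n) ?g) y" for x y
      by (intro continuous_intros
          DERIV_isCont[OF bracket_deriv_coupling[OF assms(1) depends_on_cav_mult[OF assms(2)]]])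
  qed (use assms finite_P bracket_deriv_coupling in auto)
  then show ?thesis by (simp add: mean_def)
qed

lemma bracket_deriv_path:
  assumes "depends_on {1..n} f"
  shows "((\<lambda>s. bracket (\<lambda>p. a p + s * c' p) x n f) has_real_derivative
    (\<Sum>p\<in>P. c' p * (x p * bracket (\<lambda>p. a p + s * c' p) x (Suc n) (cav_mult (v p) n f)))) (at s)"
proof -
  let ?W = "gibbs_weight S (energy (\<lambda>p. a p + s * c' p) x)"
  have "((\<lambda>s. energy (\<lambda>p. a p + s * c' p) x \<sigma>) has_real_derivative (\<Sum>p\<in>P. c' p * x p * v p \<sigma>)) (at s)" for \<sigma>
    unfolding energy_def by (intro DERIV_sum) (auto intro!: derivative_eq_intros)
  note D = replica_avg_deriv[OF finite_S S_nonempty assms, of "\<lambda>s. energy (\<lambda>p. a p + s * c' p) x", OF this]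
  have "replica_avg S ?W {1..Suc n} (\<lambda>t. f t * (\<Sum>l = 1..Suc n. cav_coeff n l * (\<Sum>p\<in>P. c' p * x p * v p (t l))))
    = replica_avg S ?W {1..Suc n} (\<lambda>t. \<Sum>p\<in>P. c' p * x p * cav_mult (v p) n f t)"
  proof (rule replica_avg_cong)
    fix t
    have "(\<Sum>l = 1..Suc n. cav_coeff n l * (\<Sum>p\<in>P. c' p * x p * v p (t l)))
        = (\<Sum>p\<in>P. \<Sum>l = 1..Suc n. c' p * x p * (cav_coeff n l * v p (t l)))"
      unfolding sum_distrib_left by (subst sum.swap) (simp only: mult_ac)
    then show "f t * (\<Sum>l = 1..Suc n. cav_coeff n l * (\<Sum>p\<in>P. c' p * x p * v p (t l)))
        = (\<Sum>p\<in>P. c' p * x p * cav_mult (v p) n f t)"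
      unfolding cav_mult_def by (simp only: sum_distrib_left mult_ac)
  qed
  also have "\<dots> = (\<Sum>p\<in>P. c' p * (x p * replica_avg S ?W {1..Suc n} (cav_mult (v p) n f)))"
    by (simp add: replica_avg_sum replica_avg_cmult mult_ac)
  finally show ?thesis using D unfolding bracket_def by simp
qed

text \<open>Two replicas appear per derivative: one from differentiating the Gibbs weights, one from
  the integration by parts that removes the coupling left by it.\<close>

lemma mean_deriv_path:
  assumes f: "depends_on {1..n} f"
  shows "((\<lambda>s. mean (\<lambda>p. a p + s * c' p) n f) has_real_derivative
    (\<Sum>p\<in>P. c' p * (a p + s * c' p) *
      mean (\<lambda>p. a p + s * c' p) (Suc (Suc n)) (cav_mult (v p) (Suc n) (cav_mult (v p) n f)))) (at s)"
proof -
  let ?c = "\<lambda>s p. a p + s * c' p"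
  let ?d = "\<lambda>s x. \<Sum>p\<in>P. c' p * (x p * bracket (?c s) x (Suc n) (cav_mult (v p) n f))"
  have "\<exists>B\<ge>0. \<forall>t\<in>{1..Suc n} \<rightarrow>\<^sub>E S. \<bar>cav_mult (v p) n f t\<bar> \<le> B" for p
    by (rule observable_bounded)
  then obtain B where B: "\<And>p. B p \<ge> 0" "\<And>p t. t \<in> {1..Suc n} \<rightarrow>\<^sub>E S \<Longrightarrow> \<bar>cav_mult (v p) n f t\<bar> \<le> B p"
    by metis
  have int_x: "integrable couplings (\<lambda>x. x p * F x)"
    if "p \<in> P" "F \<in> borel_measurable couplings" "\<And>x. \<bar>F x\<bar> \<le> A" for p F A
    using PiM_gauss_mult_integrable[OF finite_P that(1,2), of A 0] that(3) by simp
  have int_br: "integrable couplings (\<lambda>x. x p * bracket c x m g)" if "p \<in> P" for p c m g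
  proof -
    obtain A where "\<forall>s\<in>{1..m} \<rightarrow>\<^sub>E S. \<bar>g s\<bar> \<le> A" using observable_bounded by blast
    then have "\<bar>bracket c x m g\<bar> \<le> A" for x by (intro bracket_bound) auto
    then show ?thesis by (rule int_x[OF that bracket_measurable])
  qed
  have "((\<lambda>s. \<integral>x. bracket (?c s) x n f \<partial>couplings) has_real_derivative (\<integral>x. ?d s x \<partial>couplings)) (at s)"
  proof (rule has_real_derivative_integral[where d = 1 and g = "\<lambda>x. \<Sum>p\<in>P. \<bar>c' p\<bar> * (\<bar>x p\<bar> * B p)"])
    show "((\<lambda>s. bracket (?c s) x n f) has_real_derivative ?d s x) (at s)" for s x
      by (rule bracket_deriv_path[OF f])
    show "\<bar>?d s x\<bar> \<le> (\<Sum>p\<in>P. \<bar>c' p\<bar> * (\<bar>x p\<bar> * B p))" for s x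
    proof (rule order_trans[OF sum_abs], rule sum_mono)
      fix p
      have "\<bar>bracket (?c s) x (Suc n) (cav_mult (v p) n f)\<bar> \<le> B p"
        by (rule bracket_bound[OF B(2)])
      then show "\<bar>c' p * (x p * bracket (?c s) x (Suc n) (cav_mult (v p) n f))\<bar> \<le> \<bar>c' p\<bar> * (\<bar>x p\<bar> * B p)"
        unfolding abs_mult by (intro mult_left_mono) auto
    qed
    have "integrable couplings (\<lambda>x. \<bar>x p\<bar>)" if "p \<in> P" for p
      using int_x[OF that, of "\<lambda>_. 1" 1] by (auto intro: integrable_abs)
    then show "integrable couplings (\<lambda>x. \<Sum>p\<in>P. \<bar>c' p\<bar> * (\<bar>x p\<bar> * B p))"
      by (intro Bochner_Integration.integrable_sum integrable_mult_right integrable_mult_left) auto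
  qed (auto intro: bracket_integrable)
  also have "(\<integral>x. ?d s x \<partial>couplings) = (\<Sum>p\<in>P. c' p * (\<integral>x. x p * bracket (?c s) x (Suc n) (cav_mult (v p) n f) \<partial>couplings))"
    using int_br by (subst Bochner_Integration.integral_sum) auto
  also have "\<dots> = (\<Sum>p\<in>P. c' p * (a p + s * c' p) *
      mean (\<lambda>p. a p + s * c' p) (Suc (Suc n)) (cav_mult (v p) (Suc n) (cav_mult (v p) n f)))"
    by (intro sum.cong refl) (subst integral_coupling_bracket[OF _ depends_on_cav_mult[OF f]], auto simp: mult_ac)
  finally show ?thesis unfolding mean_def .
qed

end

section \<open>Annealed comparison\<close>

text \<open>Because \<open>(v p \<sigma>)^2\<close> is constant, all configurations have energies of
  the same variance \<open>b^2 * w * card P\<close>, and the mean of \<open>Z b\<close> is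
  explicit.\<close>

locale gaussian_gibbs_unit = gaussian_gibbs P S v
  for P :: "'p set" and S :: "'c set" and v :: "'p \<Rightarrow> 'c \<Rightarrow> real" +
  fixes w :: real
  assumes v_square: "p \<in> P \<Longrightarrow> \<sigma> \<in> S \<Longrightarrow> (v p \<sigma>)\<^sup>2 = w" and w_nonneg: "0 \<le> w"
begin

abbreviation hom_energy :: "real \<Rightarrow> ('p \<Rightarrow> real) \<Rightarrow> 'c \<Rightarrow> real" where
  "hom_energy b x \<equiv> energy (\<lambda>_. b) x"

abbreviation W :: "real \<Rightarrow> ('p \<Rightarrow> real) \<Rightarrow> 'c \<Rightarrow> real" where
  "W b x \<equiv> gibbs_weight S (hom_energy b x)"

abbreviation Z :: "real \<Rightarrow> ('p \<Rightarrow> real) \<Rightarrow> real" where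
  "Z b x \<equiv> (\<Sum>\<sigma>\<in>S. exp (hom_energy b x \<sigma>))"

text \<open>\<open>log_ratio b x = ln (E (Z b) / Z b x)\<close>, as \<open>E (Z b) = card S * exp (b\<^sup>2 * w * card P / 2)\<close>.\<close>

definition log_ratio :: "real \<Rightarrow> ('p \<Rightarrow> real) \<Rightarrow> real" where
  "log_ratio b x = ln (card S) + b\<^sup>2 * w * card P / 2 - ln (Z b x)"

text \<open>The covariance of the energies of two configurations at \<open>b = 1\<close>.\<close>

definition corr :: "'c \<Rightarrow> 'c \<Rightarrow> real" where
  "corr \<sigma> \<tau> = (\<Sum>p\<in>P. v p \<sigma> * v p \<tau>)"

definition pair_avg :: "real \<Rightarrow> ('p \<Rightarrow> real) \<Rightarrow> ('c \<Rightarrow> 'c \<Rightarrow> real) \<Rightarrow> real" where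
  "pair_avg b x g = (\<Sum>\<sigma>\<in>S. \<Sum>\<tau>\<in>S. W b x \<sigma> * W b x \<tau> * g \<sigma> \<tau>)"

definition magn :: "real \<Rightarrow> ('p \<Rightarrow> real) \<Rightarrow> 'p \<Rightarrow> real" where
  "magn b x p = (\<Sum>\<sigma>\<in>S. W b x \<sigma> * v p \<sigma>)"

lemma card_S_pos: "0 < card S"
  using finite_S S_nonempty by (simp add: card_gt_0_iff)

lemma Z_pos: "0 < Z b x"
  using finite_S S_nonempty by (intro sum_pos) auto

lemma W_pos: "0 < W b x \<sigma>"
  by (rule gibbs_weight_pos[OF finite_S S_nonempty])

lemma W_sum: "(\<Sum>\<sigma>\<in>S. W b x \<sigma>) = 1"
  by (rule gibbs_weight_sum[OF finite_S S_nonempty])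

lemma log_ratio_measurable [measurable]: "log_ratio b \<in> borel_measurable couplings"
  unfolding log_ratio_def by measurable

lemma pair_avg_measurable [measurable]: "(\<lambda>x. pair_avg b x g) \<in> borel_measurable couplings"
  unfolding pair_avg_def by measurable

lemma magn_measurable [measurable]: "(\<lambda>x. magn b x p) \<in> borel_measurable couplings"
  unfolding magn_def by measurable

lemma abs_v: "p \<in> P \<Longrightarrow> \<sigma> \<in> S \<Longrightarrow> \<bar>v p \<sigma>\<bar> = sqrt w"
  using v_square[of p \<sigma>] by (metis real_sqrt_abs)

lemma energy_bound:
  assumes "\<sigma> \<in> S"
  shows "\<bar>hom_energy b x \<sigma>\<bar> \<le> \<bar>b\<bar> * sqrt w * (\<Sum>p\<in>P. \<bar>x p\<bar>)"
proof -
  have "\<bar>hom_energy b x \<sigma>\<bar> \<le> (\<Sum>p\<in>P. \<bar>b * x p * v p \<sigma>\<bar>)"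
    unfolding energy_def by (rule sum_abs)
  also have "\<dots> = (\<Sum>p\<in>P. \<bar>b\<bar> * sqrt w * \<bar>x p\<bar>)"
    using assms by (intro sum.cong) (auto simp: abs_mult abs_v)
  finally show ?thesis by (simp add: sum_distrib_left)
qed

text \<open>Linear growth in the couplings makes every power of E Z / Z integrable and admissible
  for integration by parts.\<close>

lemma log_ratio_bound:
  "\<bar>log_ratio b x\<bar> \<le> b\<^sup>2 * w * card P / 2 + \<bar>b\<bar> * sqrt w * (\<Sum>p\<in>P. \<bar>x p\<bar>)" (is "_ \<le> _ + ?e")
proof -
  have card: "0 < real (card S)" using card_S_pos by simp
  have "Z b x \<le> (\<Sum>\<sigma>\<in>S. exp ?e)"
    using energy_bound[of _ b x] by (intro sum_mono) (auto simp: abs_le_iff)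
  then have "ln (Z b x) \<le> ln (card S * exp ?e)" 
    using Z_pos mult_pos_pos[OF card exp_gt_zero] by (simp only: ln_le_cancel_iff sum_constant)
  then have 1: "ln (Z b x) \<le> ln (card S) + ?e" using card by (simp add: ln_mult)
  have "(\<Sum>\<sigma>\<in>S. exp (- ?e)) \<le> Z b x"
  proof (rule sum_mono)
    fix \<sigma> assume "\<sigma> \<in> S"
    from energy_bound[OF this, of b x] show "exp (- ?e) \<le> exp (hom_energy b x \<sigma>)"
      by (simp add: abs_le_iff)
  qed
  then have "ln (card S * exp (- ?e)) \<le> ln (Z b x)" 
    using Z_pos mult_pos_pos[OF card exp_gt_zero] by (simp only: ln_le_cancel_iff sum_constant)
  then have 2: "ln (card S) - ?e \<le> ln (Z b x)" using card by (simp add: ln_mult)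
  have "0 \<le> b\<^sup>2 * w * card P / 2" using w_nonneg by simp
  with 1 2 show ?thesis unfolding log_ratio_def by (simp add: abs_le_iff)
qed

lemma magn_bound: "p \<in> P \<Longrightarrow> \<bar>magn b x p\<bar> \<le> sqrt w"
proof -
  assume p: "p \<in> P"
  have "\<bar>magn b x p\<bar> \<le> (\<Sum>\<sigma>\<in>S. \<bar>W b x \<sigma> * v p \<sigma>\<bar>)" unfolding magn_def by (rule sum_abs)
  also have "\<dots> = (\<Sum>\<sigma>\<in>S. W b x \<sigma> * sqrt w)"
    using p W_pos by (intro sum.cong refl) (auto simp: abs_mult abs_v less_imp_le)
  finally show ?thesis by (simp flip: sum_distrib_right add: W_sum)
qed

lemma log_ratio_deriv_temp:
  "((\<lambda>b. log_ratio b x) has_real_derivative b * w * card P - (\<Sum>p\<in>P. x p * magn b x p)) (at b)"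
proof -
  have "((\<lambda>b. hom_energy b x \<sigma>) has_real_derivative (\<Sum>p\<in>P. x p * v p \<sigma>)) (at b)" for \<sigma>
    unfolding energy_def by (intro DERIV_sum) (auto intro!: derivative_eq_intros)
  from log_partition_deriv[OF finite_S S_nonempty this]
  have "((\<lambda>b. ln (Z b x)) has_real_derivative (\<Sum>\<sigma>\<in>S. W b x \<sigma> * (\<Sum>p\<in>P. x p * v p \<sigma>))) (at b)" .
  also have "(\<Sum>\<sigma>\<in>S. W b x \<sigma> * (\<Sum>p\<in>P. x p * v p \<sigma>)) = (\<Sum>p\<in>P. x p * magn b x p)"
    unfolding magn_def sum_distrib_left by (subst sum.swap) (simp add: mult_ac)
  finally have D: "((\<lambda>b. ln (Z b x)) has_real_derivative (\<Sum>p\<in>P. x p * magn b x p)) (at b)" .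
  have "((\<lambda>b. ln (card S) + b\<^sup>2 * w * card P / 2) has_real_derivative b * w * card P) (at b)"
    by (auto intro!: derivative_eq_intros)
  from DERIV_diff[OF this D] show ?thesis unfolding log_ratio_def .
qed

lemma log_ratio_deriv_coupling:
  assumes "p \<in> P"
  shows "((\<lambda>y. log_ratio b (x(p := y))) has_real_derivative - b * magn b (x(p := y)) p) (at y)"
proof -
  from log_partition_deriv[OF finite_S S_nonempty energy_upd[OF assms]]
  have "((\<lambda>y. ln (Z b (x(p := y)))) has_real_derivative (\<Sum>\<sigma>\<in>S. W b (x(p := y)) \<sigma> * (b * v p \<sigma>))) (at y)" .
  also have "(\<Sum>\<sigma>\<in>S. W b (x(p := y)) \<sigma> * (b * v p \<sigma>)) = b * magn b (x(p := y)) p"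
    unfolding magn_def sum_distrib_left by (simp add: mult_ac)
  finally have D: "((\<lambda>y. ln (Z b (x(p := y)))) has_real_derivative b * magn b (x(p := y)) p) (at y)" .
  from DERIV_diff[OF DERIV_const[of "ln (card S) + b\<^sup>2 * w * card P / 2"] D]
  show ?thesis unfolding log_ratio_def by simp
qed

text \<open>The derivative of a Gibbs mean in its own field is b times the Gibbs variance of
  \<open>v p\<close>, and the second moment in this variance is w.\<close>

lemma magn_deriv_coupling:
  assumes "p \<in> P"
  shows "((\<lambda>y. magn b (x(p := y)) p) has_real_derivative b * (w - (magn b (x(p := y)) p)\<^sup>2)) (at y)"
proof -
  let ?m = "magn b (x(p := y)) p" and ?W = "W b (x(p := y))"
  have "(\<Sum>\<tau>\<in>S. ?W \<tau> * (b * v p \<tau>)) = b * ?m"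
    unfolding magn_def sum_distrib_left by (simp add: mult_ac)
  then have "((\<lambda>y. W b (x(p := y)) \<sigma>) has_real_derivative ?W \<sigma> * (b * v p \<sigma> - b * ?m)) (at y)"
    if "\<sigma> \<in> S" for \<sigma>
    using gibbs_weight_deriv[where h = "\<lambda>y. hom_energy b (x(p := y))" and d = "\<lambda>\<sigma>. b * v p \<sigma>" and y = y,
        OF finite_S S_nonempty energy_upd[OF assms, where c = "\<lambda>_. b"] that] by simp
  then have "((\<lambda>y. \<Sum>\<sigma>\<in>S. W b (x(p := y)) \<sigma> * v p \<sigma>) has_real_derivative
      (\<Sum>\<sigma>\<in>S. ?W \<sigma> * (b * v p \<sigma> - b * ?m) * v p \<sigma>)) (at y)"
    by (intro DERIV_sum DERIV_cmult_right)
  also have "(\<Sum>\<sigma>\<in>S. ?W \<sigma> * (b * v p \<sigma> - b * ?m) * v p \<sigma>)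
      = (\<Sum>\<sigma>\<in>S. ?W \<sigma> * (b * w) - b * ?m * (?W \<sigma> * v p \<sigma>))"
  proof (intro sum.cong refl)
    fix \<sigma> assume "\<sigma> \<in> S"
    from v_square[OF assms this] show "?W \<sigma> * (b * v p \<sigma> - b * ?m) * v p \<sigma>
      = ?W \<sigma> * (b * w) - b * ?m * (?W \<sigma> * v p \<sigma>)"
      by (simp add: power2_eq_square algebra_simps)
  qed
  also have "\<dots> = b * w - b * ?m * ?m"
    unfolding sum_subtractf sum_distrib_left[symmetric] sum_distrib_right[symmetric] W_sum
    by (simp add: magn_def)
  finally show ?thesis
    unfolding magn_def[symmetric] by (simp add: power2_eq_square algebra_simps)
qed

text \<open>Given the couplings the two replicas are independent, so each
  \<open>v p \<sigma> * v p \<tau>\<close> averages to a square. In this way the squares produced by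
  integration by parts become a correlation between replicas.\<close>

lemma pair_avg_corr: "pair_avg b x corr = (\<Sum>p\<in>P. (magn b x p)\<^sup>2)"
proof -
  have "(\<Sum>p\<in>P. (magn b x p)\<^sup>2)
    = (\<Sum>p\<in>P. \<Sum>\<sigma>\<in>S. \<Sum>\<tau>\<in>S. W b x \<sigma> * W b x \<tau> * (v p \<sigma> * v p \<tau>))"
    unfolding magn_def power2_eq_square sum_product by (simp add: mult_ac)
  also have "\<dots> = (\<Sum>\<sigma>\<in>S. \<Sum>\<tau>\<in>S. \<Sum>p\<in>P. W b x \<sigma> * W b x \<tau> * (v p \<sigma> * v p \<tau>))"
    by (subst sum.swap, rule sum.cong[OF refl], rule sum.swap)
  finally show ?thesis unfolding pair_avg_def corr_def by (simp add: sum_distrib_left)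
qed

lemma pair_avg_mono:
  "(\<And>\<sigma> \<tau>. \<sigma> \<in> S \<Longrightarrow> \<tau> \<in> S \<Longrightarrow> g \<sigma> \<tau> \<le> h \<sigma> \<tau>) \<Longrightarrow> pair_avg b x g \<le> pair_avg b x h"
  unfolding pair_avg_def using W_pos by (intro sum_mono mult_left_mono) (auto simp: less_imp_le)

lemma pair_avg_affine:
  "pair_avg b x (\<lambda>\<sigma> \<tau>. A + B * g \<sigma> \<tau>) = A + B * pair_avg b x g"
proof -
  have "pair_avg b x (\<lambda>\<sigma> \<tau>. A + B * g \<sigma> \<tau>)
    = (\<Sum>\<sigma>\<in>S. \<Sum>\<tau>\<in>S. W b x \<sigma> * W b x \<tau>) * A + B * pair_avg b x g"
    unfolding pair_avg_def
    by (simp add: distrib_left sum.distrib) (simp only: sum_distrib_left sum_distrib_right mult_ac)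
  then show ?thesis by (simp flip: sum_distrib_left add: W_sum)
qed

lemma gauss_pair_exp:
  assumes "\<sigma> \<in> S" "\<tau> \<in> S"
  shows "integrable couplings (\<lambda>x. exp (hom_energy b x \<sigma> + hom_energy b x \<tau>))" (is ?int)
    and "(\<integral>x. exp (hom_energy b x \<sigma> + hom_energy b x \<tau>) \<partial>couplings)
      = exp (b\<^sup>2 * w * card P) * exp (b\<^sup>2 * corr \<sigma> \<tau>)" (is ?eq)
proof -
  have "hom_energy b x \<sigma> + hom_energy b x \<tau> = (\<Sum>p\<in>P. b * (v p \<sigma> + v p \<tau>) * x p)" for x
    unfolding energy_def sum.distrib[symmetric] by (simp add: algebra_simps)
  then have eq: "exp (hom_energy b x \<sigma> + hom_energy b x \<tau>) = (\<Prod>p\<in>P. exp (b * (v p \<sigma> + v p \<tau>) * x p))" for x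
    by (simp add: exp_sum[OF finite_P])
  show ?int unfolding eq
    by (intro gauss.product_integrable_prod finite_P gauss_exp_integrable)
  have "(\<integral>x. exp (hom_energy b x \<sigma> + hom_energy b x \<tau>) \<partial>couplings)
    = (\<Prod>p\<in>P. exp ((b * (v p \<sigma> + v p \<tau>))\<^sup>2 / 2))"
    unfolding eq by (subst gauss.product_integral_prod[OF finite_P gauss_exp_integrable]) (simp add: gauss_exp)
  also have "\<dots> = (\<Prod>p\<in>P. exp (b\<^sup>2 * w + b\<^sup>2 * (v p \<sigma> * v p \<tau>)))"
  proof (intro prod.cong refl arg_cong[where f = exp])
    fix p assume "p \<in> P"
    with v_square[of p \<sigma>] v_square[of p \<tau>] assms
    have "(v p \<sigma> + v p \<tau>)\<^sup>2 = 2 * w + 2 * (v p \<sigma> * v p \<tau>)" by (simp add: power2_sum)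
    then show "(b * (v p \<sigma> + v p \<tau>))\<^sup>2 / 2 = b\<^sup>2 * w + b\<^sup>2 * (v p \<sigma> * v p \<tau>)"
      unfolding power_mult_distrib by (simp add: algebra_simps)
  qed
  also have "\<dots> = exp (\<Sum>p\<in>P. b\<^sup>2 * w + b\<^sup>2 * (v p \<sigma> * v p \<tau>))"
    by (simp add: exp_sum[OF finite_P])
  finally show ?eq
    by (simp add: sum.distrib corr_def exp_add flip: sum_distrib_left)
qed

text \<open>The factor \<open>exp (- 2 * log_ratio b x)\<close> is the square of Z / E Z and cancels
  both partition functions in the denominator. What remains is a finite sum of exponentials of
  Gaussians, integrable term by term.\<close>

lemma pair_avg_reweight:
  "exp (- 2 * log_ratio b x) * pair_avg b x g =
     (\<Sum>\<sigma>\<in>S. \<Sum>\<tau>\<in>S. exp (hom_energy b x \<sigma> + hom_energy b x \<tau>) * (g \<sigma> \<tau> / ((card S)\<^sup>2 * exp (b\<^sup>2 * w * card P))))"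
proof -
  have card: "0 < real (card S)" using card_S_pos by simp
  have "- 2 * log_ratio b x = ln (Z b x) + ln (Z b x) - (ln (card S) + ln (card S) + b\<^sup>2 * w * card P)"
    by (simp add: log_ratio_def)
  then have e: "exp (- 2 * log_ratio b x) = (Z b x)\<^sup>2 / ((card S)\<^sup>2 * exp (b\<^sup>2 * w * card P))"
    using Z_pos[of b x] card by (simp only: exp_diff exp_add exp_ln power2_eq_square of_nat_mult)
  show ?thesis
    unfolding e pair_avg_def sum_distrib_left gibbs_weight_def
    using Z_pos[of b x] by (intro sum.cong refl) (simp add: power2_eq_square exp_add)
qed

lemma second_moment:
  shows "integrable couplings (\<lambda>x. exp (- 2 * log_ratio b x) * pair_avg b x g)"
    and "(\<integral>x. exp (- 2 * log_ratio b x) * pair_avg b x g \<partial>couplings)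
      = (\<Sum>\<sigma>\<in>S. \<Sum>\<tau>\<in>S. exp (b\<^sup>2 * corr \<sigma> \<tau>) * g \<sigma> \<tau>) / (card S)\<^sup>2"
proof -
  show "integrable couplings (\<lambda>x. exp (- 2 * log_ratio b x) * pair_avg b x g)"
    unfolding pair_avg_reweight
    by (intro Bochner_Integration.integrable_sum integrable_mult_left gauss_pair_exp(1))
  have "(\<integral>x. exp (- 2 * log_ratio b x) * pair_avg b x g \<partial>couplings)
    = (\<Sum>\<sigma>\<in>S. \<Sum>\<tau>\<in>S. exp (b\<^sup>2 * w * card P) * exp (b\<^sup>2 * corr \<sigma> \<tau>)
        * (g \<sigma> \<tau> / ((card S)\<^sup>2 * exp (b\<^sup>2 * w * card P))))"
    unfolding pair_avg_reweight
    by (simp add: Bochner_Integration.integral_sum gauss_pair_exp del: times_divide_eq_right)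
  then show "(\<integral>x. exp (- 2 * log_ratio b x) * pair_avg b x g \<partial>couplings)
      = (\<Sum>\<sigma>\<in>S. \<Sum>\<tau>\<in>S. exp (b\<^sup>2 * corr \<sigma> \<tau>) * g \<sigma> \<tau>) / (card S)\<^sup>2"
    by (simp add: sum_divide_distrib)
qed

end

section \<open>Temperature derivative of the moments of E Z / Z\<close>

context gaussian_gibbs_unit
begin

lemma exp_log_ratio_integrable: "integrable couplings (\<lambda>x. exp (c * log_ratio b x))"
proof (rule PiM_gauss_integrable[OF finite_P])
  fix x :: "'p \<Rightarrow> real"
  let ?X = "\<Sum>p\<in>P. \<bar>x p\<bar>"
  have "c * log_ratio b x \<le> \<bar>c\<bar> * \<bar>log_ratio b x\<bar>" by (simp flip: abs_mult)
  also have "\<dots> \<le> \<bar>c\<bar> * (b\<^sup>2 * w * card P / 2 + \<bar>b\<bar> * sqrt w * ?X)"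
    by (intro mult_left_mono log_ratio_bound) auto
  finally show "\<bar>exp (c * log_ratio b x)\<bar>
      \<le> exp (\<bar>c\<bar> * (b\<^sup>2 * w * card P / 2)) * exp (\<bar>c\<bar> * (\<bar>b\<bar> * sqrt w) * ?X)"
    by (simp add: distrib_left mult_ac flip: exp_add)
qed simp

text \<open>In the derivative the exponential contributes \<open>- c * b\<close> times the square of
  \<open>magn\<close>, and \<open>magn\<close> itself contributes \<open>b * w\<close> minus b times
  that square; together they give the factor \<open>1 + c\<close>.\<close>

lemma exp_log_ratio_by_parts:
  assumes p: "p \<in> P" and c: "0 \<le> c"
  shows "(\<integral>x. x p * (exp (c * log_ratio b x) * magn b x p) \<partial>couplings)
    = (\<integral>x. exp (c * log_ratio b x) * (b * w - b * (1 + c) * (magn b x p)\<^sup>2) \<partial>couplings)"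
proof -
  let ?F = "\<lambda>x. exp (c * log_ratio b x) * magn b x p"
  let ?F' = "\<lambda>x. exp (c * log_ratio b x) * (b * w - b * (1 + c) * (magn b x p)\<^sup>2)"
  define A where "A = exp (c * (b\<^sup>2 * w * card P / 2))"
  define B where "B = c * (\<bar>b\<bar> * sqrt w)"
  let ?K = "sqrt w + \<bar>b\<bar> * w + \<bar>b\<bar> * (1 + c) * w"
  have E: "exp (c * log_ratio b x) \<le> A * exp (B * (\<Sum>p\<in>P. \<bar>x p\<bar>))" for x
  proof -
    have "c * log_ratio b x \<le> c * (b\<^sup>2 * w * card P / 2 + \<bar>b\<bar> * sqrt w * (\<Sum>p\<in>P. \<bar>x p\<bar>))"
      using log_ratio_bound[of b x] c by (intro mult_left_mono) auto
    then show ?thesis by (simp add: A_def B_def distrib_left mult_ac flip: exp_add)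
  qed
  have A: "0 \<le> A" by (simp add: A_def)
  have magn_sq: "(magn b x p)\<^sup>2 \<le> w" for x
    using magn_bound[OF p, of b x] w_nonneg by (metis abs_le_square_iff abs_of_nonneg real_sqrt_ge_zero real_sqrt_pow2)
  have Dm: "((\<lambda>y. magn b (x(p := y)) p) has_real_derivative b * (w - (magn b (x(p := y)) p)\<^sup>2)) (at y)" for x y
    by (rule magn_deriv_coupling[OF p])
  have De: "((\<lambda>y. exp (c * log_ratio b (x(p := y)))) has_real_derivative
      exp (c * log_ratio b (x(p := y))) * (c * (- b * magn b (x(p := y)) p))) (at y)" for x y
    by (auto intro!: derivative_eq_intros log_ratio_deriv_coupling[OF p])
  show ?thesis
  proof (rule gauss_integration_by_parts[where A = "A * ?K" and B = B])
    show "((\<lambda>y. ?F (x(p := y))) has_real_derivative ?F' (x(p := y))) (at y)" for x y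
      by (rule DERIV_cong[OF DERIV_mult[OF De Dm]]) (simp add: power2_eq_square algebra_simps)
    show "isCont (\<lambda>y. ?F' (x(p := y))) y" for x y
      by (intro continuous_intros DERIV_isCont[OF Dm] DERIV_isCont[OF log_ratio_deriv_coupling[OF p]])
    have bound: "\<bar>exp (c * log_ratio b x) * g\<bar> \<le> A * ?K * exp (B * (\<Sum>p\<in>P. \<bar>x p\<bar>))"
      if "\<bar>g\<bar> \<le> ?K" for g x
    proof -
      have "exp (c * log_ratio b x) * \<bar>g\<bar> \<le> (A * exp (B * (\<Sum>p\<in>P. \<bar>x p\<bar>))) * ?K"
        by (intro mult_mono E that) (use A in auto)
      then show ?thesis by (simp add: abs_mult mult_ac)
    qed
    show "\<bar>?F x\<bar> \<le> A * ?K * exp (B * (\<Sum>p\<in>P. \<bar>x p\<bar>))" for x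
    proof (rule bound)
      have "0 \<le> \<bar>b\<bar> * w + \<bar>b\<bar> * (1 + c) * w" using w_nonneg c by simp
      then show "\<bar>magn b x p\<bar> \<le> ?K" using magn_bound[OF p, of b x] by simp
    qed
    show "\<bar>?F' x\<bar> \<le> A * ?K * exp (B * (\<Sum>p\<in>P. \<bar>x p\<bar>))" for x
    proof (rule bound)
      have "\<bar>b * w - b * (1 + c) * (magn b x p)\<^sup>2\<bar> \<le> \<bar>b * w\<bar> + \<bar>b * (1 + c) * (magn b x p)\<^sup>2\<bar>"
        by (rule abs_triangle_ineq4)
      also have "\<dots> = \<bar>b\<bar> * w + \<bar>b\<bar> * (1 + c) * (magn b x p)\<^sup>2"
        using c w_nonneg by (simp add: abs_mult)
      also have "\<dots> \<le> \<bar>b\<bar> * w + \<bar>b\<bar> * (1 + c) * w"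
        using c magn_sq by (intro add_left_mono mult_left_mono) auto
      finally show "\<bar>b * w - b * (1 + c) * (magn b x p)\<^sup>2\<bar> \<le> ?K"
        using w_nonneg real_sqrt_ge_zero[OF w_nonneg] by linarith
    qed
  qed (use p finite_P in auto)
qed

text \<open>Integrating \<open>x p * magn b x p\<close> by parts yields a term \<open>b * w\<close>
  for each coupling. These cancel the deterministic \<open>b * w * card P\<close> that comes from E
  Z, and only the squares of the magnetizations, that is the pair average of \<open>corr\<close>,
  survive.\<close>

lemma temperature_deriv:
  assumes q: "\<And>b. (q has_real_derivative q' b) (at b)"
    and q_bounds: "\<And>b. \<bar>b - b0\<bar> < 1 \<Longrightarrow> 0 \<le> q b \<and> q b \<le> Q \<and> \<bar>q' b\<bar> \<le> Q"
  shows "((\<lambda>b. \<integral>x. exp (q b * log_ratio b x) \<partial>couplings) has_real_derivative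
    (\<integral>x. exp (q b0 * log_ratio b0 x) *
      (q' b0 * log_ratio b0 x + q b0 * (1 + q b0) * b0 * pair_avg b0 x corr) \<partial>couplings)) (at b0)"
proof -
  let ?X = "\<lambda>x :: 'p \<Rightarrow> real. \<Sum>p\<in>P. \<bar>x p\<bar>"
  let ?L' = "\<lambda>b x. b * w * card P - (\<Sum>p\<in>P. x p * magn b x p)"
  let ?f' = "\<lambda>b x. exp (q b * log_ratio b x) * (q' b * log_ratio b x + q b * ?L' b x)"
  \<comment> \<open>The constants \<open>b1\<close>, \<open>a\<close>, \<open>V\<close>,
    \<open>K\<close> dominate the integrand and its derivative uniformly for b within distance 1 of
    b0.\<close>
  define b1 where "b1 = \<bar>b0\<bar> + 1"
  define a where "a = b1\<^sup>2 * w * card P / 2"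
  define V where "V = b1 * sqrt w"
  define K where "K = Q * (a + V + b1 * w * card P + sqrt w)"
  have Q: "0 \<le> Q" using q_bounds[of b0] by auto
  have nonneg: "0 \<le> b1" "0 \<le> a" "0 \<le> V" using w_nonneg by (auto simp: b1_def a_def V_def)
  have X: "0 \<le> ?X x" for x :: "'p \<Rightarrow> real" by (rule sum_nonneg) auto
  have b_le: "\<bar>b\<bar> \<le> b1" if "\<bar>b - b0\<bar> < 1" for b using that unfolding b1_def by linarith
  have logr: "\<bar>log_ratio b x\<bar> \<le> a + V * ?X x" if "\<bar>b - b0\<bar> < 1" for b x
  proof (rule order_trans[OF log_ratio_bound])
    have "b\<^sup>2 \<le> b1\<^sup>2" using b_le[OF that] nonneg(1) by (metis abs_le_square_iff abs_of_nonneg)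
    then have "b\<^sup>2 * w * card P / 2 \<le> a"
      unfolding a_def using w_nonneg by (intro divide_right_mono mult_right_mono) auto
    moreover have "\<bar>b\<bar> * sqrt w * ?X x \<le> V * ?X x"
      unfolding V_def using b_le[OF that] w_nonneg X by (intro mult_right_mono) auto
    ultimately show "b\<^sup>2 * w * card P / 2 + \<bar>b\<bar> * sqrt w * ?X x \<le> a + V * ?X x" by simp
  qed
  have expb: "exp (q b * log_ratio b x) \<le> exp (Q * a) * exp (Q * V * ?X x)" if "\<bar>b - b0\<bar> < 1" for b x
  proof -
    have "q b * log_ratio b x \<le> q b * (a + V * ?X x)"
      using logr[OF that, of x] q_bounds[OF that] by (intro mult_left_mono) auto
    also have "\<dots> \<le> Q * (a + V * ?X x)"
      using q_bounds[OF that] nonneg X by (intro mult_right_mono add_nonneg_nonneg mult_nonneg_nonneg) auto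
    finally show ?thesis by (simp add: distrib_left mult_ac flip: exp_add)
  qed
  have sum_magn: "\<bar>\<Sum>p\<in>P. x p * magn b x p\<bar> \<le> sqrt w * ?X x" for b x
  proof -
    have "\<bar>\<Sum>p\<in>P. x p * magn b x p\<bar> \<le> (\<Sum>p\<in>P. \<bar>x p * magn b x p\<bar>)" by (rule sum_abs)
    also have "\<dots> \<le> (\<Sum>p\<in>P. \<bar>x p\<bar> * sqrt w)"
      unfolding abs_mult by (intro sum_mono mult_left_mono magn_bound) auto
    finally show ?thesis by (simp add: sum_distrib_left mult_ac)
  qed
  have lin: "\<bar>q' b * log_ratio b x + q b * ?L' b x\<bar> \<le> K * exp (?X x)" if b: "\<bar>b - b0\<bar> < 1" for b x
  proof -
    have e: "1 \<le> exp (?X x)" "?X x \<le> exp (?X x)"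
      using X[of x] exp_ge_add_one_self[of "?X x"] by linarith+
    have "\<bar>b * w * card P\<bar> \<le> b1 * w * card P"
      using b_le[OF b] w_nonneg by (simp add: abs_mult mult_right_mono)
    then have L': "\<bar>?L' b x\<bar> \<le> b1 * w * card P + sqrt w * ?X x"
      using sum_magn[of x b] by linarith
    have "\<bar>q' b * log_ratio b x + q b * ?L' b x\<bar> \<le> \<bar>q' b\<bar> * \<bar>log_ratio b x\<bar> + \<bar>q b\<bar> * \<bar>?L' b x\<bar>"
      using abs_triangle_ineq[of "q' b * log_ratio b x" "q b * ?L' b x"] by (simp only: abs_mult)
    also have "\<dots> \<le> Q * (a + V * ?X x) + Q * (b1 * w * card P + sqrt w * ?X x)"
      using q_bounds[OF b] Q by (intro add_mono mult_mono logr L' b) auto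
    also have "\<dots> = Q * (a * 1 + V * ?X x + b1 * w * card P * 1 + sqrt w * ?X x)"
      by (simp add: distrib_left)
    also have "\<dots> \<le> Q * (a * exp (?X x) + V * exp (?X x) + b1 * w * card P * exp (?X x) + sqrt w * exp (?X x))"
      using e nonneg w_nonneg Q by (intro mult_left_mono add_mono) auto
    also have "\<dots> = K * exp (?X x)" by (simp add: K_def algebra_simps)
    finally show ?thesis .
  qed
  have K: "0 \<le> K" using Q nonneg w_nonneg by (simp add: K_def)
  have "((\<lambda>b. \<integral>x. exp (q b * log_ratio b x) \<partial>couplings) has_real_derivative (\<integral>x. ?f' b0 x \<partial>couplings)) (at b0)"
  proof (rule has_real_derivative_integral[where d = 1
        and g = "\<lambda>x. exp (Q * a) * K * exp ((Q * V + 1) * ?X x)"])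
    show "((\<lambda>b. exp (q b * log_ratio b x)) has_real_derivative ?f' b x) (at b)" for b x
      by (auto intro!: derivative_eq_intros q log_ratio_deriv_temp)
    show "\<bar>?f' b x\<bar> \<le> exp (Q * a) * K * exp ((Q * V + 1) * ?X x)" if "\<bar>b - b0\<bar> < 1" for b x
    proof -
      have "\<bar>?f' b x\<bar> \<le> (exp (Q * a) * exp (Q * V * ?X x)) * (K * exp (?X x))"
        unfolding abs_mult using expb[OF that] lin[OF that] by (intro mult_mono) auto
      then show ?thesis by (simp add: distrib_right exp_add mult_ac)
    qed
    show "integrable couplings (\<lambda>x. exp (Q * a) * K * exp ((Q * V + 1) * ?X x))"
      by (intro integrable_mult_right PiM_gauss_exp_integrable finite_P)
    show "integrable couplings (\<lambda>x. exp (q s * log_ratio s x))" for s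
      by (rule exp_log_ratio_integrable)
  qed simp_all
  also have "(\<integral>x. ?f' b0 x \<partial>couplings) = (\<integral>x. exp (q b0 * log_ratio b0 x) *
      (q' b0 * log_ratio b0 x + q b0 * (1 + q b0) * b0 * pair_avg b0 x corr) \<partial>couplings)"
  proof -
    define f where "f x = exp (q b0 * log_ratio b0 x)" for x
    have f_meas [measurable]: "f \<in> borel_measurable couplings" unfolding f_def by measurable
    have q0: "0 \<le> q b0" using q_bounds[of b0] by simp
    have fb: "f x \<le> exp (Q * a) * exp (Q * V * ?X x)" for x
      unfolding f_def by (rule expb) simp
    have f0: "0 \<le> f x" for x by (simp add: f_def)
    have int_b: "integrable couplings (\<lambda>x. f x * g x)"
      if [measurable]: "g \<in> borel_measurable couplings" and g: "\<And>x. \<bar>g x\<bar> \<le> C * exp (?X x)" for g C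
    proof (rule PiM_gauss_integrable[OF finite_P])
      fix x
      have "f x * \<bar>g x\<bar> \<le> (exp (Q * a) * exp (Q * V * ?X x)) * (C * exp (?X x))"
        by (intro mult_mono fb g) (use f0 in auto)
      then show "\<bar>f x * g x\<bar> \<le> (exp (Q * a) * C) * exp ((Q * V + 1) * ?X x)"
        using f0[of x] by (simp add: abs_mult distrib_right exp_add mult_ac)
    qed simp
    have e1: "1 \<le> exp (?X x)" for x :: "'p \<Rightarrow> real" using X[of x] by simp
    have i1: "integrable couplings (\<lambda>x. f x * log_ratio b0 x)"
    proof (rule int_b)
      fix x
      have "?X x \<le> exp (?X x)" using exp_ge_add_one_self[of "?X x"] by linarith
      then have "a * 1 + V * ?X x \<le> a * exp (?X x) + V * exp (?X x)"
        using e1[of x] nonneg by (intro add_mono mult_left_mono) auto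
      then show "\<bar>log_ratio b0 x\<bar> \<le> (a + V) * exp (?X x)"
        using logr[of b0 x] by (simp add: algebra_simps)
    qed simp
    have i2: "integrable couplings f"
      using int_b[of "\<lambda>_. 1" 1] e1 by simp
    have mag2: "(magn b0 x p)\<^sup>2 \<le> w" if "p \<in> P" for x p
      using magn_bound[OF that, of b0 x] w_nonneg
      by (metis abs_le_square_iff abs_of_nonneg real_sqrt_ge_zero real_sqrt_pow2)
    have i3: "integrable couplings (\<lambda>x. f x * (magn b0 x p)\<^sup>2)" if "p \<in> P" for p
    proof (rule int_b)
      fix x
      have "(magn b0 x p)\<^sup>2 \<le> w * exp (?X x)"
        using mag2[OF that, of x] mult_left_mono[OF e1[of x] w_nonneg] by simp
      then show "\<bar>(magn b0 x p)\<^sup>2\<bar> \<le> w * exp (?X x)" by simp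
    qed simp
    have i4: "integrable couplings (\<lambda>x. x p * (f x * magn b0 x p))" if "p \<in> P" for p
    proof (rule PiM_gauss_mult_integrable[OF finite_P that])
      fix x
      have "f x * \<bar>magn b0 x p\<bar> \<le> (exp (Q * a) * exp (Q * V * ?X x)) * sqrt w"
        by (intro mult_mono fb magn_bound that) auto
      then show "\<bar>f x * magn b0 x p\<bar> \<le> (exp (Q * a) * sqrt w) * exp (Q * V * ?X x)"
        using f0[of x] by (simp add: abs_mult mult_ac)
    qed simp
    have "(\<integral>x. ?f' b0 x \<partial>couplings) = (\<integral>x. q' b0 * (f x * log_ratio b0 x)
        + q b0 * (b0 * w * card P) * f x - q b0 * (\<Sum>p\<in>P. x p * (f x * magn b0 x p)) \<partial>couplings)"
      by (intro Bochner_Integration.integral_cong refl)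
         (simp add: f_def algebra_simps sum_distrib_left)
    also have "\<dots> = q' b0 * (\<integral>x. f x * log_ratio b0 x \<partial>couplings)
        + q b0 * (b0 * w * card P) * (\<integral>x. f x \<partial>couplings)
        - q b0 * (\<Sum>p\<in>P. \<integral>x. x p * (f x * magn b0 x p) \<partial>couplings)"
      using i1 i2 i4 by (simp add: Bochner_Integration.integral_sum)
    \<comment> \<open>Integration by parts in each coupling, with the exponent frozen at
      \<open>q b0\<close>.\<close>
    also have "(\<Sum>p\<in>P. \<integral>x. x p * (f x * magn b0 x p) \<partial>couplings)
        = (\<Sum>p\<in>P. \<integral>x. b0 * w * f x - b0 * (1 + q b0) * (f x * (magn b0 x p)\<^sup>2) \<partial>couplings)"
      unfolding f_def
      by (intro sum.cong refl, subst exp_log_ratio_by_parts[OF _ q0])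
         (auto intro!: Bochner_Integration.integral_cong simp: algebra_simps)
    also have "\<dots> = b0 * w * card P * (\<integral>x. f x \<partial>couplings)
        - b0 * (1 + q b0) * (\<Sum>p\<in>P. \<integral>x. f x * (magn b0 x p)\<^sup>2 \<partial>couplings)"
      using i2 i3 by (simp add: sum_subtractf sum_distrib_left)
    also have "(\<Sum>p\<in>P. \<integral>x. f x * (magn b0 x p)\<^sup>2 \<partial>couplings) = (\<integral>x. f x * pair_avg b0 x corr \<partial>couplings)"
      using i3 unfolding pair_avg_corr sum_distrib_left by (simp add: Bochner_Integration.integral_sum)
    finally have "(\<integral>x. ?f' b0 x \<partial>couplings) = q' b0 * (\<integral>x. f x * log_ratio b0 x \<partial>couplings)
        + q b0 * (1 + q b0) * b0 * (\<integral>x. f x * pair_avg b0 x corr \<partial>couplings)"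
      by (simp add: algebra_simps)
    moreover have "integrable couplings (\<lambda>x. f x * pair_avg b0 x corr)"
      using i3 unfolding pair_avg_corr sum_distrib_left by (intro Bochner_Integration.integrable_sum)
    ultimately have "(\<integral>x. ?f' b0 x \<partial>couplings) = (\<integral>x. q' b0 * (f x * log_ratio b0 x)
        + q b0 * (1 + q b0) * b0 * (f x * pair_avg b0 x corr) \<partial>couplings)"
      using i1 by simp
    then show ?thesis by (simp add: f_def algebra_simps)
  qed
  finally show ?thesis .
qed

end

text \<open>Young's inequality for \<open>exp\<close> and its convex conjugate
  \<open>a * ln a - a\<close>, read off from the tangent of \<open>exp\<close> at
  \<open>ln a\<close>; the term \<open>- a\<close> is dropped.\<close>

lemma young_exp:
  fixes a t :: real
  assumes "0 < a"
  shows "a * t \<le> a * ln a + exp t"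
proof -
  have "a * (1 + (t - ln a)) \<le> a * exp (t - ln a)"
    using assms exp_ge_add_one_self[of "t - ln a"] by (intro mult_left_mono) auto
  also have "a * exp (t - ln a) = exp t" using assms by (simp add: exp_diff)
  finally show ?thesis using assms by (simp add: algebra_simps)
qed

lemma mult_exp_ge: "- 1 \<le> exp t * (t :: real)"
proof -
  have "- t \<le> exp (- t)" using exp_ge_add_one_self[of "- t"] by linarith
  then have "exp t * (- t) \<le> exp t * exp (- t)" by (intro mult_left_mono) auto
  then show ?thesis by (simp flip: exp_add)
qed

context gaussian_gibbs_unit
begin

lemma log_ratio_zero: "log_ratio 0 x = 0"
  by (simp add: log_ratio_def energy_def)

text \<open>With u = E Z / Z, Young's inequality is applied with weight u^(q+2). After
  multiplication by u^-2 it leaves u^q ln u and u^-2 times a pair average of an exponential; the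
  expectation of the latter is given by \<open>second_moment\<close>.\<close>

lemma corr_young:
  assumes lam: "0 < \<theta>"
  shows "exp (q * log_ratio b x) * pair_avg b x corr \<le>
    ((q + 2) * (exp (q * log_ratio b x) * log_ratio b x)
      + exp (- 2 * log_ratio b x) * pair_avg b x (\<lambda>\<sigma> \<tau>. exp (\<theta> * corr \<sigma> \<tau>))) / \<theta>"
proof -
  define L where "L = log_ratio b x"
  define a where "a = exp ((q + 2) * L)"
  have "pair_avg b x (\<lambda>\<sigma> \<tau>. 0 + (a * \<theta>) * corr \<sigma> \<tau>)
      \<le> pair_avg b x (\<lambda>\<sigma> \<tau>. a * ((q + 2) * L) + 1 * exp (\<theta> * corr \<sigma> \<tau>))"
  proof (rule pair_avg_mono)
    fix \<sigma> \<tau>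
    show "0 + (a * \<theta>) * corr \<sigma> \<tau> \<le> a * ((q + 2) * L) + 1 * exp (\<theta> * corr \<sigma> \<tau>)"
      using young_exp[of a "\<theta> * corr \<sigma> \<tau>"] by (simp add: a_def mult_ac)
  qed
  then have "a * \<theta> * pair_avg b x corr
      \<le> a * ((q + 2) * L) + pair_avg b x (\<lambda>\<sigma> \<tau>. exp (\<theta> * corr \<sigma> \<tau>))"
    unfolding pair_avg_affine by simp
  then have "exp (- 2 * L) * (a * \<theta> * pair_avg b x corr)
      \<le> exp (- 2 * L) * (a * ((q + 2) * L) + pair_avg b x (\<lambda>\<sigma> \<tau>. exp (\<theta> * corr \<sigma> \<tau>)))"
    by (intro mult_left_mono) auto
  moreover have "exp (- 2 * L) * a = exp (q * L)"
    by (simp add: a_def algebra_simps flip: exp_add)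
  ultimately have "exp (q * L) * (\<theta> * pair_avg b x corr)
      \<le> exp (q * L) * ((q + 2) * L) + exp (- 2 * L) * pair_avg b x (\<lambda>\<sigma> \<tau>. exp (\<theta> * corr \<sigma> \<tau>))"
    by (simp add: distrib_left flip: mult.assoc)
  then show ?thesis
    using lam by (simp add: L_def pos_le_divide_eq mult_ac)
qed

text \<open>The exponent \<open>q b = exp (- 6 * b / \<theta>)\<close> solves \<open>q' = - 6 * q / \<theta>\<close>, which makes the derivative of
  \<open>q\<close> absorb the term \<open>u\<^sup>q ln u\<close> of \<open>corr_young\<close>.\<close>

lemma log_ratio_moment:
  fixes C :: real
  assumes \<beta>: "0 < \<beta>" "\<beta> \<le> 1" and lam: "0 < \<theta>"
    and C: "\<And>b. 0 \<le> b \<Longrightarrow> b \<le> \<beta> \<Longrightarrow>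
      (\<Sum>\<sigma>\<in>S. \<Sum>\<tau>\<in>S. exp ((b\<^sup>2 + \<theta>) * corr \<sigma> \<tau>)) \<le> C * (card S)\<^sup>2"
  shows "(\<integral>x. exp (exp (- 6 * \<beta> / \<theta>) * log_ratio \<beta> x) \<partial>couplings) \<le> 1 + (6 + 2 * C) / \<theta>"
proof -
  define q where "q b = exp (- 6 * b / \<theta>)" for b
  define q' where "q' b = - 6 / \<theta> * q b" for b
  define \<psi> where "\<psi> b = (\<integral>x. exp (q b * log_ratio b x) \<partial>couplings)" for b
  define R where "R b x = exp (- 2 * log_ratio b x) * pair_avg b x (\<lambda>\<sigma> \<tau>. exp (\<theta> * corr \<sigma> \<tau>))" for b x
  define h where "h b x = exp (q b * log_ratio b x) *
      (q' b * log_ratio b x + q b * (1 + q b) * b * pair_avg b x corr)" for b x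
  have q_deriv: "(q has_real_derivative q' b) (at b)" for b
    unfolding q_def q'_def using lam by (auto intro!: derivative_eq_intros)
  have deriv: "(\<psi> has_real_derivative (\<integral>x. h b x \<partial>couplings)) (at b)" for b
    unfolding \<psi>_def h_def
  proof (rule temperature_deriv[OF q_deriv])
    fix b' assume b': "\<bar>b' - b\<bar> < 1"
    define Q where "Q = exp (6 * (\<bar>b\<bar> + 1) / \<theta>)"
    have "- 6 * b' \<le> 6 * (\<bar>b\<bar> + 1)" using b' by argo
    then have "q b' \<le> Q"
      unfolding q_def Q_def exp_le_cancel_iff using lam by (intro divide_right_mono) auto
    moreover from this have "6 / \<theta> * q b' \<le> 6 / \<theta> * Q" using lam by (intro mult_left_mono) auto
    moreover have "0 \<le> Q" "0 \<le> q b'" "0 \<le> 6 / \<theta>" "0 \<le> 6 / \<theta> * Q" using lam by (auto simp: Q_def q_def)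
    ultimately have "q b' \<le> Q + 6 / \<theta> * Q" "6 / \<theta> * q b' \<le> Q + 6 / \<theta> * Q" "0 \<le> q b'"
      by linarith+
    then show "0 \<le> q b' \<and> q b' \<le> (1 + 6 / \<theta>) * exp (6 * (\<bar>b\<bar> + 1) / \<theta>)
        \<and> \<bar>q' b'\<bar> \<le> (1 + 6 / \<theta>) * exp (6 * (\<bar>b\<bar> + 1) / \<theta>)"
      unfolding q'_def Q_def[symmetric] using lam by (simp add: distrib_right abs_mult)
  qed
  have pointwise: "h b x \<le> 6 / \<theta> + 2 / \<theta> * R b x" if b: "0 \<le> b" "b \<le> \<beta>" for b x
  proof -
    let ?u = "exp (q b * log_ratio b x) * log_ratio b x"
    have qb: "0 < q b" "q b \<le> 1" using b lam by (auto simp: q_def)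
    have R: "0 \<le> R b x" unfolding R_def pair_avg_def
      using W_pos by (intro mult_nonneg_nonneg sum_nonneg) (auto simp: less_imp_le)
    define k where "k = q b * (1 + q b) * b"
    have k: "0 \<le> k" using qb b by (simp add: k_def)
    have "(1 + q b) * b \<le> 2 * 1" using qb b \<beta> by (intro mult_mono) auto
    then have k2: "k \<le> 2 * q b" using qb by (simp add: k_def mult.assoc)
    have "q b * ?u \<ge> - 1" using mult_exp_ge[of "q b * log_ratio b x"] by (simp add: mult_ac)
    have "h b x = q' b * ?u + k * (exp (q b * log_ratio b x) * pair_avg b x corr)"
      by (simp add: h_def k_def algebra_simps)
    also have "\<dots> \<le> q' b * ?u + k * (((q b + 2) * ?u + R b x) / \<theta>)"
      using k corr_young[OF lam, of "q b" b x] unfolding R_def by (intro add_left_mono mult_left_mono) auto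
    also have "\<dots> = ((6 * q b - k * (q b + 2)) * (- ?u) + k * R b x) / \<theta>"
      using lam by (simp add: q'_def field_simps)
    also have "\<dots> \<le> (6 + 2 * R b x) / \<theta>"
    proof (intro divide_right_mono add_mono)
      \<comment> \<open>Origin of the 6 in the exponent: \<open>k \<le> 2 * q b\<close> and
        \<open>q b + 2 \<le> 3\<close>. So the coefficient of minus u^q ln u is nonnegative, and an
        upper bound of that quantity suffices.\<close>
      have "k * (q b + 2) \<le> 2 * q b * 3" using k2 qb k by (intro mult_mono) auto
      then have c0: "0 \<le> 6 * q b - k * (q b + 2)" by simp
      have "- ?u \<le> 1 / q b"
        using \<open>q b * ?u \<ge> - 1\<close> qb by (simp add: field_simps)
      then have "(6 * q b - k * (q b + 2)) * (- ?u) \<le> (6 * q b - k * (q b + 2)) * (1 / q b)"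
        using c0 by (rule mult_left_mono)
      also have "\<dots> \<le> (6 * q b) * (1 / q b)"
        using k qb by (intro mult_right_mono) auto
      finally show "(6 * q b - k * (q b + 2)) * (- ?u) \<le> 6" using qb by simp
      have "k \<le> 2" using k2 qb by linarith
      then show "k * R b x \<le> 2 * R b x" using R by (rule mult_right_mono)
    qed (use lam in auto)
    finally show ?thesis by (simp add: add_divide_distrib)
  qed
  have C1: "(\<integral>x. h b x \<partial>couplings) \<le> (6 + 2 * C) / \<theta>" if b: "0 \<le> b" "b \<le> \<beta>" for b
  proof -
    have "C \<ge> 0"
    proof -
      have "0 \<le> (\<Sum>\<sigma>\<in>S. \<Sum>\<tau>\<in>S. exp ((b\<^sup>2 + \<theta>) * corr \<sigma> \<tau>))" by (intro sum_nonneg) auto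
      also have "\<dots> \<le> C * (card S)\<^sup>2" by (rule C[OF b])
      finally show ?thesis using card_S_pos by (simp add: zero_le_mult_iff)
    qed
    have R: "integrable couplings (R b)" "integral\<^sup>L couplings (R b) \<le> C"
    proof -
      show "integrable couplings (R b)" unfolding R_def by (rule second_moment)
      have "integral\<^sup>L couplings (R b)
          = (\<Sum>\<sigma>\<in>S. \<Sum>\<tau>\<in>S. exp ((b\<^sup>2 + \<theta>) * corr \<sigma> \<tau>)) / (card S)\<^sup>2"
        unfolding R_def second_moment by (simp add: distrib_right exp_add)
      also have "\<dots> \<le> C" using C[OF b] by (simp add: pos_divide_le_eq card_S_pos)
      finally show "integral\<^sup>L couplings (R b) \<le> C" .
    qed
    show ?thesis
    proof (cases "integrable couplings (h b)")
      case True
      have "(\<integral>x. h b x \<partial>couplings) \<le> (\<integral>x. 6 / \<theta> + 2 / \<theta> * R b x \<partial>couplings)"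
        using True R pointwise[OF b] by (intro integral_mono) auto
      also have "\<dots> = 6 / \<theta> + 2 / \<theta> * integral\<^sup>L couplings (R b)"
        using R by (simp add: couplings.prob_space)
      also have "\<dots> \<le> 6 / \<theta> + 2 / \<theta> * C"
        using R lam by (intro add_left_mono mult_left_mono) auto
      finally show ?thesis by (simp add: add_divide_distrib)
    next
      case False
      \<comment> \<open>The integral of a non-integrable function is 0 by convention, below the
        nonnegative bound.\<close>
      then show ?thesis using \<open>C \<ge> 0\<close> lam by (simp add: not_integrable_integral_eq)
    qed
  qed
  obtain b where b: "0 < b" "b < \<beta>" "\<psi> \<beta> - \<psi> 0 = (\<beta> - 0) * (\<integral>x. h b x \<partial>couplings)"
    using MVT2[OF \<beta>(1), of \<psi> "\<lambda>b. \<integral>x. h b x \<partial>couplings"] deriv by auto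
  have nonneg: "0 \<le> (6 + 2 * C) / \<theta>"
  proof -
    have "0 \<le> (\<Sum>\<sigma>\<in>S. \<Sum>\<tau>\<in>S. exp ((0\<^sup>2 + \<theta>) * corr \<sigma> \<tau>))" by (intro sum_nonneg) auto
    also have "\<dots> \<le> C * (card S)\<^sup>2" using \<beta> by (intro C) auto
    finally have "0 \<le> C" using card_S_pos by (simp add: zero_le_mult_iff)
    then show ?thesis using lam by simp
  qed
  have "\<beta> * (\<integral>x. h b x \<partial>couplings) \<le> \<beta> * ((6 + 2 * C) / \<theta>)"
    using b \<beta> by (intro mult_left_mono C1) auto
  also have "\<dots> \<le> 1 * ((6 + 2 * C) / \<theta>)" using \<beta> nonneg by (intro mult_right_mono) auto
  finally have "\<psi> \<beta> \<le> \<psi> 0 + (6 + 2 * C) / \<theta>" using b by simp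
  \<comment> \<open>At \<open>b = 0\<close> the partition function is deterministic, which provides
    the initial value.\<close>
  moreover have "\<psi> 0 = 1" unfolding \<psi>_def log_ratio_zero by (simp add: couplings.prob_space)
  ultimately show ?thesis unfolding \<psi>_def q_def by simp
qed

text \<open>Removing the factor u^-2 from the annealed bound costs a smaller exponent, \<theta> / r
  in place of \<theta>. The ratio r is chosen so that the only moment of u required is the small one
  supplied by \<open>log_ratio_moment\<close>.\<close>

lemma corr_exp_moment:
  fixes C :: real
  assumes \<beta>: "0 < \<beta>" "\<beta> \<le> 1" and lam: "0 < \<theta>"
    and C: "\<And>b. 0 \<le> b \<Longrightarrow> b \<le> \<beta> \<Longrightarrow>
      (\<Sum>\<sigma>\<in>S. \<Sum>\<tau>\<in>S. exp ((b\<^sup>2 + \<theta>) * corr \<sigma> \<tau>)) \<le> C * (card S)\<^sup>2"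
  shows "(\<integral>x. pair_avg \<beta> x (\<lambda>\<sigma> \<tau>. exp (\<theta> / (1 + 2 * exp (6 * \<beta> / \<theta>)) * corr \<sigma> \<tau>)) \<partial>couplings)
    \<le> 1 + (6 + 2 * C) / \<theta> + C"
proof -
  define \<eta> where "\<eta> = exp (- 6 * \<beta> / \<theta>)"
  define r where "r = 1 + 2 * exp (6 * \<beta> / \<theta>)"
  define R where "R x = exp (- 2 * log_ratio \<beta> x) * pair_avg \<beta> x (\<lambda>\<sigma> \<tau>. exp (\<theta> * corr \<sigma> \<tau>))" for x
  have r: "1 < r" by (simp add: r_def)
  have \<eta>r: "\<eta> * (r - 1) = 2" unfolding \<eta>_def r_def by (simp flip: exp_add)
  \<comment> \<open>\<open>e\<^sup>t \<le> u\<^sup>\<eta> + u\<^sup>-\<^sup>2 e\<^sup>r\<^sup>t\<close> holds for all \<open>t\<close> and \<open>u > 0\<close> because \<open>\<eta> * (r - 1) = 2\<close>.\<close>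
  have pointwise: "pair_avg \<beta> x (\<lambda>\<sigma> \<tau>. exp (\<theta> / r * corr \<sigma> \<tau>)) \<le> exp (\<eta> * log_ratio \<beta> x) + R x" for x
  proof -
    let ?L = "log_ratio \<beta> x"
    have "pair_avg \<beta> x (\<lambda>\<sigma> \<tau>. exp (\<theta> / r * corr \<sigma> \<tau>))
      \<le> pair_avg \<beta> x (\<lambda>\<sigma> \<tau>. exp (\<eta> * ?L) + exp (- 2 * ?L) * exp (\<theta> * corr \<sigma> \<tau>))"
    proof (rule pair_avg_mono)
      fix \<sigma> \<tau>
      define t where "t = \<theta> / r * corr \<sigma> \<tau>"
      have rt: "\<theta> * corr \<sigma> \<tau> = r * t" using r by (simp add: t_def)
      show "exp (\<theta> / r * corr \<sigma> \<tau>) \<le> exp (\<eta> * ?L) + exp (- 2 * ?L) * exp (\<theta> * corr \<sigma> \<tau>)"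
      proof (cases "t \<le> \<eta> * ?L")
        case True
        then have "exp t \<le> exp (\<eta> * ?L)" by simp
        then show ?thesis unfolding t_def[symmetric] by (simp add: add_increasing2)
      next
        case False
        then have "(r - 1) * (\<eta> * ?L) \<le> (r - 1) * t" using r by (intro mult_left_mono) auto
        moreover have "(r - 1) * (\<eta> * ?L) = 2 * ?L" using \<eta>r by (metis mult.assoc mult.commute)
        ultimately have "t \<le> - 2 * ?L + r * t" by (simp add: algebra_simps)
        then have "exp t \<le> exp (- 2 * ?L) * exp (r * t)" by (simp flip: exp_add)
        then show ?thesis unfolding t_def[symmetric] rt by (simp add: add_increasing)
      qed
    qed
    then show ?thesis unfolding R_def pair_avg_affine .
  qed
  have R: "integrable couplings R" "integral\<^sup>L couplings R \<le> C"
  proof -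
    show "integrable couplings R" unfolding R_def by (rule second_moment)
    have "integral\<^sup>L couplings R
        = (\<Sum>\<sigma>\<in>S. \<Sum>\<tau>\<in>S. exp ((\<beta>\<^sup>2 + \<theta>) * corr \<sigma> \<tau>)) / (card S)\<^sup>2"
      unfolding R_def second_moment by (simp add: distrib_right exp_add)
    also have "\<dots> \<le> C" using C[of \<beta>] \<beta> by (simp add: pos_divide_le_eq card_S_pos)
    finally show "integral\<^sup>L couplings R \<le> C" .
  qed
  have pos: "0 \<le> pair_avg \<beta> x (\<lambda>\<sigma> \<tau>. exp (\<theta> / r * corr \<sigma> \<tau>))" for x
    unfolding pair_avg_def using W_pos by (intro sum_nonneg mult_nonneg_nonneg) (auto simp: less_imp_le)
  have int: "integrable couplings (\<lambda>x. exp (\<eta> * log_ratio \<beta> x) + R x)"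
    using R exp_log_ratio_integrable by auto
  have "(\<integral>x. pair_avg \<beta> x (\<lambda>\<sigma> \<tau>. exp (\<theta> / r * corr \<sigma> \<tau>)) \<partial>couplings)
      \<le> (\<integral>x. exp (\<eta> * log_ratio \<beta> x) + R x \<partial>couplings)"
  proof (rule integral_mono[OF _ int pointwise])
    show "integrable couplings (\<lambda>x. pair_avg \<beta> x (\<lambda>\<sigma> \<tau>. exp (\<theta> / r * corr \<sigma> \<tau>)))"
      by (rule Bochner_Integration.integrable_bound[OF int])
         (use pos pointwise in \<open>auto intro!: AE_I2 simp: abs_of_nonneg intro: order_trans[OF _ abs_ge_self]\<close>)
  qed
  also have "\<dots> = (\<integral>x. exp (\<eta> * log_ratio \<beta> x) \<partial>couplings) + integral\<^sup>L couplings R"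
    using R exp_log_ratio_integrable by simp
  also have "\<dots> \<le> (1 + (6 + 2 * C) / \<theta>) + C"
    unfolding \<eta>_def using R(2) log_ratio_moment[OF assms] by (intro add_mono) auto
  finally show ?thesis by (simp add: r_def)
qed

end

section \<open>Exponential moments of the overlap\<close>

text \<open>The Gaussian bound on cosh, obtained as Hoeffding's lemma for a symmetric sign: interval
  length \<open>2 * y\<close>, probability \<open>1 / 2\<close>.\<close>

lemma exp_plus_exp_minus_le: "exp x + exp (- x) \<le> 2 * exp (x\<^sup>2 / 2)" for x :: real
proof -
  have *: "exp y + exp (- y) \<le> 2 * exp (y\<^sup>2 / 2)" if "0 \<le> y" for y :: real
  proof -
    have eq: "1 + 1 / 2 * (exp (2 * y) - 1) = exp y * ((exp y + exp (- y)) / 2)"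
      by (simp add: field_simps flip: exp_add)
    have ln_exp_mult: "ln (exp y * c) = y + ln c" if "0 < c" for c :: real
      using that by (simp add: ln_mult)
    have pos: "0 < (exp y + exp (- y)) / 2" by (simp add: add_pos_pos)
    have "- (2 * y) * (1 / 2) + ln (1 + 1 / 2 * (exp (2 * y) - 1)) \<le> (2 * y)\<^sup>2 / 8"
      using that by (intro Hoeffdings_lemma_aux) auto
    then have "ln ((exp y + exp (- y)) / 2) \<le> y\<^sup>2 / 2"
      unfolding eq ln_exp_mult[OF pos] power_mult_distrib by simp
    then have "(exp y + exp (- y)) / 2 \<le> exp (y\<^sup>2 / 2)"
      using pos by (metis exp_le_cancel_iff exp_ln)
    then show ?thesis by simp
  qed
  show ?thesis using *[of x] *[of "- x"] by (cases "0 \<le> x") (auto simp: add.commute)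
qed

section \<open>Configurations, pairs of sites and their correlation\<close>

lemma finite_sk_configs [simp]: "finite (sk_configs N)"
  unfolding sk_configs_def by (intro finite_PiE) auto

lemma sk_configs_nonempty [simp]: "sk_configs N \<noteq> {}"
  unfolding sk_configs_def by (auto simp: PiE_eq_empty_iff)

lemma card_sk_configs: "card (sk_configs N) = 2 ^ N"
  unfolding sk_configs_def by (simp add: card_PiE numeral_2_eq_2)

lemma sk_configs_cases: "\<sigma> \<in> sk_configs N \<Longrightarrow> i \<in> {1..N} \<Longrightarrow> \<sigma> i = 1 \<or> \<sigma> i = - 1"
  unfolding sk_configs_def using PiE_mem[of \<sigma> "{1..N}" "\<lambda>_. {-1, 1}" i] by auto

lemma sk_configs_square: "\<sigma> \<in> sk_configs N \<Longrightarrow> i \<in> {1..N} \<Longrightarrow> \<sigma> i * \<sigma> i = 1"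
  using sk_configs_cases by fastforce

lemma sk_configs_abs: "\<sigma> \<in> sk_configs N \<Longrightarrow> i \<in> {1..N} \<Longrightarrow> \<bar>\<sigma> i\<bar> = 1"
  using sk_configs_cases by fastforce

lemma finite_sk_pairs [simp]: "finite (sk_pairs N)"
  by (rule finite_subset[of _ "{1..N} \<times> {1..N}"]) (auto simp: sk_pairs_def)

lemma sk_pairs_Suc: "sk_pairs (Suc N) = sk_pairs N \<union> {1..N} \<times> {Suc N}"
  by (auto simp: sk_pairs_def le_Suc_eq)

lemma sum_square_sk_pairs:
  fixes a :: "nat \<Rightarrow> real"
  shows "(\<Sum>i = 1..N. a i)\<^sup>2 = (\<Sum>i = 1..N. (a i)\<^sup>2) + 2 * (\<Sum>p\<in>sk_pairs N. a (fst p) * a (snd p))"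
proof (induction N)
  case 0
  have "sk_pairs 0 = {}" by (auto simp: sk_pairs_def)
  then show ?case by simp
next
  case (Suc N)
  have "(\<Sum>p\<in>sk_pairs (Suc N). a (fst p) * a (snd p))
    = (\<Sum>p\<in>sk_pairs N. a (fst p) * a (snd p)) + (\<Sum>p\<in>{1..N} \<times> {Suc N}. a (fst p) * a (snd p))"
    unfolding sk_pairs_Suc by (rule sum.union_disjoint) (simp_all, auto simp: sk_pairs_def)
  also have "(\<Sum>p\<in>{1..N} \<times> {Suc N}. a (fst p) * a (snd p)) = (\<Sum>i = 1..N. a i) * a (Suc N)"
    by (simp add: sum.cartesian_product' sum_distrib_right)
  finally show ?case using Suc by (simp add: power2_sum algebra_simps)
qed

text \<open>The normalization of the Hamiltonian is put into the observable, so the strength of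
  every coupling is \<beta> and the constant square is \<open>w = 1 / N\<close>.\<close>

definition sk_spin_pair :: "nat \<Rightarrow> nat \<times> nat \<Rightarrow> (nat \<Rightarrow> real) \<Rightarrow> real" where
  "sk_spin_pair N p \<sigma> = \<sigma> (fst p) * \<sigma> (snd p) / sqrt (real N)"

interpretation sk: gaussian_gibbs "sk_pairs N" "sk_configs N" "sk_spin_pair N" for N
  by unfold_locales auto

lemma sk_gibbs_unit:
  assumes "1 \<le> N"
  shows "gaussian_gibbs_unit (sk_pairs N) (sk_configs N) (sk_spin_pair N) (1 / real N)"
proof (unfold_locales)
  fix p \<sigma> assume "p \<in> sk_pairs N" "\<sigma> \<in> sk_configs N"
  then have "\<sigma> (fst p) * \<sigma> (fst p) = 1" "\<sigma> (snd p) * \<sigma> (snd p) = 1"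
    by (auto intro!: sk_configs_square simp: sk_pairs_def)
  moreover have "(\<sigma> (fst p) * \<sigma> (snd p))\<^sup>2 = (\<sigma> (fst p) * \<sigma> (fst p)) * (\<sigma> (snd p) * \<sigma> (snd p))"
    by (simp add: power2_eq_square mult_ac)
  ultimately have "(\<sigma> (fst p) * \<sigma> (snd p))\<^sup>2 = 1" by simp
  then show "(sk_spin_pair N p \<sigma>)\<^sup>2 = 1 / real N"
    by (simp add: sk_spin_pair_def power_divide)
qed simp

text \<open>With R the overlap, the right-hand side is (N R^2 - 1) / 2. The \<open>- 1\<close> is
  the diagonal of the squared sum: N terms equal to 1, divided by N.\<close>

lemma sk_corr:
  assumes "1 \<le> N" "\<sigma> \<in> sk_configs N" "\<tau> \<in> sk_configs N"
  shows "(\<Sum>p\<in>sk_pairs N. sk_spin_pair N p \<sigma> * sk_spin_pair N p \<tau>)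
    = ((\<Sum>i = 1..N. \<sigma> i * \<tau> i)\<^sup>2 / real N - 1) / 2"
proof -
  have "(\<Sum>i = 1..N. \<sigma> i * \<tau> i)\<^sup>2
      = (\<Sum>i = 1..N. (\<sigma> i * \<tau> i)\<^sup>2)
        + 2 * (\<Sum>p\<in>sk_pairs N. (\<sigma> (fst p) * \<tau> (fst p)) * (\<sigma> (snd p) * \<tau> (snd p)))"
    by (rule sum_square_sk_pairs)
  also have "(\<Sum>i = 1..N. (\<sigma> i * \<tau> i)\<^sup>2) = (\<Sum>i = 1..N. 1)"
  proof (intro sum.cong refl)
    fix i assume i: "i \<in> {1..N}"
    have "(\<sigma> i * \<tau> i)\<^sup>2 = (\<sigma> i * \<sigma> i) * (\<tau> i * \<tau> i)" by (simp add: power2_eq_square mult_ac)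
    then show "(\<sigma> i * \<tau> i)\<^sup>2 = 1" using sk_configs_square i assms by simp
  qed
  also have "(\<Sum>p\<in>sk_pairs N. (\<sigma> (fst p) * \<tau> (fst p)) * (\<sigma> (snd p) * \<tau> (snd p)))
      = real N * (\<Sum>p\<in>sk_pairs N. sk_spin_pair N p \<sigma> * sk_spin_pair N p \<tau>)"
    unfolding sum_distrib_left sk_spin_pair_def using assms(1) by (intro sum.cong refl) (simp add: field_simps)
  finally show ?thesis using assms(1) by (simp add: field_simps)
qed

lemma sum_sk_configs_exp:
  assumes "\<sigma> \<in> sk_configs N"
  shows "(\<Sum>\<tau>\<in>sk_configs N. exp (c * (\<Sum>i = 1..N. \<sigma> i * \<tau> i))) = (exp c + exp (- c)) ^ N"
proof -
  have "(\<Sum>\<tau>\<in>sk_configs N. exp (c * (\<Sum>i = 1..N. \<sigma> i * \<tau> i)))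
    = (\<Sum>\<tau>\<in>{1..N} \<rightarrow>\<^sub>E {-1, 1}. \<Prod>i = 1..N. exp (c * (\<sigma> i * \<tau> i)))"
    by (simp add: sk_configs_def sum_distrib_left exp_sum)
  also have "\<dots> = (\<Prod>i = 1..N. \<Sum>y\<in>{-1, 1}. exp (c * (\<sigma> i * y)))"
    by (subst prod_sum_PiE) auto
  also have "\<dots> = (\<Prod>i = 1..N. exp c + exp (- c))"
  proof (intro prod.cong refl)
    fix i assume "i \<in> {1..N}"
    from sk_configs_cases[OF assms this] show "(\<Sum>y\<in>{-1, 1}. exp (c * (\<sigma> i * y))) = exp c + exp (- c)"
      by (auto simp: add.commute)
  qed
  finally show ?thesis by simp
qed

text \<open>An auxiliary Gaussian z linearizes the square (Hubbard-Stratonovich). The sum over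
  \<tau> then factorizes into N equal cosh factors, whose Gaussian bound leaves
  \<open>exp (\<kappa> * z^2 / 2)\<close>; its integrability uses
  \<open>\<kappa> < 1\<close>.\<close>

lemma sum_exp_overlap_square:
  assumes "1 \<le> N" "0 \<le> \<kappa>" "\<kappa> < 1"
  shows "(\<Sum>\<sigma>\<in>sk_configs N. \<Sum>\<tau>\<in>sk_configs N. exp (\<kappa> / 2 * ((\<Sum>i = 1..N. \<sigma> i * \<tau> i)\<^sup>2 / real N)))
    \<le> 1 / sqrt (1 - \<kappa>) * (card (sk_configs N))\<^sup>2"
proof -
  define a where "a = sqrt (\<kappa> / real N)"
  have a2: "a\<^sup>2 = \<kappa> / real N" using assms by (simp add: a_def)
  let ?S = "\<lambda>\<sigma> \<tau> :: nat \<Rightarrow> real. \<Sum>i = 1..N. \<sigma> i * \<tau> i"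
  have "(\<Sum>\<tau>\<in>sk_configs N. exp (\<kappa> / 2 * ((?S \<sigma> \<tau>)\<^sup>2 / real N))) \<le> 2 ^ N * (1 / sqrt (1 - \<kappa>))"
    if \<sigma>: "\<sigma> \<in> sk_configs N" for \<sigma>
  proof -
    have lin: "exp (\<kappa> / 2 * ((?S \<sigma> \<tau>)\<^sup>2 / real N)) = (\<integral>z. exp ((a * ?S \<sigma> \<tau>) * z) \<partial>gauss)" for \<tau>
    proof -
      have "\<kappa> / 2 * (S\<^sup>2 / real N) = (a * S)\<^sup>2 / 2" for S
        by (simp add: power_mult_distrib a2)
      then show ?thesis unfolding gauss_exp by (rule arg_cong)
    qed
    have pw: "(\<Sum>\<tau>\<in>sk_configs N. exp ((a * ?S \<sigma> \<tau>) * z)) = (exp (a * z) + exp (- (a * z))) ^ N" for z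
      unfolding sum_sk_configs_exp[OF \<sigma>, of "a * z", symmetric]
      by (intro sum.cong refl arg_cong[where f = exp]) simp
    have "(\<Sum>\<tau>\<in>sk_configs N. exp (\<kappa> / 2 * ((?S \<sigma> \<tau>)\<^sup>2 / real N)))
        = (\<integral>z. (\<Sum>\<tau>\<in>sk_configs N. exp ((a * ?S \<sigma> \<tau>) * z)) \<partial>gauss)"
      unfolding lin by (rule Bochner_Integration.integral_sum[symmetric], rule gauss_exp_integrable)
    also have "\<dots> = (\<integral>z. (exp (a * z) + exp (- (a * z))) ^ N \<partial>gauss)"
      unfolding pw ..
    also have "\<dots> \<le> (\<integral>z. 2 ^ N * exp (\<kappa> * z\<^sup>2 / 2) \<partial>gauss)"
    proof (rule integral_mono)
      have "integrable gauss (\<lambda>z. (\<Sum>\<tau>\<in>sk_configs N. exp ((a * ?S \<sigma> \<tau>) * z)))"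
        by (intro Bochner_Integration.integrable_sum gauss_exp_integrable)
      then show "integrable gauss (\<lambda>z. (exp (a * z) + exp (- (a * z))) ^ N)"
        unfolding pw .
      show "integrable gauss (\<lambda>z. 2 ^ N * exp (\<kappa> * z\<^sup>2 / 2))"
        using assms by (intro integrable_mult_right gauss_exp_square_integrable)
      fix z
      have "(exp (a * z) + exp (- (a * z))) ^ N \<le> (2 * exp ((a * z)\<^sup>2 / 2)) ^ N"
        by (intro power_mono exp_plus_exp_minus_le) (simp add: add_nonneg_nonneg)
      also have "\<dots> = 2 ^ N * exp (real N * ((a * z)\<^sup>2 / 2))"
        unfolding exp_of_nat_mult by (rule power_mult_distrib)
      also have "real N * ((a * z)\<^sup>2 / 2) = \<kappa> * z\<^sup>2 / 2"
        using assms(1) by (simp add: power_mult_distrib a2)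
      finally show "(exp (a * z) + exp (- (a * z))) ^ N \<le> 2 ^ N * exp (\<kappa> * z\<^sup>2 / 2)" .
    qed
    also have "\<dots> = 2 ^ N * (1 / sqrt (1 - \<kappa>))"
      using gauss_exp_square[OF assms(3)] by simp
    finally show ?thesis .
  qed
  then have "(\<Sum>\<sigma>\<in>sk_configs N. \<Sum>\<tau>\<in>sk_configs N. exp (\<kappa> / 2 * ((?S \<sigma> \<tau>)\<^sup>2 / real N)))
      \<le> (\<Sum>\<sigma>\<in>sk_configs N. 2 ^ N * (1 / sqrt (1 - \<kappa>)))"
    by (rule sum_mono)
  also have "\<dots> = 1 / sqrt (1 - \<kappa>) * (card (sk_configs N))\<^sup>2"
    by (simp add: card_sk_configs power2_eq_square)
  finally show ?thesis .
qed

lemma sk_exp_moment: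
  assumes \<beta>: "0 < \<beta>" "\<beta> < 1"
  shows "\<exists>\<delta>>0. \<exists>C. \<forall>N\<ge>1. \<forall>n l l'. l \<in> {1..n} \<longrightarrow> l' \<in> {1..n} \<longrightarrow> l \<noteq> l' \<longrightarrow>
    sk.mean N (\<lambda>_. \<beta>) n (\<lambda>s. exp (\<delta> * (real N * (sk_overlap N s l l')\<^sup>2))) \<le> C"
proof -
  \<comment> \<open>Half of the gap between \<beta>^2 and 1: for b up to \<beta>,
    \<open>b^2 + \<theta>\<close> stays below 1 by at least the other half, which gives the constant
    C.\<close>
  define \<theta> where "\<theta> = (1 - \<beta>\<^sup>2) / 2"
  define C where "C = 1 / sqrt ((1 - \<beta>\<^sup>2) / 2)"
  define \<delta> where "\<delta> = \<theta> / (1 + 2 * exp (6 * \<beta> / \<theta>))"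
  have \<beta>2: "\<beta>\<^sup>2 < 1" using \<beta> by (simp add: power_less_one_iff)
  have \<theta>: "0 < \<theta>" using \<beta>2 by (simp add: \<theta>_def)
  have \<delta>: "0 < \<delta>" using \<theta> by (simp add: \<delta>_def add_pos_pos)
  \<comment> \<open>The exponent is halved because the correlation is (N R^2 - 1) / 2; its
    \<open>- 1\<close> gives the factor \<open>exp (\<delta> / 2)\<close>.\<close>
  have main: "sk.mean N (\<lambda>_. \<beta>) n (\<lambda>s. exp (\<delta> / 2 * (real N * (sk_overlap N s l l')\<^sup>2)))
      \<le> exp (\<delta> / 2) * (1 + (6 + 2 * C) / \<theta> + C)"
    if N: "1 \<le> N" and l: "l \<in> {1..n}" "l' \<in> {1..n}" "l \<noteq> l'" for N n l l'
  proof -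
    interpret u: gaussian_gibbs_unit "sk_pairs N" "sk_configs N" "sk_spin_pair N" "1 / real N"
      by (rule sk_gibbs_unit[OF N])
    have C: "(\<Sum>\<sigma>\<in>sk_configs N. \<Sum>\<tau>\<in>sk_configs N. exp ((b\<^sup>2 + \<theta>) * u.corr \<sigma> \<tau>)) \<le> C * (card (sk_configs N))\<^sup>2"
      if b: "0 \<le> b" "b \<le> \<beta>" for b
    proof -
      define \<kappa> where "\<kappa> = b\<^sup>2 + \<theta>"
      have b2: "b\<^sup>2 \<le> \<beta>\<^sup>2" using b by (intro power_mono) auto
      have \<kappa>: "0 \<le> \<kappa>" "\<kappa> < 1" "(1 - \<beta>\<^sup>2) / 2 \<le> 1 - \<kappa>"
        using b2 \<beta>2 zero_le_power2[of b] unfolding \<kappa>_def \<theta>_def by argo+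
      have "(\<Sum>\<sigma>\<in>sk_configs N. \<Sum>\<tau>\<in>sk_configs N. exp (\<kappa> * u.corr \<sigma> \<tau>))
        \<le> (\<Sum>\<sigma>\<in>sk_configs N. \<Sum>\<tau>\<in>sk_configs N. exp (\<kappa> / 2 * ((\<Sum>i = 1..N. \<sigma> i * \<tau> i)\<^sup>2 / real N)))"
        using N \<kappa>(1) by (intro sum_mono) (simp add: u.corr_def sk_corr right_diff_distrib)
      also have "\<dots> \<le> 1 / sqrt (1 - \<kappa>) * (card (sk_configs N))\<^sup>2"
        by (rule sum_exp_overlap_square[OF N \<kappa>(1,2)])
      also have "\<dots> \<le> C * (card (sk_configs N))\<^sup>2"
        unfolding C_def using \<kappa> \<beta>2 by (intro mult_right_mono divide_left_mono mult_pos_pos) auto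
      finally show ?thesis by (simp add: \<kappa>_def)
    qed
    have "sk.mean N (\<lambda>_. \<beta>) n (\<lambda>s. exp (\<delta> / 2 * (real N * (sk_overlap N s l l')\<^sup>2)))
      = (\<integral>x. exp (\<delta> / 2) * u.pair_avg \<beta> x (\<lambda>\<sigma> \<tau>. exp (\<delta> * u.corr \<sigma> \<tau>)) \<partial>sk.couplings N)"
      unfolding sk.mean_def
    proof (rule Bochner_Integration.integral_cong[OF refl])
      fix x
      let ?g = "\<lambda>\<sigma> \<tau>. exp (\<delta> / 2 * ((\<Sum>i = 1..N. \<sigma> i * \<tau> i)\<^sup>2 / real N))"
      have "sk.bracket N (\<lambda>_. \<beta>) x n (\<lambda>s. exp (\<delta> / 2 * (real N * (sk_overlap N s l l')\<^sup>2)))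
        = sk.bracket N (\<lambda>_. \<beta>) x n (\<lambda>s. ?g (s l) (s l'))"
        using N by (simp add: sk_overlap_def power_mult_distrib power_divide power2_eq_square)
      also have "\<dots> = u.pair_avg \<beta> x ?g"
        unfolding sk.bracket_def u.pair_avg_def using l
        by (subst replica_avg_two) (auto simp: gibbs_weight_sum)
      also have "\<dots> = u.pair_avg \<beta> x (\<lambda>\<sigma> \<tau>. 0 + exp (\<delta> / 2) * exp (\<delta> * u.corr \<sigma> \<tau>))"
        unfolding u.pair_avg_def using N
        by (intro sum.cong refl) (simp add: u.corr_def sk_corr right_diff_distrib diff_divide_distrib flip: exp_add)
      finally show "sk.bracket N (\<lambda>_. \<beta>) x n (\<lambda>s. exp (\<delta> / 2 * (real N * (sk_overlap N s l l')\<^sup>2)))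
        = exp (\<delta> / 2) * u.pair_avg \<beta> x (\<lambda>\<sigma> \<tau>. exp (\<delta> * u.corr \<sigma> \<tau>))"
        unfolding u.pair_avg_affine by simp
    qed
    also have "\<dots> = exp (\<delta> / 2) * (\<integral>x. u.pair_avg \<beta> x (\<lambda>\<sigma> \<tau>. exp (\<delta> * u.corr \<sigma> \<tau>)) \<partial>sk.couplings N)"
      by simp
    also have "\<dots> \<le> exp (\<delta> / 2) * (1 + (6 + 2 * C) / \<theta> + C)"
      unfolding \<delta>_def using \<beta> \<theta> C by (intro mult_left_mono u.corr_exp_moment) auto
    finally show ?thesis .
  qed
  show ?thesis
    by (rule exI[of _ "\<delta> / 2"], intro conjI exI[of _ "exp (\<delta> / 2) * (1 + (6 + 2 * C) / \<theta> + C)"] allI impI main)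
       (use \<delta> in auto)
qed

section \<open>The cavity path\<close>

text \<open>Pairs are increasing, so \<open>snd p = N\<close> singles out the couplings of the last
  spin. The affine form in s is the one that \<open>sk.mean_deriv_path\<close> differentiates; s is
  the square root of the time t.\<close>

definition path_coupling :: "real \<Rightarrow> nat \<Rightarrow> real \<Rightarrow> nat \<times> nat \<Rightarrow> real" where
  "path_coupling \<beta> N s p = (if snd p = N then 0 else \<beta>) + s * (if snd p = N then \<beta> else 0)"

abbreviation nu_path :: "real \<Rightarrow> nat \<Rightarrow> real \<Rightarrow> nat \<Rightarrow> ((nat \<Rightarrow> nat \<Rightarrow> real) \<Rightarrow> real) \<Rightarrow> real" where
  "nu_path \<beta> N s n f \<equiv> sk.mean N (path_coupling \<beta> N s) n f"

text \<open>The normalization is still by N, not by N - 1, so that the full overlap differs from it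
  by exactly the product of the two last spins over N.\<close>

definition cav_overlap :: "nat \<Rightarrow> (nat \<Rightarrow> nat \<Rightarrow> real) \<Rightarrow> nat \<Rightarrow> nat \<Rightarrow> real" where
  "cav_overlap N t l l' = 1 / real N * (\<Sum>i\<in>{1..<N}. t l i * t l' i)"

lemma path_coupling_one: "path_coupling \<beta> N 1 = (\<lambda>_. \<beta>)"
  by (auto simp: path_coupling_def)

lemma replica_config: "t \<in> {1..n} \<rightarrow>\<^sub>E sk_configs N \<Longrightarrow> l \<in> {1..n} \<Longrightarrow> t l \<in> sk_configs N"
  by (rule PiE_mem)

lemma sk_overlap_split:
  "1 \<le> N \<Longrightarrow> sk_overlap N t l l' = cav_overlap N t l l' + t l N * t l' N / real N"
proof -
  assume "1 \<le> N"
  then have "{1..N} = insert N {1..<N}" by auto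
  then have "(\<Sum>i = 1..N. t l i * t l' i) = t l N * t l' N + (\<Sum>i\<in>{1..<N}. t l i * t l' i)" by simp
  then show ?thesis unfolding sk_overlap_def cav_overlap_def by (simp add: add_divide_distrib)
qed

lemma cav_overlap_abs:
  assumes "1 \<le> N" "t l \<in> sk_configs N" "t l' \<in> sk_configs N"
  shows "\<bar>cav_overlap N t l l'\<bar> \<le> 1"
proof -
  have "\<bar>\<Sum>i\<in>{1..<N}. t l i * t l' i\<bar> \<le> (\<Sum>i\<in>{1..<N}. \<bar>t l i * t l' i\<bar>)" by (rule sum_abs)
  also have "\<dots> = (\<Sum>i\<in>{1..<N}. 1)"
    using assms by (intro sum.cong refl) (simp add: abs_mult sk_configs_abs)
  also have "\<dots> \<le> real N" by simp
  finally show ?thesis unfolding cav_overlap_def using assms(1) by (simp add: abs_mult)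
qed

lemma sum_last_spin_pairs:
  assumes "1 \<le> N"
  shows "(\<Sum>p\<in>sk_pairs N. if snd p = N then sk_spin_pair N p \<sigma> * sk_spin_pair N p \<tau> else 0)
    = \<sigma> N * \<tau> N * (1 / real N * (\<Sum>i\<in>{1..<N}. \<sigma> i * \<tau> i))"
proof -
  have "(\<Sum>p\<in>sk_pairs N. if snd p = N then sk_spin_pair N p \<sigma> * sk_spin_pair N p \<tau> else 0)
    = (\<Sum>p\<in>{1..<N} \<times> {N}. sk_spin_pair N p \<sigma> * sk_spin_pair N p \<tau>)"
    by (rule sum.mono_neutral_cong_right) (simp_all, auto simp: sk_pairs_def)
  also have "\<dots> = (\<Sum>i\<in>{1..<N}. sk_spin_pair N (i, N) \<sigma> * sk_spin_pair N (i, N) \<tau>)"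
    by (simp add: sum.cartesian_product')
  also have "\<dots> = (\<Sum>i\<in>{1..<N}. \<sigma> N * \<tau> N * (1 / real N) * (\<sigma> i * \<tau> i))"
    using assms by (intro sum.cong refl) (simp add: sk_spin_pair_def)
  finally show ?thesis by (simp only: sum_distrib_left mult_ac)
qed

text \<open>A term with l = l' compares a replica with itself and has the same value for every l.
  The n old replicas count 1 each and the new one - n, so the diagonal cancels and only overlaps of
  distinct replicas enter derivatives along the path.\<close>

lemma sum_cav_coeff_diag: "(\<Sum>l = 1..Suc n. cav_coeff n l * cav_coeff (Suc n) l) = 0"
proof -
  have "(\<Sum>l = 1..n. cav_coeff n l * cav_coeff (Suc n) l) = (\<Sum>l = 1..n. 1)"
    by (intro sum.cong) (auto simp: cav_coeff_def)
  then show ?thesis by (simp add: cav_coeff_def)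
qed

lemma cavity_double_mult:
  assumes N: "1 \<le> N" and t: "t \<in> {1..Suc (Suc n)} \<rightarrow>\<^sub>E sk_configs N"
  shows "(\<Sum>p\<in>sk_pairs N. if snd p = N then
      cav_mult (sk_spin_pair N p) (Suc n) (cav_mult (sk_spin_pair N p) n f) t else 0)
    = (\<Sum>l = 1..Suc n. \<Sum>l'\<in>{1..Suc (Suc n)} - {l}. cav_coeff n l * cav_coeff (Suc n) l' *
        (f t * (t l N * t l' N * cav_overlap N t l l')))"
proof -
  define G where "G l l' = (\<Sum>p\<in>sk_pairs N. if snd p = N then sk_spin_pair N p (t l) * sk_spin_pair N p (t l') else 0)" for l l'
  have G: "G l l' = t l N * t l' N * cav_overlap N t l l'" for l l'
    unfolding G_def cav_overlap_def by (rule sum_last_spin_pairs[OF N])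
  have G_diag: "G l l = (real N - 1) / real N" if "l \<in> {1..Suc n}" for l
  proof -
    have c: "t l \<in> sk_configs N" using t by (rule replica_config) (use that in auto)
    have "(\<Sum>i\<in>{1..<N}. t l i * t l i) = (\<Sum>i\<in>{1..<N}. 1)"
      by (intro sum.cong refl sk_configs_square[OF c]) auto
    then show ?thesis unfolding G cav_overlap_def
      using N sk_configs_square[OF c, of N] by (simp add: of_nat_diff)
  qed
  have "(\<Sum>p\<in>sk_pairs N. if snd p = N then
      cav_mult (sk_spin_pair N p) (Suc n) (cav_mult (sk_spin_pair N p) n f) t else 0)
    = (\<Sum>p\<in>sk_pairs N. \<Sum>l = 1..Suc n. \<Sum>l' = 1..Suc (Suc n). f t * (cav_coeff n l * cav_coeff (Suc n) l' *
        (if snd p = N then sk_spin_pair N p (t l) * sk_spin_pair N p (t l') else 0)))"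
  proof (intro sum.cong refl)
    fix p
    show "(if snd p = N then cav_mult (sk_spin_pair N p) (Suc n) (cav_mult (sk_spin_pair N p) n f) t else 0)
      = (\<Sum>l = 1..Suc n. \<Sum>l' = 1..Suc (Suc n). f t * (cav_coeff n l * cav_coeff (Suc n) l' *
        (if snd p = N then sk_spin_pair N p (t l) * sk_spin_pair N p (t l') else 0)))"
    proof (cases "snd p = N")
      case True
      then show ?thesis unfolding cav_mult_def
        by (simp only: if_True simp_thms mult.assoc sum_product) (simp only: if_True simp_thms sum_distrib_left mult_ac)
    qed simp
  qed
  also have "\<dots> = (\<Sum>l = 1..Suc n. \<Sum>l' = 1..Suc (Suc n). f t * (cav_coeff n l * cav_coeff (Suc n) l' * G l l'))"
    unfolding G_def sum_distrib_left
    by (subst sum.swap, rule sum.cong[OF refl], subst sum.swap, rule refl)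
  also have "\<dots> = (\<Sum>l = 1..Suc n. f t * (cav_coeff n l * cav_coeff (Suc n) l * G l l)
      + (\<Sum>l'\<in>{1..Suc (Suc n)} - {l}. f t * (cav_coeff n l * cav_coeff (Suc n) l' * G l l')))"
    by (intro sum.cong refl, rule sum.remove) auto
  also have "\<dots> = f t * ((real N - 1) / real N) * (\<Sum>l = 1..Suc n. cav_coeff n l * cav_coeff (Suc n) l)
      + (\<Sum>l = 1..Suc n. \<Sum>l'\<in>{1..Suc (Suc n)} - {l}. f t * (cav_coeff n l * cav_coeff (Suc n) l' * G l l'))"
  proof -
    have "(\<Sum>l = 1..Suc n. f t * (cav_coeff n l * cav_coeff (Suc n) l * G l l))
      = (\<Sum>l = 1..Suc n. f t * (cav_coeff n l * cav_coeff (Suc n) l * ((real N - 1) / real N)))"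
      by (intro sum.cong refl) (simp only: G_diag)
    also have "\<dots> = f t * ((real N - 1) / real N) * (\<Sum>l = 1..Suc n. cav_coeff n l * cav_coeff (Suc n) l)"
      unfolding sum_distrib_left by (intro sum.cong refl) (simp only: mult_ac)
    finally show ?thesis unfolding sum.distrib by simp
  qed
  also have "\<dots> = (\<Sum>l = 1..Suc n. \<Sum>l'\<in>{1..Suc (Suc n)} - {l}. f t * (cav_coeff n l * cav_coeff (Suc n) l' * G l l'))"
    unfolding sum_cav_coeff_diag by simp
  finally show ?thesis unfolding G by (simp only: mult_ac)
qed

lemma nu_path_deriv:
  assumes N: "1 \<le> N" and f: "depends_on {1..n} f"
  shows "((\<lambda>s. nu_path \<beta> N s n f) has_real_derivative
    \<beta>\<^sup>2 * s * (\<Sum>l = 1..Suc n. \<Sum>l'\<in>{1..Suc (Suc n)} - {l}. cav_coeff n l * cav_coeff (Suc n) l' *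
      nu_path \<beta> N s (Suc (Suc n)) (\<lambda>t. f t * (t l N * t l' N * cav_overlap N t l l')))) (at s)"
proof -
  let ?a = "\<lambda>p. if snd p = N then 0 else \<beta>" and ?c = "\<lambda>p. if snd p = N then \<beta> else 0"
  let ?F = "\<lambda>p. cav_mult (sk_spin_pair N p) (Suc n) (cav_mult (sk_spin_pair N p) n f)"
  have path: "path_coupling \<beta> N = (\<lambda>s p. ?a p + s * ?c p)"
    by (auto simp: path_coupling_def fun_eq_iff)
  let ?m = "nu_path \<beta> N s (Suc (Suc n))"
  have "((\<lambda>s. nu_path \<beta> N s n f) has_real_derivative
      (\<Sum>p\<in>sk_pairs N. ?c p * (?a p + s * ?c p) * ?m (?F p))) (at s)"
    unfolding path by (rule sk.mean_deriv_path[OF f])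
  also have "(\<Sum>p\<in>sk_pairs N. ?c p * (?a p + s * ?c p) * ?m (?F p))
      = (\<Sum>p\<in>sk_pairs N. \<beta>\<^sup>2 * s * ?m (\<lambda>t. if snd p = N then ?F p t else 0))"
    by (intro sum.cong refl) (simp add: sk.mean_const power2_eq_square)
  also have "\<dots> = \<beta>\<^sup>2 * s * ?m (\<lambda>t. \<Sum>p\<in>sk_pairs N. if snd p = N then ?F p t else 0)"
    by (simp add: sk.mean_sum sum_distrib_left)
  also have "?m (\<lambda>t. \<Sum>p\<in>sk_pairs N. if snd p = N then ?F p t else 0)
      = ?m (\<lambda>t. \<Sum>l = 1..Suc n. \<Sum>l'\<in>{1..Suc (Suc n)} - {l}. cav_coeff n l * cav_coeff (Suc n) l' *
          (f t * (t l N * t l' N * cav_overlap N t l l')))"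
    by (rule sk.mean_cong) (rule cavity_double_mult[OF N])
  also have "\<dots> = (\<Sum>l = 1..Suc n. \<Sum>l'\<in>{1..Suc (Suc n)} - {l}. cav_coeff n l * cav_coeff (Suc n) l' *
      ?m (\<lambda>t. f t * (t l N * t l' N * cav_overlap N t l l')))"
    by (simp only: sk.mean_sum sk.mean_cmult)
  finally show ?thesis .
qed

definition cav_total :: "nat \<Rightarrow> real" where
  "cav_total n = (\<Sum>l = 1..Suc n. \<Sum>l'\<in>{1..Suc (Suc n)} - {l}. \<bar>cav_coeff n l * cav_coeff (Suc n) l'\<bar>)"

text \<open>Gronwall's argument: last spins and cavity overlaps are bounded by 1, so the derivative
  is at most \<open>cav_total n\<close> times the average itself, and
  \<open>exp (cav_total n * s)\<close> times the average is nondecreasing. This carries bounds for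
  the original model, at \<open>s = 1\<close>, to the whole path.\<close>

lemma nu_path_le_end:
  assumes N: "1 \<le> N" and f: "depends_on {1..n} f" and nonneg: "\<And>t. 0 \<le> f t"
    and \<beta>: "0 \<le> \<beta>" "\<beta> \<le> 1" and s: "0 \<le> s" "s \<le> 1"
  shows "nu_path \<beta> N s n f \<le> exp (cav_total n) * nu_path \<beta> N 1 n f"
proof -
  let ?K = "cav_total n"
  define D where "D s = \<beta>\<^sup>2 * s * (\<Sum>l = 1..Suc n. \<Sum>l'\<in>{1..Suc (Suc n)} - {l}. cav_coeff n l * cav_coeff (Suc n) l' *
      nu_path \<beta> N s (Suc (Suc n)) (\<lambda>t. f t * (t l N * t l' N * cav_overlap N t l l')))" for s
  have nu_nonneg: "0 \<le> nu_path \<beta> N s n f" for s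
    using sk.mean_mono[of n N "\<lambda>_. 0" f] nonneg by (simp add: sk.mean_const)
  have K: "0 \<le> ?K" unfolding cav_total_def by (intro sum_nonneg) auto
  have D_bound: "\<bar>D s\<bar> \<le> ?K * nu_path \<beta> N s n f" if s: "0 \<le> s" "s \<le> 1" for s
  proof -
    have one: "\<bar>nu_path \<beta> N s (Suc (Suc n)) (\<lambda>t. f t * (t l N * t l' N * cav_overlap N t l l'))\<bar>
        \<le> nu_path \<beta> N s n f" if l: "l \<in> {1..Suc (Suc n)}" "l' \<in> {1..Suc (Suc n)}" for l l'
    proof -
      have "\<bar>nu_path \<beta> N s (Suc (Suc n)) (\<lambda>t. f t * (t l N * t l' N * cav_overlap N t l l'))\<bar>
        \<le> nu_path \<beta> N s (Suc (Suc n)) (\<lambda>t. \<bar>f t * (t l N * t l' N * cav_overlap N t l l')\<bar>)"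
        by (rule sk.mean_abs)
      also have "\<dots> \<le> nu_path \<beta> N s (Suc (Suc n)) f"
      proof (rule sk.mean_mono)
        fix t assume t: "t \<in> {1..Suc (Suc n)} \<rightarrow>\<^sub>E sk_configs N"
        have c: "t l \<in> sk_configs N" "t l' \<in> sk_configs N" using t l by (auto intro: replica_config)
        have "f t * \<bar>cav_overlap N t l l'\<bar> \<le> f t * 1"
          using N c by (intro mult_left_mono nonneg cav_overlap_abs)
        then show "\<bar>f t * (t l N * t l' N * cav_overlap N t l l')\<bar> \<le> f t"
          using N c nonneg by (simp add: abs_mult sk_configs_abs)
      qed
      also have "\<dots> = nu_path \<beta> N s n f" by (rule sk.mean_marginal[OF f]) simp
      finally show ?thesis .
    qed
    have "\<bar>D s\<bar> = \<beta>\<^sup>2 * s * \<bar>\<Sum>l = 1..Suc n. \<Sum>l'\<in>{1..Suc (Suc n)} - {l}. cav_coeff n l * cav_coeff (Suc n) l' *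
      nu_path \<beta> N s (Suc (Suc n)) (\<lambda>t. f t * (t l N * t l' N * cav_overlap N t l l'))\<bar>"
      using s by (simp add: D_def abs_mult)
    also have "\<dots> \<le> 1 * (\<Sum>l = 1..Suc n. \<Sum>l'\<in>{1..Suc (Suc n)} - {l}. \<bar>cav_coeff n l * cav_coeff (Suc n) l'\<bar> *
      nu_path \<beta> N s n f)"
    proof (rule mult_mono)
      show "\<beta>\<^sup>2 * s \<le> 1" using s \<beta> by (simp add: mult_le_one power_le_one)
      show "\<bar>\<Sum>l = 1..Suc n. \<Sum>l'\<in>{1..Suc (Suc n)} - {l}. cav_coeff n l * cav_coeff (Suc n) l' *
        nu_path \<beta> N s (Suc (Suc n)) (\<lambda>t. f t * (t l N * t l' N * cav_overlap N t l l'))\<bar>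
        \<le> (\<Sum>l = 1..Suc n. \<Sum>l'\<in>{1..Suc (Suc n)} - {l}. \<bar>cav_coeff n l * cav_coeff (Suc n) l'\<bar> * nu_path \<beta> N s n f)"
        by (intro order_trans[OF sum_abs] sum_mono, subst abs_mult, intro mult_left_mono one) auto
    qed auto
    finally show ?thesis by (simp only: cav_total_def sum_distrib_right mult_1)
  qed
  have "exp (?K * s) * nu_path \<beta> N s n f \<le> exp (?K * 1) * nu_path \<beta> N 1 n f"
  proof (rule DERIV_nonneg_imp_nondecreasing[OF s(2)])
    fix r assume r: "s \<le> r" "r \<le> 1"
    have "((\<lambda>s. nu_path \<beta> N s n f) has_real_derivative D r) (at r)"
      unfolding D_def by (rule nu_path_deriv[OF N f])
    then have "((\<lambda>s. exp (?K * s) * nu_path \<beta> N s n f) has_real_derivative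
        exp (?K * r) * (?K * nu_path \<beta> N r n f + D r)) (at r)"
      by (auto intro!: derivative_eq_intros simp: algebra_simps)
    moreover have "0 \<le> exp (?K * r) * (?K * nu_path \<beta> N r n f + D r)"
      using D_bound[of r] r s by (intro mult_nonneg_nonneg) auto
    ultimately show "\<exists>y. ((\<lambda>s. exp (?K * s) * nu_path \<beta> N s n f) has_real_derivative y) (at r) \<and> 0 \<le> y"
      by blast
  qed
  moreover have "1 * nu_path \<beta> N s n f \<le> exp (?K * s) * nu_path \<beta> N s n f"
    using K s nu_nonneg by (intro mult_right_mono) auto
  ultimately show ?thesis by simp
qed

section \<open>Products of overlaps and their moments\<close>

definition pair_prod ::
  "((nat \<Rightarrow> nat \<Rightarrow> real) \<Rightarrow> nat \<Rightarrow> nat \<Rightarrow> real) \<Rightarrow> (nat \<times> nat) list \<Rightarrow> (nat \<Rightarrow> nat \<Rightarrow> real) \<Rightarrow> real" where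
  "pair_prod R es t = (\<Prod>e\<leftarrow>es. R t (fst e) (snd e))"

definition pairs_in :: "nat \<Rightarrow> (nat \<times> nat) list \<Rightarrow> bool" where
  "pairs_in n es \<longleftrightarrow> (\<forall>e\<in>set es. fst e \<in> {1..n} \<and> snd e \<in> {1..n} \<and> fst e \<noteq> snd e)"

lemma abs_prod_list_le_power:
  fixes xs :: "real list"
  assumes "\<And>x. x \<in> set xs \<Longrightarrow> \<bar>x\<bar> \<le> B"
  shows "\<bar>prod_list xs\<bar> \<le> B ^ length xs"
  using assms
proof (induction xs)
  case (Cons a xs)
  then have "0 \<le> B" using abs_ge_zero order_trans by (metis list.set_intros(1))
  then show ?case using Cons by (auto simp: abs_mult intro!: mult_mono)
qed simp

text \<open>Takes the place of Hoelder's inequality: a product is at most the corresponding power of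
  its largest factor, which is one of the summands. The \<open>1\<close> covers the empty
  list.\<close>

lemma abs_prod_list_le_sum:
  fixes xs :: "real list"
  shows "\<bar>prod_list xs\<bar> \<le> 1 + (\<Sum>i<length xs. \<bar>xs ! i\<bar> ^ length xs)"
proof (cases "xs = []")
  case False
  define M where "M = Max (abs ` set xs)"
  have "M \<in> abs ` set xs" unfolding M_def using False by (intro Max_in) auto
  then obtain i where i: "i < length xs" "M = \<bar>xs ! i\<bar>" by (auto simp: in_set_conv_nth)
  have "\<bar>prod_list xs\<bar> \<le> M ^ length xs"
    by (rule abs_prod_list_le_power) (simp add: M_def)
  also have "\<dots> \<le> (\<Sum>i<length xs. \<bar>xs ! i\<bar> ^ length xs)"
    unfolding i(2) using i(1) by (intro member_le_sum[of i _ "\<lambda>i. \<bar>xs ! i\<bar> ^ length xs"]) auto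
  finally show ?thesis by simp
qed simp

text \<open>Follows from (1 + x / k)^k \<le> exp x at x = \<gamma> z^2; the additive 1 pays for
  passing from \<bar>z\<bar> to its square.\<close>

lemma abs_power_le_exp_square:
  fixes z \<gamma> :: real
  assumes "0 < \<gamma>"
  shows "\<bar>z\<bar> ^ k \<le> (1 + (real k / \<gamma>) ^ k) * exp (\<gamma> * z\<^sup>2)"
proof (cases "k = 0")
  case False
  have e: "1 \<le> exp (\<gamma> * z\<^sup>2)" using assms by simp
  have "(z\<^sup>2) ^ k \<le> (real k / \<gamma> * (1 + \<gamma> * z\<^sup>2 / real k)) ^ k"
    using assms False by (intro power_mono) (auto simp: field_simps)
  also have "\<dots> = (real k / \<gamma>) ^ k * (1 + \<gamma> * z\<^sup>2 / real k) ^ k" by (rule power_mult_distrib)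
  also have "\<dots> \<le> (real k / \<gamma>) ^ k * exp (\<gamma> * z\<^sup>2)"
    using assms False by (intro mult_left_mono exp_ge_one_plus_x_over_n_power_n)
      (auto intro: order_trans[of _ 0])
  finally have 1: "(z\<^sup>2) ^ k \<le> (real k / \<gamma>) ^ k * exp (\<gamma> * z\<^sup>2)" .
  have "\<bar>z\<bar> ^ k \<le> 1 + (z\<^sup>2) ^ k"
  proof (cases "\<bar>z\<bar> \<le> 1")
    case True
    then show ?thesis using power_le_one[of "\<bar>z\<bar>" k] by (simp add: add_increasing2)
  next
    case False
    then have "\<bar>z\<bar> * 1 \<le> \<bar>z\<bar> * \<bar>z\<bar>" by (intro mult_left_mono) auto
    then have "\<bar>z\<bar> \<le> z\<^sup>2" by (simp add: power2_eq_square)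
    then have "\<bar>z\<bar> ^ k \<le> (z\<^sup>2) ^ k" by (intro power_mono) auto
    then show ?thesis by simp
  qed
  then show ?thesis using 1 e unfolding distrib_right by linarith
next
  case True
  have e: "1 \<le> exp (\<gamma> * z\<^sup>2)" using assms by simp
  have "\<bar>z\<bar> ^ k = 1" "(1 + (real k / \<gamma>) ^ k) * exp (\<gamma> * z\<^sup>2) = 2 * exp (\<gamma> * z\<^sup>2)"
    using True by auto
  with e show ?thesis by linarith
qed

lemma pair_prod_moment:
  assumes N: "1 \<le> N" and \<gamma>: "0 < \<gamma>" and es: "pairs_in n es" "length es = k"
    and C: "\<And>l l'. l \<in> {1..n} \<Longrightarrow> l' \<in> {1..n} \<Longrightarrow> l \<noteq> l' \<Longrightarrow>
      sk.mean N c n (\<lambda>t. exp (\<gamma> * (real N * (R t l l')\<^sup>2))) \<le> C"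
  shows "sk.mean N c n (\<lambda>t. \<bar>pair_prod R es t\<bar>)
    \<le> (1 + real k * ((1 + (real k / \<gamma>) ^ k) * C)) / sqrt (real N) ^ k"
proof -
  let ?A = "1 + (real k / \<gamma>) ^ k"
  let ?e = "\<lambda>i. es ! i"
  have A: "0 \<le> ?A" using \<gamma> by (simp add: add_nonneg_nonneg)
  have "sqrt (real N) ^ k * sk.mean N c n (\<lambda>t. \<bar>pair_prod R es t\<bar>)
    \<le> sk.mean N c n (\<lambda>t. 1 + (\<Sum>i<k. ?A * exp (\<gamma> * (real N * (R t (fst (?e i)) (snd (?e i)))\<^sup>2))))"
    unfolding sk.mean_cmult[symmetric]
  proof (rule sk.mean_mono)
    fix t
    \<comment> \<open>Each of the k overlaps absorbs one factor \<open>sqrt (real N)\<close>, the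
      scale on which exponential moments are bounded.\<close>
    let ?xs = "map (\<lambda>e. sqrt (real N) * R t (fst e) (snd e)) es"
    have "sqrt (real N) ^ length es' * \<bar>pair_prod R es' t\<bar>
        = \<bar>prod_list (map (\<lambda>e. sqrt (real N) * R t (fst e) (snd e)) es')\<bar>" for es'
      by (induction es') (auto simp: pair_prod_def abs_mult mult_ac)
    then have "sqrt (real N) ^ k * \<bar>pair_prod R es t\<bar> = \<bar>prod_list ?xs\<bar>"
      using es(2) by blast
    also have "\<dots> \<le> 1 + (\<Sum>i<k. \<bar>?xs ! i\<bar> ^ k)"
      using abs_prod_list_le_sum[of ?xs] es(2) by simp
    also have "\<dots> \<le> 1 + (\<Sum>i<k. ?A * exp (\<gamma> * (real N * (R t (fst (?e i)) (snd (?e i)))\<^sup>2)))"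
    proof (intro add_left_mono sum_mono)
      fix i assume "i \<in> {..<k}"
      then have xi: "?xs ! i = sqrt (real N) * R t (fst (?e i)) (snd (?e i))" using es(2) by simp
      show "\<bar>?xs ! i\<bar> ^ k \<le> ?A * exp (\<gamma> * (real N * (R t (fst (?e i)) (snd (?e i)))\<^sup>2))"
        unfolding xi using abs_power_le_exp_square[OF \<gamma>, of "sqrt (real N) * R t (fst (?e i)) (snd (?e i))" k]
        by (simp add: power_mult_distrib)
    qed
    finally show "sqrt (real N) ^ k * \<bar>pair_prod R es t\<bar>
      \<le> 1 + (\<Sum>i<k. ?A * exp (\<gamma> * (real N * (R t (fst (?e i)) (snd (?e i)))\<^sup>2)))" .
  qed
  also have "\<dots> = 1 + (\<Sum>i<k. ?A * sk.mean N c n (\<lambda>t. exp (\<gamma> * (real N * (R t (fst (?e i)) (snd (?e i)))\<^sup>2))))"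
    by (simp only: sk.mean_add sk.mean_const sk.mean_sum sk.mean_cmult)
  also have "\<dots> \<le> 1 + (\<Sum>i<k. ?A * C)"
    using es by (intro add_left_mono sum_mono mult_left_mono A C) (auto simp: pairs_in_def)
  finally have *: "sqrt (real N) ^ k * sk.mean N c n (\<lambda>t. \<bar>pair_prod R es t\<bar>) \<le> 1 + real k * (?A * C)"
    by simp
  have "0 < sqrt (real N) ^ k" using N by simp
  then show ?thesis using * by (simp add: pos_le_divide_eq mult.commute)
qed

lemma depends_on_cav_overlap: "l \<in> I \<Longrightarrow> l' \<in> I \<Longrightarrow> depends_on I (\<lambda>t. F (cav_overlap N t l l'))"
  by (auto simp: depends_on_def cav_overlap_def)

lemma overlap_moments:
  assumes \<beta>: "0 < \<beta>" "\<beta> < 1"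
  shows "\<exists>C. \<forall>N\<ge>1. \<forall>es. pairs_in n es \<longrightarrow> length es = k \<longrightarrow>
    nu_path \<beta> N 1 n (\<lambda>t. \<bar>pair_prod (sk_overlap N) es t\<bar>) \<le> C / sqrt (real N) ^ k \<and>
    (\<forall>s\<in>{0..1}. nu_path \<beta> N s n (\<lambda>t. \<bar>pair_prod (cav_overlap N) es t\<bar>) \<le> C / sqrt (real N) ^ k)"
proof -
  obtain \<delta> C where \<delta>: "0 < \<delta>" and C: "\<And>N n l l'. 1 \<le> N \<Longrightarrow> l \<in> {1..n} \<Longrightarrow> l' \<in> {1..n} \<Longrightarrow> l \<noteq> l' \<Longrightarrow>
      sk.mean N (\<lambda>_. \<beta>) n (\<lambda>s. exp (\<delta> * (real N * (sk_overlap N s l l')\<^sup>2))) \<le> C"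
    using sk_exp_moment[OF \<beta>] by blast
  define C1 where "C1 = exp (cav_total n) * (exp \<delta> * C)"
  \<comment> \<open>Deleting the last site changes an overlap by 1 / N. The inequality (a - b)^2
    \<le> 2 a^2 + 2 b^2 absorbs this change at the price of half the exponent;
    \<open>nu_path_le_end\<close> does the rest.\<close>
  have cav: "nu_path \<beta> N s n (\<lambda>t. exp (\<delta> / 2 * (real N * (cav_overlap N t l l')\<^sup>2))) \<le> C1"
    if N: "1 \<le> N" and s: "s \<in> {0..1}" and l: "l \<in> {1..n}" "l' \<in> {1..n}" "l \<noteq> l'" for N s l l'
  proof -
    have "nu_path \<beta> N s n (\<lambda>t. exp (\<delta> / 2 * (real N * (cav_overlap N t l l')\<^sup>2)))
      \<le> exp (cav_total n) * nu_path \<beta> N 1 n (\<lambda>t. exp (\<delta> / 2 * (real N * (cav_overlap N t l l')\<^sup>2)))"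
      by (rule nu_path_le_end[OF N depends_on_cav_overlap]) (use \<beta> s l in auto)
    also have "nu_path \<beta> N 1 n (\<lambda>t. exp (\<delta> / 2 * (real N * (cav_overlap N t l l')\<^sup>2)))
      \<le> nu_path \<beta> N 1 n (\<lambda>t. exp \<delta> * exp (\<delta> * (real N * (sk_overlap N t l l')\<^sup>2)))"
    proof (rule sk.mean_mono)
      fix t assume t: "t \<in> {1..n} \<rightarrow>\<^sub>E sk_configs N"
      define a b where "a = sk_overlap N t l l'" and "b = t l N * t l' N / real N"
      have c: "t l \<in> sk_configs N" "t l' \<in> sk_configs N" using t l by (auto intro: replica_config)
      have "\<bar>b\<bar> = 1 / real N" using N c by (simp add: b_def abs_mult sk_configs_abs)
      then have b2: "b\<^sup>2 = (1 / real N)\<^sup>2" by (metis power2_abs)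
      have "cav_overlap N t l l' = a - b" using sk_overlap_split[OF N] by (simp add: a_def b_def)
      moreover have "(a - b)\<^sup>2 \<le> 2 * a\<^sup>2 + 2 * b\<^sup>2"
        using zero_le_power2[of "a + b"] by (simp add: power2_eq_square algebra_simps)
      ultimately have "real N * (cav_overlap N t l l')\<^sup>2 \<le> real N * (2 * a\<^sup>2 + 2 * b\<^sup>2)"
        by (simp add: mult_left_mono)
      also have "\<dots> = 2 * (real N * a\<^sup>2) + 2 / real N"
        unfolding b2 using N by (simp add: power2_eq_square distrib_left)
      also have "\<dots> \<le> 2 * (real N * a\<^sup>2) + 2" using N by (simp add: divide_le_eq)
      finally have "\<delta> / 2 * (real N * (cav_overlap N t l l')\<^sup>2) \<le> \<delta> / 2 * (2 * (real N * a\<^sup>2) + 2)"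
        using \<delta> by (intro mult_left_mono) auto
      also have "\<dots> = \<delta> + \<delta> * (real N * a\<^sup>2)" by (simp add: algebra_simps)
      finally show "exp (\<delta> / 2 * (real N * (cav_overlap N t l l')\<^sup>2))
        \<le> exp \<delta> * exp (\<delta> * (real N * (sk_overlap N t l l')\<^sup>2))"
        by (simp add: a_def flip: exp_add)
    qed
    also have "\<dots> \<le> exp \<delta> * C"
      unfolding sk.mean_cmult path_coupling_one using N l by (intro mult_left_mono C) auto
    finally show ?thesis by (simp add: C1_def)
  qed
  define D where "D = max (1 + real k * ((1 + (real k / \<delta>) ^ k) * C)) (1 + real k * ((1 + (real k / (\<delta> / 2)) ^ k) * C1))"
  have D1: "nu_path \<beta> N 1 n (\<lambda>t. \<bar>pair_prod (sk_overlap N) es t\<bar>) \<le> D / sqrt (real N) ^ k"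
    if "1 \<le> N" "pairs_in n es" "length es = k" for N es
  proof (rule order_trans[OF pair_prod_moment[OF that(1) \<delta> that(2,3)]])
    show "nu_path \<beta> N 1 n (\<lambda>t. exp (\<delta> * (real N * (sk_overlap N t l l')\<^sup>2))) \<le> C"
      if "l \<in> {1..n}" "l' \<in> {1..n}" "l \<noteq> l'" for l l'
      unfolding path_coupling_one using C \<open>1 \<le> N\<close> that by blast
  qed (auto simp: D_def intro!: divide_right_mono)
  have D2: "nu_path \<beta> N s n (\<lambda>t. \<bar>pair_prod (cav_overlap N) es t\<bar>) \<le> D / sqrt (real N) ^ k"
    if "1 \<le> N" "pairs_in n es" "length es = k" "s \<in> {0..1}" for N es s
    by (rule order_trans[OF pair_prod_moment[OF that(1) half_gt_zero[OF \<delta>] that(2,3)]])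
       (use cav that in \<open>auto simp: D_def intro!: divide_right_mono\<close>)
  show ?thesis using D1 D2 by blast
qed

section \<open>Monomials in last spins and cavity overlaps\<close>

definition spin_prod :: "nat \<Rightarrow> nat set \<Rightarrow> (nat \<Rightarrow> nat \<Rightarrow> real) \<Rightarrow> real" where
  "spin_prod N T t = (\<Prod>l\<in>T. t l N)"

text \<open>A family closed under differentiation along the path: last spins square to 1, so their
  product is recorded by a set T, and two further spins change T by a symmetric difference. The
  overlaps form a list because pairs may repeat.\<close>

definition cav_mono :: "nat \<Rightarrow> nat set \<Rightarrow> (nat \<times> nat) list \<Rightarrow> (nat \<Rightarrow> nat \<Rightarrow> real) \<Rightarrow> real" where
  "cav_mono N T es t = spin_prod N T t * pair_prod (cav_overlap N) es t"

abbreviation symdiff :: "nat set \<Rightarrow> nat set \<Rightarrow> nat set" where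
  "symdiff A B \<equiv> (A - B) \<union> (B - A)"

lemma pair_prod_Nil [simp]: "pair_prod R [] t = 1"
  by (simp add: pair_prod_def)

lemma pair_prod_Cons [simp]: "pair_prod R (e # es) t = R t (fst e) (snd e) * pair_prod R es t"
  by (simp add: pair_prod_def)

lemma pair_prod_append: "pair_prod R (es @ es') t = pair_prod R es t * pair_prod R es' t"
  by (induction es) auto

lemma pairs_in_mono: "pairs_in n es \<Longrightarrow> n \<le> m \<Longrightarrow> pairs_in m es"
  unfolding pairs_in_def by fastforce

lemma pairs_in_Nil [simp]: "pairs_in n []"
  by (simp add: pairs_in_def)

lemma pairs_in_Cons [simp]:
  "pairs_in n (e # es) \<longleftrightarrow> fst e \<in> {1..n} \<and> snd e \<in> {1..n} \<and> fst e \<noteq> snd e \<and> pairs_in n es"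
  by (auto simp: pairs_in_def)

lemma pairs_in_append [simp]: "pairs_in n (es @ es') \<longleftrightarrow> pairs_in n es \<and> pairs_in n es'"
  by (auto simp: pairs_in_def)

lemma spin_square:
  "1 \<le> N \<Longrightarrow> t \<in> {1..n} \<rightarrow>\<^sub>E sk_configs N \<Longrightarrow> l \<in> {1..n} \<Longrightarrow> t l N * t l N = 1"
  by (rule sk_configs_square) (auto intro: replica_config)

lemma spin_prod_mult:
  assumes "1 \<le> N" "t \<in> {1..n} \<rightarrow>\<^sub>E sk_configs N" "T \<subseteq> {1..n}" "U \<subseteq> {1..n}"
  shows "spin_prod N T t * spin_prod N U t = spin_prod N (symdiff T U) t"
proof -
  have fin: "finite T" "finite U" using assms finite_subset by blast+
  have "spin_prod N (T \<inter> U) t * spin_prod N (T \<inter> U) t = (\<Prod>l\<in>T \<inter> U. t l N * t l N)"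
    by (simp add: spin_prod_def prod.distrib)
  also have "\<dots> = 1"
    using assms by (intro prod.neutral ballI spin_square) auto
  finally have one: "spin_prod N (T \<inter> U) t * spin_prod N (T \<inter> U) t = 1" .
  have T: "spin_prod N T t = spin_prod N (T - U) t * spin_prod N (T \<inter> U) t"
    using fin unfolding spin_prod_def by (subst prod.union_disjoint[symmetric]) (auto intro: prod.cong)
  have U: "spin_prod N U t = spin_prod N (U - T) t * spin_prod N (T \<inter> U) t"
    using fin unfolding spin_prod_def by (subst prod.union_disjoint[symmetric]) (auto intro: prod.cong)
  have "spin_prod N (symdiff T U) t = spin_prod N (T - U) t * spin_prod N (U - T) t"
    using fin unfolding spin_prod_def by (intro prod.union_disjoint) auto
  then show ?thesis unfolding T U using one by (simp add: mult_ac)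
qed

lemma spin_prod_pair: "l \<noteq> l' \<Longrightarrow> spin_prod N {l, l'} t = t l N * t l' N"
  by (simp add: spin_prod_def)

lemma spin_prod_abs:
  assumes "1 \<le> N" "t \<in> {1..n} \<rightarrow>\<^sub>E sk_configs N" "T \<subseteq> {1..n}"
  shows "\<bar>spin_prod N T t\<bar> = 1"
proof -
  have "\<bar>t l N\<bar> = 1" if "l \<in> T" for l
    by (rule sk_configs_abs[of _ N]) (use assms that in \<open>auto intro: replica_config\<close>)
  then show ?thesis by (simp add: spin_prod_def abs_prod)
qed

lemma depends_on_mult:
  "depends_on I f \<Longrightarrow> depends_on I g \<Longrightarrow> depends_on I (\<lambda>t. f t * g t :: real)"
  unfolding depends_on_def by metis

lemma depends_on_spin_prod: "T \<subseteq> I \<Longrightarrow> depends_on I (spin_prod N T)"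
  by (auto simp: depends_on_def spin_prod_def intro!: prod.cong)

lemma depends_on_pair_prod:
  assumes "pairs_in n es" "\<And>l l'. l \<in> {1..n} \<Longrightarrow> l' \<in> {1..n} \<Longrightarrow> depends_on {1..n} (\<lambda>t. R t l l')"
  shows "depends_on {1..n} (pair_prod R es)"
proof -
  have "depends_on {1..n} (\<lambda>t. pair_prod R es t)"
    using assms(1)
  proof (induction es)
    case (Cons e es)
    then show ?case by (simp only: pair_prod_Cons) (intro depends_on_mult assms(2), auto)
  qed (simp add: depends_on_def)
  then show ?thesis .
qed

lemma depends_on_sk_overlap: "l \<in> I \<Longrightarrow> l' \<in> I \<Longrightarrow> depends_on I (\<lambda>t. sk_overlap N t l l')"
  by (auto simp: depends_on_def sk_overlap_def)

lemma depends_on_cav_pair_prod: "pairs_in n es \<Longrightarrow> depends_on {1..n} (pair_prod (cav_overlap N) es)"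
  by (rule depends_on_pair_prod) (auto intro: depends_on_cav_overlap)

lemma depends_on_sk_pair_prod: "pairs_in n es \<Longrightarrow> depends_on {1..n} (pair_prod (sk_overlap N) es)"
  by (rule depends_on_pair_prod) (auto intro: depends_on_sk_overlap)

lemma depends_on_cav_mono:
  "T \<subseteq> {1..n} \<Longrightarrow> pairs_in n es \<Longrightarrow> depends_on {1..n} (cav_mono N T es)"
  unfolding cav_mono_def by (intro depends_on_mult depends_on_spin_prod depends_on_cav_pair_prod)

lemma cav_mono_step:
  assumes "1 \<le> N" "t \<in> {1..n} \<rightarrow>\<^sub>E sk_configs N" "T \<subseteq> {1..n}" "l \<in> {1..n}" "l' \<in> {1..n}" "l \<noteq> l'"
  shows "cav_mono N T es t * (t l N * t l' N * cav_overlap N t l l')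
    = cav_mono N (symdiff T {l, l'}) ((l, l') # es) t"
proof -
  have "spin_prod N T t * spin_prod N {l, l'} t = spin_prod N (symdiff T {l, l'}) t"
    by (rule spin_prod_mult) (use assms in auto)
  then show ?thesis
    using assms(6) unfolding cav_mono_def by (simp add: spin_prod_pair mult_ac)
qed

text \<open>The derivatives along the cavity path in the time \<open>u = s\<^sup>2\<close>, in which the factor \<open>\<beta>\<^sup>2 * s\<close> of
  \<open>nu_path_deriv\<close> becomes the constant \<open>\<beta>\<^sup>2 / 2\<close>.\<close>

primrec path_derivs ::
  "nat \<Rightarrow> real \<Rightarrow> nat \<Rightarrow> nat \<Rightarrow> nat set \<Rightarrow> (nat \<times> nat) list \<Rightarrow> real \<Rightarrow> real" where
  "path_derivs 0 \<beta> N n T es u = nu_path \<beta> N (sqrt u) n (cav_mono N T es)"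
| "path_derivs (Suc r) \<beta> N n T es u =
     (\<Sum>l = 1..Suc n. \<Sum>l'\<in>{1..Suc (Suc n)} - {l}. \<beta>\<^sup>2 / 2 * (cav_coeff n l * cav_coeff (Suc n) l') *
       path_derivs r \<beta> N (Suc (Suc n)) (symdiff T {l, l'}) ((l, l') # es) u)"

lemma admissible_step:
  assumes "T \<subseteq> {1..n}" "pairs_in n es" "l \<in> {1..Suc n}" "l' \<in> {1..Suc (Suc n)} - {l}"
  shows "symdiff T {l, l'} \<subseteq> {1..Suc (Suc n)}" "pairs_in (Suc (Suc n)) ((l, l') # es)"
  using assms by (auto intro: pairs_in_mono)

lemma path_derivs_0_deriv:
  assumes N: "1 \<le> N" and T: "T \<subseteq> {1..n}" and es: "pairs_in n es" and u: "0 < u"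
  shows "(path_derivs 0 \<beta> N n T es has_real_derivative path_derivs (Suc 0) \<beta> N n T es u) (at u)"
proof -
  let ?m = "\<lambda>f. nu_path \<beta> N (sqrt u) (Suc (Suc n)) f"
  let ?g = "\<lambda>l l' t. cav_mono N T es t * (t l N * t l' N * cav_overlap N t l l')"
  have "((\<lambda>u. nu_path \<beta> N (sqrt u) n (cav_mono N T es)) has_real_derivative
      \<beta>\<^sup>2 * sqrt u * (\<Sum>l = 1..Suc n. \<Sum>l'\<in>{1..Suc (Suc n)} - {l}. cav_coeff n l * cav_coeff (Suc n) l' * ?m (?g l l'))
      * (inverse (sqrt u) / 2)) (at u)"
    by (rule DERIV_chain2[OF nu_path_deriv[OF N depends_on_cav_mono[OF T es]] DERIV_real_sqrt[OF u]])
  also have "\<beta>\<^sup>2 * sqrt u * (\<Sum>l = 1..Suc n. \<Sum>l'\<in>{1..Suc (Suc n)} - {l}. cav_coeff n l * cav_coeff (Suc n) l' * ?m (?g l l'))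
      * (inverse (sqrt u) / 2)
    = \<beta>\<^sup>2 / 2 * (\<Sum>l = 1..Suc n. \<Sum>l'\<in>{1..Suc (Suc n)} - {l}. cav_coeff n l * cav_coeff (Suc n) l' * ?m (?g l l'))"
    using u by (simp add: field_simps)
  also have "\<dots> = (\<Sum>l = 1..Suc n. \<Sum>l'\<in>{1..Suc (Suc n)} - {l}. \<beta>\<^sup>2 / 2 * (cav_coeff n l * cav_coeff (Suc n) l') *
      ?m (cav_mono N (symdiff T {l, l'}) ((l, l') # es)))"
    unfolding sum_distrib_left
  proof (intro sum.cong refl)
    fix l l' assume l: "l \<in> {1..Suc n}" "l' \<in> {1..Suc (Suc n)} - {l}"
    have "?m (?g l l') = ?m (cav_mono N (symdiff T {l, l'}) ((l, l') # es))"
      by (rule sk.mean_cong, rule cav_mono_step[OF N, where n = "Suc (Suc n)"]) (use l T in auto)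
    then show "\<beta>\<^sup>2 / 2 * (cav_coeff n l * cav_coeff (Suc n) l' * ?m (?g l l'))
      = \<beta>\<^sup>2 / 2 * (cav_coeff n l * cav_coeff (Suc n) l') * ?m (cav_mono N (symdiff T {l, l'}) ((l, l') # es))"
      by simp
  qed
  finally have *: "((\<lambda>u. nu_path \<beta> N (sqrt u) n (cav_mono N T es)) has_real_derivative
      path_derivs (Suc 0) \<beta> N n T es u) (at u)"
    by (simp only: path_derivs.simps)
  moreover have "path_derivs 0 \<beta> N n T es = (\<lambda>u. nu_path \<beta> N (sqrt u) n (cav_mono N T es))"
    by (rule ext) simp
  ultimately show ?thesis by (simp only:)
qed

lemma path_derivs_deriv:
  assumes N: "1 \<le> N" and u: "0 < u" and "T \<subseteq> {1..n}" "pairs_in n es"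
  shows "(path_derivs r \<beta> N n T es has_real_derivative path_derivs (Suc r) \<beta> N n T es u) (at u)"
  using assms(3,4)
proof (induction r arbitrary: n T es)
  case 0
  then show ?case by (rule path_derivs_0_deriv[OF N _ _ u])
next
  case (Suc r)
  have "((\<lambda>u. \<Sum>l = 1..Suc n. \<Sum>l'\<in>{1..Suc (Suc n)} - {l}. \<beta>\<^sup>2 / 2 * (cav_coeff n l * cav_coeff (Suc n) l') *
       path_derivs r \<beta> N (Suc (Suc n)) (symdiff T {l, l'}) ((l, l') # es) u) has_real_derivative
     (\<Sum>l = 1..Suc n. \<Sum>l'\<in>{1..Suc (Suc n)} - {l}. \<beta>\<^sup>2 / 2 * (cav_coeff n l * cav_coeff (Suc n) l') *
       path_derivs (Suc r) \<beta> N (Suc (Suc n)) (symdiff T {l, l'}) ((l, l') # es) u)) (at u)"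
    by (intro DERIV_sum DERIV_cmult Suc.IH admissible_step[OF Suc.prems])
  then show ?case unfolding path_derivs.simps(2)[of "Suc r"] by (subst path_derivs.simps(2)[abs_def])
qed

lemma path_derivs_continuous:
  assumes N: "1 \<le> N" and "T \<subseteq> {1..n}" "pairs_in n es"
  shows "continuous_on {0..1} (path_derivs r \<beta> N n T es)"
  using assms(2,3)
proof (induction r arbitrary: n T es)
  case 0
  have "continuous_on UNIV (\<lambda>s. nu_path \<beta> N s n (cav_mono N T es))"
    using DERIV_isCont[OF nu_path_deriv[OF N depends_on_cav_mono[OF 0]]]
    by (intro continuous_at_imp_continuous_on) blast
  then have "continuous_on {0..1} (\<lambda>u. nu_path \<beta> N (sqrt u) n (cav_mono N T es))"
    by (rule continuous_on_compose2) (auto intro!: continuous_intros)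
  then show ?case by (subst path_derivs.simps(1)[abs_def])
next
  case (Suc r)
  show ?case
    by (subst path_derivs.simps(2)[abs_def])
       (intro continuous_on_sum continuous_on_mult_left Suc.IH admissible_step[OF Suc.prems])
qed

text \<open>Each derivative adds one pair to the list, hence one factor N^(-1/2); the last spins
  have absolute value 1.\<close>

lemma path_derivs_bound:
  assumes \<beta>: "0 < \<beta>" "\<beta> < 1"
  shows "\<exists>C. \<forall>N\<ge>1. \<forall>T es. \<forall>u\<in>{0..1}. T \<subseteq> {1..n} \<longrightarrow> pairs_in n es \<longrightarrow> length es = k \<longrightarrow>
    \<bar>path_derivs r \<beta> N n T es u\<bar> \<le> C / sqrt (real N) ^ (k + r)"
proof (induction r arbitrary: n k)
  case 0
  obtain C where C: "\<And>N es s. 1 \<le> N \<Longrightarrow> pairs_in n es \<Longrightarrow> length es = k \<Longrightarrow> s \<in> {0..1} \<Longrightarrow>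
      nu_path \<beta> N s n (\<lambda>t. \<bar>pair_prod (cav_overlap N) es t\<bar>) \<le> C / sqrt (real N) ^ k"
    using overlap_moments[OF \<beta>, of n k] by blast
  have "\<bar>path_derivs 0 \<beta> N n T es u\<bar> \<le> C / sqrt (real N) ^ (k + 0)"
    if "1 \<le> N" "T \<subseteq> {1..n}" "pairs_in n es" "length es = k" "u \<in> {0..1}" for N T es u
  proof -
    have "\<bar>path_derivs 0 \<beta> N n T es u\<bar> \<le> nu_path \<beta> N (sqrt u) n (\<lambda>t. \<bar>cav_mono N T es t\<bar>)"
      by (simp add: sk.mean_abs)
    also have "\<dots> = nu_path \<beta> N (sqrt u) n (\<lambda>t. \<bar>pair_prod (cav_overlap N) es t\<bar>)"
      by (rule sk.mean_cong) (use that in \<open>simp add: cav_mono_def abs_mult spin_prod_abs\<close>)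
    also have "\<dots> \<le> C / sqrt (real N) ^ k" by (rule C) (use that in auto)
    finally show ?thesis by simp
  qed
  then show ?case by blast
next
  case (Suc r)
  obtain C where C: "\<And>N T es u. 1 \<le> N \<Longrightarrow> T \<subseteq> {1..Suc (Suc n)} \<Longrightarrow> pairs_in (Suc (Suc n)) es \<Longrightarrow>
      length es = Suc k \<Longrightarrow> u \<in> {0..1} \<Longrightarrow>
      \<bar>path_derivs r \<beta> N (Suc (Suc n)) T es u\<bar> \<le> C / sqrt (real N) ^ (Suc k + r)"
    using Suc.IH[of "Suc (Suc n)" "Suc k"] by blast
  define D where "D = (\<Sum>l = 1..Suc n. \<Sum>l'\<in>{1..Suc (Suc n)} - {l}.
      \<bar>\<beta>\<^sup>2 / 2 * (cav_coeff n l * cav_coeff (Suc n) l')\<bar> * C)"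
  have "\<bar>path_derivs (Suc r) \<beta> N n T es u\<bar> \<le> D / sqrt (real N) ^ (k + Suc r)"
    if "1 \<le> N" "T \<subseteq> {1..n}" "pairs_in n es" "length es = k" "u \<in> {0..1}" for N T es u
  proof -
    have "\<bar>path_derivs (Suc r) \<beta> N n T es u\<bar> \<le> (\<Sum>l = 1..Suc n. \<Sum>l'\<in>{1..Suc (Suc n)} - {l}.
        \<bar>\<beta>\<^sup>2 / 2 * (cav_coeff n l * cav_coeff (Suc n) l')\<bar> * (C / sqrt (real N) ^ (Suc k + r)))"
      unfolding path_derivs.simps
      by (intro order_trans[OF sum_abs] sum_mono, subst abs_mult, intro mult_left_mono C)
         (use that admissible_step[OF that(2,3)] in auto)
    then show ?thesis
      by (simp only: D_def sum_divide_distrib times_divide_eq_right add_Suc add_Suc_right)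
  qed
  then show ?case by blast
qed

lemma path_taylor:
  assumes \<beta>: "0 < \<beta>" "\<beta> < 1" and T: "T \<subseteq> {1..n}" and es: "pairs_in n es"
  shows "(\<lambda>N. nu_path \<beta> N 1 n (cav_mono N T es) - (\<Sum>r\<le>K. path_derivs r \<beta> N n T es 0 / fact r))
    \<in> O(\<lambda>N. 1 / sqrt (real N) ^ (length es + Suc K))"
proof -
  obtain C where C: "\<And>N u. 1 \<le> N \<Longrightarrow> u \<in> {0..1} \<Longrightarrow>
      \<bar>path_derivs (Suc K) \<beta> N n T es u\<bar> \<le> C / sqrt (real N) ^ (length es + Suc K)"
    using path_derivs_bound[OF \<beta>, of n "length es" "Suc K"] T es by blast
  have "\<bar>path_derivs 0 \<beta> N n T es 1 - (\<Sum>r\<le>K. path_derivs r \<beta> N n T es 0 * 1 ^ r / fact r)\<bar>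
      \<le> C / sqrt (real N) ^ (length es + Suc K)" if N: "1 \<le> N" for N
    by (rule taylor_iterated[where \<phi> = "\<lambda>r. path_derivs r \<beta> N n T es"])
       (use N T es C in \<open>auto intro!: path_derivs_continuous path_derivs_deriv simp del: path_derivs.simps\<close>)
  then have bound: "\<bar>nu_path \<beta> N 1 n (cav_mono N T es) - (\<Sum>r\<le>K. path_derivs r \<beta> N n T es 0 / fact r)\<bar>
      \<le> C / sqrt (real N) ^ (length es + Suc K)" if N: "1 \<le> N" for N
    using N by (simp add: path_derivs.simps(1)[of \<beta> N n T es 1])
  show ?thesis
  proof (rule bigoI[where c = "\<bar>C\<bar>"])
    show "\<forall>\<^sub>F N in sequentially. norm (nu_path \<beta> N 1 n (cav_mono N T es) - (\<Sum>r\<le>K. path_derivs r \<beta> N n T es 0 / fact r))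
        \<le> \<bar>C\<bar> * norm (1 / sqrt (real N) ^ (length es + Suc K))"
      using eventually_ge_at_top[of 1]
    proof eventually_elim
      case (elim N)
      have "C / sqrt (real N) ^ (length es + Suc K) \<le> \<bar>C\<bar> / sqrt (real N) ^ (length es + Suc K)"
        by (intro divide_right_mono) auto
      then show ?case using bound[of N] elim by (simp del: path_derivs.simps)
    qed
  qed
qed

section \<open>Vanishing at the start of the path by flipping the last spin\<close>

lemma replica_avg_antisymmetric:
  assumes flip: "\<And>\<sigma>. \<sigma> \<in> S \<Longrightarrow> \<phi> \<sigma> \<in> S \<and> \<phi> (\<phi> \<sigma>) = \<sigma> \<and> p (\<phi> \<sigma>) = p \<sigma>" and l0: "l0 \<in> I"
    and f: "\<And>t. t \<in> I \<rightarrow>\<^sub>E S \<Longrightarrow> f (t(l0 := \<phi> (t l0))) = - f t"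
  shows "replica_avg S p I f = 0"
proof -
  let ?\<Phi> = "\<lambda>t. t(l0 := \<phi> (t l0))"
  \<comment> \<open>Only replica l0 is transformed, which is a bijection of the replica
    configurations preserving their weight. The average therefore equals its own negative.\<close>
  have mem: "?\<Phi> t \<in> I \<rightarrow>\<^sub>E S" if "t \<in> I \<rightarrow>\<^sub>E S" for t
    using that l0 flip[OF PiE_mem[OF that l0]] by (auto simp: PiE_iff extensional_def)
  have inv: "?\<Phi> (?\<Phi> t) = t" if "t \<in> I \<rightarrow>\<^sub>E S" for t
    using flip[OF PiE_mem[OF that l0]] by auto
  have "replica_avg S p I f = (\<Sum>t\<in>I \<rightarrow>\<^sub>E S. f (?\<Phi> t) * (\<Prod>l\<in>I. p (?\<Phi> t l)))"
    unfolding replica_avg_def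
    by (rule sum.reindex_bij_witness[of _ ?\<Phi> ?\<Phi>]) (use mem inv in auto)
  also have "\<dots> = (\<Sum>t\<in>I \<rightarrow>\<^sub>E S. - (f t * (\<Prod>l\<in>I. p (t l))))"
  proof (intro sum.cong refl)
    fix t assume t: "t \<in> I \<rightarrow>\<^sub>E S"
    have "(\<Prod>l\<in>I. p (?\<Phi> t l)) = (\<Prod>l\<in>I. p (t l))"
      using flip[OF PiE_mem[OF t l0]] by (intro prod.cong) auto
    then show "f (?\<Phi> t) * (\<Prod>l\<in>I. p (?\<Phi> t l)) = - (f t * (\<Prod>l\<in>I. p (t l)))"
      using f[OF t] by simp
  qed
  also have "\<dots> = - replica_avg S p I f" by (simp add: replica_avg_def sum_negf)
  finally show ?thesis by simp
qed

text \<open>At \<open>s = 0\<close> the energy does not involve the last spin, and cavity overlaps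
  never do. Flipping it in one replica of T changes nothing but the sign of the monomial.\<close>

lemma nu_path_zero_antisymmetric:
  assumes N: "1 \<le> N" and T: "T \<subseteq> {1..n}" "T \<noteq> {}"
  shows "nu_path \<beta> N 0 n (cav_mono N T es) = 0"
proof -
  obtain l0 where l0: "l0 \<in> T" using T by blast
  let ?\<phi> = "\<lambda>\<sigma>. \<sigma>(N := - \<sigma> N)"
  have "sk.bracket N (path_coupling \<beta> N 0) x n (cav_mono N T es) = 0" for x
    unfolding sk.bracket_def
  proof (rule replica_avg_antisymmetric[of _ ?\<phi>])
    show "l0 \<in> {1..n}" using l0 T by blast
    fix \<sigma> assume \<sigma>: "\<sigma> \<in> sk_configs N"
    have mem: "?\<phi> \<sigma> \<in> sk_configs N"
      using \<sigma> N unfolding sk_configs_def by (auto simp: PiE_iff extensional_def)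
    have "sk.energy N (path_coupling \<beta> N 0) x (?\<phi> \<sigma>) = sk.energy N (path_coupling \<beta> N 0) x \<sigma>"
      unfolding sk.energy_def
      by (intro sum.cong refl) (auto simp: path_coupling_def sk_spin_pair_def sk_pairs_def)
    then show "?\<phi> \<sigma> \<in> sk_configs N \<and> ?\<phi> (?\<phi> \<sigma>) = \<sigma> \<and>
      gibbs_weight (sk_configs N) (sk.energy N (path_coupling \<beta> N 0) x) (?\<phi> \<sigma>) =
      gibbs_weight (sk_configs N) (sk.energy N (path_coupling \<beta> N 0) x) \<sigma>"
      using mem by (simp add: gibbs_weight_def)
  next
    fix t assume "t \<in> {1..n} \<rightarrow>\<^sub>E sk_configs N"
    let ?t = "t(l0 := ?\<phi> (t l0))"
    have fin: "finite T" using T finite_subset by blast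
    have "spin_prod N T ?t = - spin_prod N T t"
    proof -
      have "(\<Prod>l\<in>T - {l0}. ?t l N) = (\<Prod>l\<in>T - {l0}. t l N)" by (intro prod.cong) auto
      then show ?thesis unfolding spin_prod_def using prod.remove[OF fin l0, of "\<lambda>l. ?t l N"]
          prod.remove[OF fin l0, of "\<lambda>l. t l N"] by simp
    qed
    moreover have "pair_prod (cav_overlap N) es ?t = pair_prod (cav_overlap N) es t"
    proof -
      have "cav_overlap N ?t l l' = cav_overlap N t l l'" for l l'
        unfolding cav_overlap_def by (intro arg_cong2[where f = "(*)"] refl sum.cong) auto
      then show ?thesis by (induction es) auto
    qed
    ultimately show "cav_mono N T es ?t = - cav_mono N T es t" by (simp add: cav_mono_def)
  qed
  then show ?thesis by (simp add: sk.mean_def)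
qed

section \<open>Symmetry between sites and reduction to product measure\<close>

text \<open>The action of a permutation on unordered pairs of sites; \<open>min\<close> and
  \<open>max\<close> restore the increasing order in which pairs are stored.\<close>

definition site_pair :: "(nat \<Rightarrow> nat) \<Rightarrow> nat \<times> nat \<Rightarrow> nat \<times> nat" where
  "site_pair \<pi> p = (min (\<pi> (fst p)) (\<pi> (snd p)), max (\<pi> (fst p)) (\<pi> (snd p)))"

lemma site_pair_mem:
  assumes "\<pi> permutes {1..N}" "p \<in> sk_pairs N"
  shows "site_pair \<pi> p \<in> sk_pairs N"
proof -
  have p: "fst p \<in> {1..N}" "snd p \<in> {1..N}" "fst p \<noteq> snd p" using assms(2) by (auto simp: sk_pairs_def)
  then have "\<pi> (fst p) \<in> {1..N}" "\<pi> (snd p) \<in> {1..N}"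
    by (simp_all only: permutes_in_image[OF assms(1)])
  moreover have "\<pi> (fst p) \<noteq> \<pi> (snd p)" using p inj_eq[OF permutes_inj[OF assms(1)]] by simp
  ultimately show ?thesis by (auto simp: site_pair_def sk_pairs_def min_def max_def)
qed

lemma site_pair_involution:
  assumes "\<And>i. \<pi> (\<pi> i) = i" "p \<in> sk_pairs N"
  shows "site_pair \<pi> (site_pair \<pi> p) = p"
proof (cases p)
  case (Pair i j)
  then have ij: "i < j" using assms(2) by (simp add: sk_pairs_def)
  have sym: "site_pair \<pi> (a, b) = site_pair \<pi> (b, a)" for a b
    by (simp add: site_pair_def min.commute max.commute)
  have "site_pair \<pi> (\<pi> i, \<pi> j) = (i, j)"
    unfolding site_pair_def using ij by (simp only: fst_conv snd_conv assms(1)) simp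
  moreover have "site_pair \<pi> p = (\<pi> i, \<pi> j) \<or> site_pair \<pi> p = (\<pi> j, \<pi> i)"
    unfolding Pair site_pair_def fst_conv snd_conv by (metis max_def min_def)
  ultimately show ?thesis unfolding Pair by (metis sym)
qed

lemma spin_pair_site: "sk_spin_pair N p (\<lambda>i. \<sigma> (\<pi> i)) = sk_spin_pair N (site_pair \<pi> p) \<sigma>"
  by (simp add: sk_spin_pair_def site_pair_def min_def max_def mult.commute)

lemma configs_site:
  assumes "\<pi> permutes {1..N}" "\<sigma> \<in> sk_configs N"
  shows "(\<lambda>i. \<sigma> (\<pi> i)) \<in> sk_configs N"
proof -
  have "\<sigma> (\<pi> i) \<in> {-1, 1}" if i: "i \<in> {1..N}" for i
  proof -
    have "\<pi> i \<in> {1..N}" by (simp only: permutes_in_image[OF assms(1)] i)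
    from sk_configs_cases[OF assms(2) this] show ?thesis by auto
  qed
  moreover have "\<sigma> (\<pi> i) = undefined" if i: "i \<notin> {1..N}" for i
    unfolding permutes_not_in[OF assms(1) i] by (rule PiE_arb[OF assms(2)[unfolded sk_configs_def] i])
  ultimately show ?thesis unfolding sk_configs_def by (intro PiE_I)
qed

lemma energy_site:
  assumes \<pi>: "\<pi> permutes {1..N}" "\<And>i. \<pi> (\<pi> i) = i"
  shows "sk.energy N (\<lambda>_. \<beta>) x (\<lambda>i. \<sigma> (\<pi> i))
    = sk.energy N (\<lambda>_. \<beta>) (\<lambda>p\<in>sk_pairs N. x (site_pair \<pi> p)) \<sigma>"
  unfolding sk.energy_def spin_pair_site
  by (rule sum.reindex_bij_witness[of _ "site_pair \<pi>" "site_pair \<pi>"])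
     (use site_pair_mem[OF \<pi>(1)] site_pair_involution[OF \<pi>(2)] in auto)

text \<open>Relabelling the sites of the spins amounts to relabelling the couplings. An involution
  is its own inverse, so it serves in both directions of the reindexing; exchanges of two sites are
  of this kind.\<close>

lemma bracket_site:
  assumes \<pi>: "\<pi> permutes {1..N}" "\<And>i. \<pi> (\<pi> i) = i" and f: "depends_on {1..n} f"
  shows "sk.bracket N (\<lambda>_. \<beta>) x n (\<lambda>t. f (\<lambda>l i. t l (\<pi> i)))
    = sk.bracket N (\<lambda>_. \<beta>) (\<lambda>p\<in>sk_pairs N. x (site_pair \<pi> p)) n f"
proof -
  let ?x = "\<lambda>p\<in>sk_pairs N. x (site_pair \<pi> p)"
  let ?E = "sk.energy N (\<lambda>_. \<beta>)"
  let ?\<Phi> = "\<lambda>t. \<lambda>l\<in>{1..n}. (\<lambda>i. t l (\<pi> i) :: real)"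
  have Z: "(\<Sum>\<sigma>\<in>sk_configs N. exp (?E ?x \<sigma>)) = (\<Sum>\<sigma>\<in>sk_configs N. exp (?E x \<sigma>))"
    by (rule sum.reindex_bij_witness[of _ "\<lambda>\<sigma> i. \<sigma> (\<pi> i)" "\<lambda>\<sigma> i. \<sigma> (\<pi> i)"])
       (use configs_site[OF \<pi>(1)] energy_site[OF \<pi>] \<pi>(2) in auto)
  have W: "gibbs_weight (sk_configs N) (?E x) (\<lambda>i. \<sigma> (\<pi> i)) = gibbs_weight (sk_configs N) (?E ?x) \<sigma>" for \<sigma>
    unfolding gibbs_weight_def Z energy_site[OF \<pi>] ..
  have mem: "?\<Phi> t \<in> {1..n} \<rightarrow>\<^sub>E sk_configs N" if "t \<in> {1..n} \<rightarrow>\<^sub>E sk_configs N" for t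
    using replica_config[OF that] configs_site[OF \<pi>(1)] by auto
  have inv: "?\<Phi> (?\<Phi> t) = t" if "t \<in> {1..n} \<rightarrow>\<^sub>E sk_configs N" for t
    using that \<pi>(2) by (auto simp: fun_eq_iff PiE_iff extensional_def restrict_def)
  show ?thesis
    unfolding sk.bracket_def replica_avg_def
  proof (rule sum.reindex_bij_witness[of _ ?\<Phi> ?\<Phi>])
    fix t assume t: "t \<in> {1..n} \<rightarrow>\<^sub>E sk_configs N"
    have "f (?\<Phi> t) = f (\<lambda>l i. t l (\<pi> i))"
      by (rule f[unfolded depends_on_def, rule_format]) simp
    moreover have "(\<Prod>l\<in>{1..n}. gibbs_weight (sk_configs N) (?E ?x) (?\<Phi> t l))
      = (\<Prod>l\<in>{1..n}. gibbs_weight (sk_configs N) (?E x) (t l))"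
      unfolding W[symmetric] using \<pi>(2) by (intro prod.cong refl) simp
    ultimately show "f (?\<Phi> t) * (\<Prod>l\<in>{1..n}. gibbs_weight (sk_configs N) (?E ?x) (?\<Phi> t l))
      = f (\<lambda>l i. t l (\<pi> i)) * (\<Prod>l\<in>{1..n}. gibbs_weight (sk_configs N) (?E x) (t l))"
      by simp
  qed (use mem inv in auto)
qed

text \<open>The couplings are independent with a common law, so relabelling them leaves their joint
  law unchanged.\<close>

lemma mean_site:
  assumes \<pi>: "\<pi> permutes {1..N}" "\<And>i. \<pi> (\<pi> i) = i" and f: "depends_on {1..n} f"
  shows "sk.mean N (\<lambda>_. \<beta>) n (\<lambda>t. f (\<lambda>l i. t l (\<pi> i))) = sk.mean N (\<lambda>_. \<beta>) n f"
proof -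
  let ?\<rho> = "\<lambda>x. \<lambda>p\<in>sk_pairs N. x (site_pair \<pi> p)"
  have inj: "inj_on (site_pair \<pi>) (sk_pairs N)"
    by (rule inj_on_inverseI[of _ "site_pair \<pi>"]) (rule site_pair_involution[OF \<pi>(2)])
  have distr: "distr (sk.couplings N) (sk.couplings N) ?\<rho> = sk.couplings N"
    by (rule distr_PiM_reindex[of "sk_pairs N" "\<lambda>_. gauss" "site_pair \<pi>" "sk_pairs N"])
       (use prob_space_gauss inj site_pair_mem[OF \<pi>(1)] in auto)
  have [measurable]: "?\<rho> \<in> measurable (sk.couplings N) (sk.couplings N)"
    by (rule measurable_restrict) (use site_pair_mem[OF \<pi>(1)] in \<open>auto intro: measurable_component_singleton\<close>)
  have "sk.mean N (\<lambda>_. \<beta>) n f = integral\<^sup>L (distr (sk.couplings N) (sk.couplings N) ?\<rho>) (\<lambda>x. sk.bracket N (\<lambda>_. \<beta>) x n f)"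
    unfolding distr sk.mean_def ..
  also have "\<dots> = (\<integral>x. sk.bracket N (\<lambda>_. \<beta>) (?\<rho> x) n f \<partial>sk.couplings N)"
    by (rule integral_distr) measurable
  also have "\<dots> = sk.mean N (\<lambda>_. \<beta>) n (\<lambda>t. f (\<lambda>l i. t l (\<pi> i)))"
    unfolding sk.mean_def bracket_site[OF \<pi> f] ..
  finally show ?thesis by simp
qed

lemma sk_overlap_site:
  assumes "\<pi> permutes {1..N}"
  shows "sk_overlap N (\<lambda>l i. t l (\<pi> i)) l l' = sk_overlap N t l l'"
  unfolding sk_overlap_def using sum.permute[OF assms, of "\<lambda>i. t l i * t l' i"] by (simp add: comp_def)

text \<open>One overlap is expanded as an average over sites i. The remaining factors are full
  overlaps and invariant under the exchange of i and N, so each site contributes as much as the last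
  one.\<close>

lemma mean_overlap_eq_last_spin:
  assumes N: "1 \<le> N" and es: "pairs_in n es" and l: "l \<in> {1..n}" "l' \<in> {1..n}"
  shows "sk.mean N (\<lambda>_. \<beta>) n (\<lambda>t. sk_overlap N t l l' * pair_prod (sk_overlap N) es t)
    = sk.mean N (\<lambda>_. \<beta>) n (\<lambda>t. t l N * t l' N * pair_prod (sk_overlap N) es t)"
proof -
  let ?m = "sk.mean N (\<lambda>_. \<beta>) n"
  let ?f = "\<lambda>i t. t l i * t l' i * pair_prod (sk_overlap N) es t"
  have site: "?m (?f i) = ?m (?f N)" if i: "i \<in> {1..N}" for i
  proof -
    define \<pi> where "\<pi> = Transposition.transpose i N"
    have \<pi>: "\<pi> permutes {1..N}" "\<And>j. \<pi> (\<pi> j) = j" "\<pi> N = i"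
      using i N by (auto simp: \<pi>_def permutes_swap_id)
    have prod: "pair_prod (sk_overlap N) es' (\<lambda>l j. t l (\<pi> j)) = pair_prod (sk_overlap N) es' t" for es' t
      by (induction es') (simp_all add: sk_overlap_site[OF \<pi>(1)])
    have "depends_on {1..n} (?f N)"
      by (intro depends_on_mult depends_on_sk_pair_prod es) (use l in \<open>auto simp: depends_on_def\<close>)
    from mean_site[OF \<pi>(1,2) this, of \<beta>] show ?thesis
      by (simp only: prod \<pi>(3))
  qed
  have "?m (\<lambda>t. sk_overlap N t l l' * pair_prod (sk_overlap N) es t) = ?m (\<lambda>t. \<Sum>i = 1..N. 1 / real N * ?f i t)"
    unfolding sk_overlap_def sum_distrib_left sum_distrib_right by (simp only: mult.assoc)
  also have "\<dots> = (\<Sum>i = 1..N. 1 / real N * ?m (?f i))"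
    by (simp only: sk.mean_sum sk.mean_cmult)
  also have "\<dots> = (\<Sum>i = 1..N. 1 / real N * ?m (?f N))"
    by (intro sum.cong refl) (simp only: site)
  also have "\<dots> = ?m (?f N)" using N by simp
  finally show ?thesis .
qed

section \<open>From the given probability space to the product measure\<close>

lemma sk_gibbs_eq_bracket:
  "sk_gibbs x \<beta> N n f = sk.bracket N (\<lambda>_. \<beta>) x n f"
proof -
  have h: "- \<beta> * sk_hamiltonian x N \<sigma> = sk.energy N (\<lambda>_. \<beta>) x \<sigma>" for \<sigma>
    unfolding sk_hamiltonian_def sk.energy_def sk_spin_pair_def
    by (simp add: sum_distrib_left sum_negf case_prod_unfold mult_ac)
  have "exp (- \<beta> * (\<Sum>l = 1..n. sk_hamiltonian x N (t l))) = (\<Prod>l\<in>{1..n}. exp (sk.energy N (\<lambda>_. \<beta>) x (t l)))" for t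
    unfolding sum_distrib_left h by (simp add: exp_sum)
  then show ?thesis
    unfolding sk_gibbs_def sk.bracket_def replica_avg_def gibbs_weight_def sk_replicas_def sk_partition_def h
    by (simp add: prod_dividef sum_divide_distrib)
qed

lemma bracket_cong_couplings:
  assumes "\<And>p. p \<in> sk_pairs N \<Longrightarrow> x p = y p"
  shows "sk.bracket N c x n f = sk.bracket N c y n f"
proof -
  have "sk.energy N c x = sk.energy N c y"
    unfolding sk.energy_def using assms by (intro ext sum.cong) auto
  then show ?thesis by (simp add: sk.bracket_def)
qed

lemma sk_nu_eq_mean:
  assumes N: "2 \<le> N" and dis: "sk_disorder N M g"
  shows "sk_nu M g \<beta> N n f = sk.mean N (\<lambda>_. \<beta>) n f"
proof -
  have M: "prob_space M" and indep: "prob_space.indep_vars M (\<lambda>_. borel) g (sk_pairs N)"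
    and d: "\<And>p. p \<in> sk_pairs N \<Longrightarrow> distributed M lborel (g p) (\<lambda>x. ennreal (std_normal_density x))"
    using dis unfolding sk_disorder_def by auto
  interpret M: prob_space M by (rule M)
  have rv: "g p \<in> borel_measurable M" if "p \<in> sk_pairs N" for p
    using distributed_measurable[OF d[OF that]] by simp
  have distr_g: "distr M borel (g p) = gauss" if "p \<in> sk_pairs N" for p
  proof -
    have "distr M borel (g p) = distr M lborel (g p)" by (rule distr_cong) auto
    also have "\<dots> = gauss" using distributed_distr_eq_density[OF d[OF that]] by (simp add: gauss_def)
    finally show ?thesis .
  qed
  let ?X = "\<lambda>\<omega>. \<lambda>p\<in>sk_pairs N. g p \<omega>"
  \<comment> \<open>For \<open>N \<ge> 2\<close> there is at least one coupling; the
    characterization of independence by the joint law is applied to a nonempty index set.\<close>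
  have "(1, 2) \<in> sk_pairs N" using N by (simp add: sk_pairs_def)
  then have "distr M (PiM (sk_pairs N) (\<lambda>_. borel)) ?X = PiM (sk_pairs N) (\<lambda>p. distr M borel (g p))"
    using M.indep_vars_iff_distr_eq_PiM'[of "sk_pairs N" g "\<lambda>_. borel"] rv indep by auto
  also have "\<dots> = sk.couplings N" by (rule PiM_cong) (auto simp: distr_g)
  finally have distr: "distr M (PiM (sk_pairs N) (\<lambda>_. borel)) ?X = sk.couplings N" .
  have meas: "(\<lambda>x. sk.bracket N (\<lambda>_. \<beta>) x n f) \<in> borel_measurable (PiM (sk_pairs N) (\<lambda>_. borel))"
  proof -
    have "sets (PiM (sk_pairs N) (\<lambda>_. borel :: real measure)) = sets (sk.couplings N)"
      by (rule sets_PiM_cong) auto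
    then show ?thesis using sk.bracket_measurable measurable_cong_sets by blast
  qed
  have "sk.mean N (\<lambda>_. \<beta>) n f = (\<integral>\<omega>. sk.bracket N (\<lambda>_. \<beta>) (?X \<omega>) n f \<partial>M)"
    unfolding sk.mean_def distr[symmetric]
    by (rule integral_distr[OF _ meas]) (rule measurable_restrict, rule rv)
  also have "\<dots> = sk_nu M g \<beta> N n f"
    unfolding sk_nu_def sk_gibbs_eq_bracket
    by (intro Bochner_Integration.integral_cong refl bracket_cong_couplings) simp
  finally show ?thesis by simp
qed

section \<open>The expansion\<close>

text \<open>The final digit is the value of s and a counts factors 1 / N. At \<open>s = 0\<close>
  only the empty set of last spins is kept, since monomials with last spins vanish there.\<close>

definition cav0 :: "real \<Rightarrow> nat \<Rightarrow> nat \<Rightarrow> (nat \<times> nat) list \<Rightarrow> nat \<Rightarrow> real" where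
  "cav0 \<beta> a n es N = nu_path \<beta> N 0 n (cav_mono N {} es) / real N ^ a"

definition cav1 :: "real \<Rightarrow> nat \<Rightarrow> nat \<Rightarrow> nat set \<Rightarrow> (nat \<times> nat) list \<Rightarrow> nat \<Rightarrow> real" where
  "cav1 \<beta> a n T es N = nu_path \<beta> N 1 n (cav_mono N T es) / real N ^ a"

text \<open>An intermediate stage between full and cavity overlaps: es is already converted, es' is
  still full, so the conversion can go pair by pair.\<close>

definition mixed ::
  "real \<Rightarrow> nat \<Rightarrow> nat \<Rightarrow> nat set \<Rightarrow> (nat \<times> nat) list \<Rightarrow> (nat \<times> nat) list \<Rightarrow> nat \<Rightarrow> real" where
  "mixed \<beta> a n T es es' N =
     nu_path \<beta> N 1 n (\<lambda>t. cav_mono N T es t * pair_prod (sk_overlap N) es' t) / real N ^ a"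

text \<open>The bound \<open>w\<close> refers to the weight \<open>2 * a + length es\<close>, twice the order in \<open>1 / N\<close> of \<open>cav0\<close>.\<close>

definition expandable_from :: "real \<Rightarrow> nat \<Rightarrow> nat \<Rightarrow> bool" where
  "expandable_from \<beta> K w \<longleftrightarrow>
     (\<forall>a n es. pairs_in n es \<longrightarrow> w \<le> 2 * a + length es \<longrightarrow> expandable K (cav0 \<beta> a n es))"

text \<open>At time 0 the derivative of order r is a combination, with coefficients not depending on
  N, of monomials with r more overlaps; those with a last spin left over vanish.\<close>

lemma path_derivs_expandable:
  assumes "T \<subseteq> {1..n}" "pairs_in n es"
    and "\<And>n' es'. pairs_in n' es' \<Longrightarrow> length es' = length es + r \<Longrightarrow> expandable K (cav0 \<beta> a n' es')"
  shows "expandable K (\<lambda>N. path_derivs r \<beta> N n T es 0 / real N ^ a)"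
  using assms
proof (induction r arbitrary: n T es)
  case 0
  show ?case
  proof (cases "T = {}")
    case True
    then show ?thesis using 0(3)[OF 0(2)] by (simp add: cav0_def[abs_def])
  next
    case False
    have "\<forall>\<^sub>F N in sequentially. 0 = path_derivs 0 \<beta> N n T es 0 / real N ^ a"
      using eventually_ge_at_top[of 1]
      by eventually_elim (simp add: nu_path_zero_antisymmetric[OF _ 0(1) False])
    then show ?thesis by (rule expandable_cong[OF expandable_zero])
  qed
next
  case (Suc r)
  have "expandable K (\<lambda>N. \<Sum>l = 1..Suc n. \<Sum>l'\<in>{1..Suc (Suc n)} - {l}.
      \<beta>\<^sup>2 / 2 * (cav_coeff n l * cav_coeff (Suc n) l') *
      (path_derivs r \<beta> N (Suc (Suc n)) (symdiff T {l, l'}) ((l, l') # es) 0 / real N ^ a))"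
  proof (intro expandable_sum expandable_cmult)
    fix l l' assume l: "l \<in> {1..Suc n}" "l' \<in> {1..Suc (Suc n)} - {l}"
    show "expandable K (\<lambda>N. path_derivs r \<beta> N (Suc (Suc n)) (symdiff T {l, l'}) ((l, l') # es) 0 / real N ^ a)"
      by (rule Suc.IH[OF admissible_step[OF Suc.prems(1,2) l]]) (use Suc.prems(3) in simp)
  qed
  then show ?case
    by (simp only: path_derivs.simps(2) sum_divide_distrib times_divide_eq_right)
qed

text \<open>Only the terms (p, q) and (q, p) cancel the two last spins. Both replicas are at most n,
  so their coefficients \<open>cav_coeff\<close> are 1 and each term contributes half of \<beta>^2.
  This is the \<beta>^2 of the equation X = \<beta>^2 X.\<close>

lemma path_derivs_one_pair:
  assumes N: "1 \<le> N" and e: "p \<in> {1..n}" "q \<in> {1..n}" "p \<noteq> q" and es: "pairs_in n es"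
  shows "path_derivs (Suc 0) \<beta> N n {p, q} es 0 = \<beta>\<^sup>2 * nu_path \<beta> N 0 n (cav_mono N {} ((p, q) # es))"
proof -
  let ?g = "\<lambda>l l'. \<beta>\<^sup>2 / 2 * (cav_coeff n l * cav_coeff (Suc n) l') *
      path_derivs 0 \<beta> N (Suc (Suc n)) (symdiff {p, q} {l, l'}) ((l, l') # es) 0"
  let ?A = "SIGMA l:{1..Suc n}. {1..Suc (Suc n)} - {l}"
  have "path_derivs (Suc 0) \<beta> N n {p, q} es 0 = (\<Sum>x\<in>?A. ?g (fst x) (snd x))"
    unfolding path_derivs.simps(2)[of 0] by (subst sum.Sigma) (auto simp: case_prod_unfold)
  also have "\<dots> = (\<Sum>x\<in>{(p, q), (q, p)}. ?g (fst x) (snd x))"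
  proof (rule sum.mono_neutral_right)
    show "\<forall>x\<in>?A - {(p, q), (q, p)}. ?g (fst x) (snd x) = 0"
    proof
      fix x assume x: "x \<in> ?A - {(p, q), (q, p)}"
      then have "symdiff {p, q} {fst x, snd x} \<noteq> {}" by (cases x) auto
      moreover have "symdiff {p, q} {fst x, snd x} \<subseteq> {1..Suc (Suc n)}" using x e by auto
      ultimately show "?g (fst x) (snd x) = 0"
        by (simp add: nu_path_zero_antisymmetric[OF N])
    qed
  qed (use e in auto)
  also have "\<dots> = ?g p q + ?g q p" using e by simp
  also have "?g q p = ?g p q"
  proof -
    have "cav_mono N {} ((q, p) # es) = cav_mono N {} ((p, q) # es)"
      by (rule ext) (simp add: cav_mono_def cav_overlap_def mult.commute)
    then show ?thesis using e by (simp add: cav_coeff_def insert_commute)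
  qed
  also have "?g p q = \<beta>\<^sup>2 / 2 * nu_path \<beta> N 0 (Suc (Suc n)) (cav_mono N {} ((p, q) # es))"
    using e by (simp add: cav_coeff_def)
  also have "nu_path \<beta> N 0 (Suc (Suc n)) (cav_mono N {} ((p, q) # es)) = nu_path \<beta> N 0 n (cav_mono N {} ((p, q) # es))"
    by (rule sk.mean_marginal[OF depends_on_cav_mono]) (use e es in auto)
  finally show ?thesis by simp
qed

text \<open>One derivative multiplies by the last spins of two distinct replicas; unless T consists
  of just these two, a last spin survives.\<close>

lemma path_derivs_one_zero:
  assumes N: "1 \<le> N" and T: "T \<subseteq> {1..n}" and no_pair: "\<And>p q. p \<noteq> q \<Longrightarrow> T \<noteq> {p, q}"
  shows "path_derivs (Suc 0) \<beta> N n T es 0 = 0"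
  unfolding path_derivs.simps(2)[of 0]
proof (intro sum.neutral ballI)
  fix l l' assume l: "l \<in> {1..Suc n}" "l' \<in> {1..Suc (Suc n)} - {l}"
  then have "symdiff T {l, l'} \<noteq> {}" using no_pair[of l l'] by blast
  moreover have "symdiff T {l, l'} \<subseteq> {1..Suc (Suc n)}" using l T by auto
  ultimately show "\<beta>\<^sup>2 / 2 * (cav_coeff n l * cav_coeff (Suc n) l') *
      path_derivs 0 \<beta> N (Suc (Suc n)) (symdiff T {l, l'}) ((l, l') # es) 0 = 0"
    by (simp add: nu_path_zero_antisymmetric[OF N])
qed

section \<open>Downward induction on the weight\<close>

context
  fixes \<beta> :: real and K :: nat
  assumes \<beta>: "0 < \<beta>" "\<beta> < 1"
begin

text \<open>Taylor terms of order at least 2 have weight at least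
  \<open>2 * a + length es + 2\<close>, hence above w, and are expandable by hypothesis; only orders
  0 and 1 remain.\<close>

lemma cav1_first_order:
  assumes G: "expandable_from \<beta> K (Suc w)" and T: "T \<subseteq> {1..n}" and es: "pairs_in n es"
    and w: "w \<le> 2 * a + length es + 1"
  shows "expandable K (\<lambda>N. cav1 \<beta> a n T es N
    - (path_derivs 0 \<beta> N n T es 0 + path_derivs (Suc 0) \<beta> N n T es 0) / real N ^ a)"
proof -
  \<comment> \<open>The Taylor remainder is of order N to the power -(length es + R + 1) / 2 - a;
    \<open>R + 1 = 2 * (K + 1)\<close> makes it at most N^-(K+1).\<close>
  define R where "R = 2 * K + 1"
  have "(\<lambda>N. (nu_path \<beta> N 1 n (cav_mono N T es) - (\<Sum>r\<le>R. path_derivs r \<beta> N n T es 0 / fact r)) * (1 / real N ^ a))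
      \<in> O(\<lambda>N. 1 / sqrt (real N) ^ (length es + Suc R) * (1 / real N ^ a))"
    by (intro landau_o.big.mult_right path_taylor \<beta> T es)
  also have "(\<lambda>N. 1 / sqrt (real N) ^ (length es + Suc R) * (1 / real N ^ a))
      = (\<lambda>N. 1 / sqrt (real N) ^ (length es + Suc R + 2 * a))"
    by (simp only: power_add sqrt_power_even times_divide_times_eq mult_1)
  also have "(\<lambda>N. 1 / sqrt (real N) ^ (length es + Suc R + 2 * a)) \<in> O(\<lambda>N. 1 / sqrt (real N) ^ (2 * (K + 1)))"
    by (rule inverse_power_bigo) (simp add: R_def)
  finally have rem: "expandable K (\<lambda>N. (nu_path \<beta> N 1 n (cav_mono N T es)
      - (\<Sum>r\<le>R. path_derivs r \<beta> N n T es 0 / fact r)) * (1 / real N ^ a))"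
    unfolding sqrt_power_even by (rule expandable_bigo)
  have tail: "expandable K (\<lambda>N. \<Sum>r\<in>{2..R}. 1 / fact r * (path_derivs r \<beta> N n T es 0 / real N ^ a))"
  proof (intro expandable_sum expandable_cmult path_derivs_expandable[OF T es])
    fix r n' es' assume "r \<in> {2..R}" "pairs_in n' es'" "length es' = length es + r"
    then show "expandable K (cav0 \<beta> a n' es')" using G w unfolding expandable_from_def by auto
  qed
  have "(nu_path \<beta> N 1 n (cav_mono N T es)
      - (\<Sum>r\<le>R. path_derivs r \<beta> N n T es 0 / fact r)) * (1 / real N ^ a)
      + (\<Sum>r\<in>{2..R}. 1 / fact r * (path_derivs r \<beta> N n T es 0 / real N ^ a))
    = cav1 \<beta> a n T es N - (path_derivs 0 \<beta> N n T es 0 + path_derivs (Suc 0) \<beta> N n T es 0) / real N ^ a" for N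
  proof -
    define d where "d r = path_derivs r \<beta> N n T es 0" for r
    have set: "{..R} = insert 0 (insert (Suc 0) {2..R})" by (auto simp: R_def)
    have "(\<Sum>r\<le>R. d r / fact r) = d 0 + d (Suc 0) + (\<Sum>r\<in>{2..R}. d r / fact r)"
      unfolding set by simp
    moreover have "(\<Sum>r\<in>{2..R}. 1 / fact r * (d r / real N ^ a)) = (\<Sum>r\<in>{2..R}. d r / fact r) * (1 / real N ^ a)"
      unfolding sum_distrib_right by simp
    ultimately show ?thesis
      unfolding cav1_def d_def[symmetric] by (simp add: algebra_simps diff_divide_distrib add_divide_distrib)
  qed
  with expandable_add[OF rem tail] show ?thesis by (simp only:)
qed

lemma cav1_empty:
  assumes G: "expandable_from \<beta> K (Suc w)" and es: "pairs_in n es" and w: "w \<le> 2 * a + length es + 1"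
  shows "expandable K (\<lambda>N. cav1 \<beta> a n {} es N - cav0 \<beta> a n es N)"
proof (rule expandable_cong[OF cav1_first_order[OF G _ es w, of "{}"]])
  show "\<forall>\<^sub>F N in sequentially. cav1 \<beta> a n {} es N
    - (path_derivs 0 \<beta> N n {} es 0 + path_derivs (Suc 0) \<beta> N n {} es 0) / real N ^ a
    = cav1 \<beta> a n {} es N - cav0 \<beta> a n es N"
    using eventually_ge_at_top[of 1]
    by eventually_elim (subst path_derivs_one_zero, auto simp: cav0_def)
qed simp

lemma cav1_pair:
  assumes G: "expandable_from \<beta> K (Suc w)" and es: "pairs_in n es" and w: "w \<le> 2 * a + length es + 1"
    and e: "p \<in> {1..n}" "q \<in> {1..n}" "p \<noteq> q"
  shows "expandable K (\<lambda>N. cav1 \<beta> a n {p, q} es N - \<beta>\<^sup>2 * cav0 \<beta> a n ((p, q) # es) N)"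
proof -
  have T: "{p, q} \<subseteq> {1..n}" using e by auto
  show ?thesis
  proof (rule expandable_cong[OF cav1_first_order[OF G T es w]])
    show "\<forall>\<^sub>F N in sequentially. cav1 \<beta> a n {p, q} es N
      - (path_derivs 0 \<beta> N n {p, q} es 0 + path_derivs (Suc 0) \<beta> N n {p, q} es 0) / real N ^ a
      = cav1 \<beta> a n {p, q} es N - \<beta>\<^sup>2 * cav0 \<beta> a n ((p, q) # es) N"
      using eventually_ge_at_top[of 1]
    proof eventually_elim
      case (elim N)
      have "path_derivs 0 \<beta> N n {p, q} es 0 = 0"
        using nu_path_zero_antisymmetric[OF elim T] by simp
      then show ?case
        unfolding path_derivs_one_pair[OF elim e es] cav0_def by simp
    qed
  qed
qed

lemma cav1_no_pair:
  assumes G: "expandable_from \<beta> K (Suc w)" and es: "pairs_in n es" and w: "w \<le> 2 * a + length es + 1"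
    and T: "T \<subseteq> {1..n}" "T \<noteq> {}" and no_pair: "\<And>p q. p \<noteq> q \<Longrightarrow> T \<noteq> {p, q}"
  shows "expandable K (cav1 \<beta> a n T es)"
proof (rule expandable_cong[OF cav1_first_order[OF G T(1) es w]])
  show "\<forall>\<^sub>F N in sequentially. cav1 \<beta> a n T es N
    - (path_derivs 0 \<beta> N n T es 0 + path_derivs (Suc 0) \<beta> N n T es 0) / real N ^ a = cav1 \<beta> a n T es N"
    using eventually_ge_at_top[of 1]
  proof eventually_elim
    case (elim N)
    have "path_derivs 0 \<beta> N n T es 0 = 0" using nu_path_zero_antisymmetric[OF elim T] by simp
    moreover have "path_derivs (Suc 0) \<beta> N n T es 0 = 0"
      by (rule path_derivs_one_zero[OF elim T(1)]) (rule no_pair)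
    ultimately show ?case by (simp del: path_derivs.simps)
  qed
qed

text \<open>The assumption on the weight is stronger by one than in \<open>cav1_pair\<close>, so
  that even the leading term, with one overlap more than es, has weight above w.\<close>

lemma cav1_nonempty:
  assumes G: "expandable_from \<beta> K (Suc w)" and es: "pairs_in n es" and w: "w \<le> 2 * a + length es"
    and T: "T \<subseteq> {1..n}" "T \<noteq> {}"
  shows "expandable K (cav1 \<beta> a n T es)"
proof (cases "\<exists>p q. p \<noteq> q \<and> T = {p, q}")
  case True
  then obtain p q where pq: "p \<noteq> q" "T = {p, q}" by blast
  then have e: "p \<in> {1..n}" "q \<in> {1..n}" using T by auto
  have "expandable K (cav0 \<beta> a n ((p, q) # es))"
    using G es e pq w unfolding expandable_from_def by simp
  from expandable_add[OF cav1_pair[OF G es _ e pq(1), of a] expandable_cmult[OF this, of "\<beta>\<^sup>2"]] w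
  show ?thesis unfolding pq(2) by simp
next
  case False
  then show ?thesis using w by (intro cav1_no_pair[OF G es _ T]) auto
qed

lemma mixed_Nil: "mixed \<beta> a n T es [] = cav1 \<beta> a n T es"
  by (rule ext) (simp add: mixed_def cav1_def)

text \<open>A full overlap is a cavity overlap plus a product of last spins over N. In the second
  case a pair leaves the lists, the factor 1 / N adds 2 to the weight, and the spins join T: the
  weight rises by one, although spins may cancel in T.\<close>

lemma mixed_Cons:
  assumes N: "1 \<le> N" and T: "T \<subseteq> {1..n}" and e: "fst e \<in> {1..n}" "snd e \<in> {1..n}" "fst e \<noteq> snd e"
  shows "mixed \<beta> a n T es (e # es') N
    = mixed \<beta> a n T (es @ [e]) es' N + mixed \<beta> (Suc a) n (symdiff T {fst e, snd e}) es es' N"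
proof -
  let ?R = "pair_prod (sk_overlap N) es'" and ?T' = "symdiff T {fst e, snd e}"
  have "nu_path \<beta> N 1 n (\<lambda>t. cav_mono N T es t * pair_prod (sk_overlap N) (e # es') t)
    = nu_path \<beta> N 1 n (\<lambda>t. cav_mono N T (es @ [e]) t * ?R t + 1 / real N * (cav_mono N ?T' es t * ?R t))"
  proof (rule sk.mean_cong)
    fix t assume t: "t \<in> {1..n} \<rightarrow>\<^sub>E sk_configs N"
    have s: "spin_prod N T t * (t (fst e) N * t (snd e) N) = spin_prod N ?T' t"
      using spin_prod_mult[OF N t T, of "{fst e, snd e}"] e by (simp add: spin_prod_pair)
    have "cav_mono N ?T' es t = spin_prod N T t * (t (fst e) N * t (snd e) N) * pair_prod (cav_overlap N) es t"
      unfolding cav_mono_def s ..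
    then show "cav_mono N T es t * pair_prod (sk_overlap N) (e # es') t
      = cav_mono N T (es @ [e]) t * ?R t + 1 / real N * (cav_mono N ?T' es t * ?R t)"
      unfolding cav_mono_def s[symmetric] pair_prod_append pair_prod_Cons
        sk_overlap_split[OF N, of t "fst e" "snd e"]
      by (simp add: algebra_simps)
  qed
  also have "\<dots> = nu_path \<beta> N 1 n (\<lambda>t. cav_mono N T (es @ [e]) t * ?R t)
      + 1 / real N * nu_path \<beta> N 1 n (\<lambda>t. cav_mono N ?T' es t * ?R t)"
    by (simp only: sk.mean_add sk.mean_cmult)
  finally show ?thesis by (simp add: mixed_def add_divide_distrib)
qed

lemma mixed_expandable:
  assumes H: "\<And>a T es. a0 \<le> a \<Longrightarrow> w \<le> 2 * a + length es \<Longrightarrow> T \<subseteq> {1..n} \<Longrightarrow> pairs_in n es \<Longrightarrow>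
      expandable K (cav1 \<beta> a n T es)"
    and "a0 \<le> a" "w \<le> 2 * a + length es + length es'" "T \<subseteq> {1..n}" "pairs_in n es" "pairs_in n es'"
  shows "expandable K (mixed \<beta> a n T es es')"
  using assms(2-6)
proof (induction es' arbitrary: a T es)
  case Nil
  then show ?case unfolding mixed_Nil by (intro H) auto
next
  case (Cons e es')
  have e: "fst e \<in> {1..n}" "snd e \<in> {1..n}" "fst e \<noteq> snd e" using Cons.prems by auto
  have "expandable K (\<lambda>N. mixed \<beta> a n T (es @ [e]) es' N + mixed \<beta> (Suc a) n (symdiff T {fst e, snd e}) es es' N)"
    using Cons.prems by (intro expandable_add Cons.IH) auto
  then show ?case
    by (rule expandable_cong)
       (use eventually_ge_at_top[of 1] in \<open>eventually_elim, simp add: mixed_Cons[OF _ Cons.prems(3) e]\<close>)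
qed

text \<open>All corrections from converting overlaps carry a higher power of 1 / N, so the
  hypothesis is needed only for exponents above a. The \<open>+ 1\<close> admits products in which
  one overlap has been traded for two last spins.\<close>

lemma mixed_eq_cav1:
  assumes H: "\<And>a' T es. a < a' \<Longrightarrow> w \<le> 2 * a' + length es \<Longrightarrow> T \<subseteq> {1..n} \<Longrightarrow> pairs_in n es \<Longrightarrow>
      expandable K (cav1 \<beta> a' n T es)"
    and "w \<le> 2 * a + length es + length es' + 1" "T \<subseteq> {1..n}" "pairs_in n es" "pairs_in n es'"
  shows "expandable K (\<lambda>N. mixed \<beta> a n T es es' N - cav1 \<beta> a n T (es @ es') N)"
  using assms(2-5)
proof (induction es' arbitrary: T es)
  case Nil
  then show ?case by (simp add: mixed_Nil expandable_zero)
next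
  case (Cons e es')
  have e: "fst e \<in> {1..n}" "snd e \<in> {1..n}" "fst e \<noteq> snd e" using Cons.prems by auto
  have 1: "expandable K (\<lambda>N. mixed \<beta> a n T (es @ [e]) es' N - cav1 \<beta> a n T ((es @ [e]) @ es') N)"
    using Cons.prems by (intro Cons.IH) auto
  have 2: "expandable K (mixed \<beta> (Suc a) n (symdiff T {fst e, snd e}) es es')"
    by (rule mixed_expandable[where w = w and ?a0.0 = "Suc a"]) (use Cons.prems H in auto)
  show ?case
    by (rule expandable_cong[OF expandable_add[OF 1 2]])
       (use eventually_ge_at_top[of 1] in \<open>eventually_elim, simp add: mixed_Cons[OF _ Cons.prems(2) e]\<close>)
qed

lemma mixed_last_spin:
  assumes "1 \<le> N" "pairs_in n (e # es)"
  shows "mixed \<beta> a n {fst e, snd e} [] es N = mixed \<beta> a n {} [] (e # es) N"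
proof -
  have "nu_path \<beta> N 1 n (\<lambda>t. sk_overlap N t (fst e) (snd e) * pair_prod (sk_overlap N) es t)
    = nu_path \<beta> N 1 n (\<lambda>t. t (fst e) N * t (snd e) N * pair_prod (sk_overlap N) es t)"
    unfolding path_coupling_one using assms by (intro mean_overlap_eq_last_spin) auto
  then show ?thesis using assms(2) by (simp add: mixed_def cav_mono_def spin_prod_pair) (simp add: spin_prod_def)
qed

lemma expandable_from_step:
  assumes G: "expandable_from \<beta> K (Suc w)"
  shows "expandable_from \<beta> K w"
proof -
  have exact: "expandable K (cav0 \<beta> a n es)" if "2 * a + length es = w" "pairs_in n es" for a n es
    using that
  proof (induction "length es" arbitrary: a n es rule: less_induct)
    case less
    show ?case
    proof (cases es)
      case Nil
      \<comment> \<open>Explicit powers of 1 / N enter the expansion only here, where no overlap is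
        left.\<close>
      have "cav_mono N {} [] = (\<lambda>_. 1)" for N
        by (rule ext) (simp add: cav_mono_def spin_prod_def)
      then have "cav0 \<beta> a n [] = (\<lambda>N. 1 / real N ^ a)"
        by (simp add: cav0_def[abs_def] sk.mean_const)
      then show ?thesis unfolding Nil by (simp add: expandable_power)
    next
      case (Cons e es')
      have e: "fst e \<in> {1..n}" "snd e \<in> {1..n}" "fst e \<noteq> snd e" and es': "pairs_in n es'"
        using less.prems Cons by auto
      let ?T = "{fst e, snd e}"
      \<comment> \<open>Corrections of the same weight w with \<open>a' > a\<close> have fewer
        overlaps and fall under the inner induction; larger weights are covered by G.\<close>
      have H: "expandable K (cav1 \<beta> a' n T' es'')"
        if "a < a'" "w \<le> 2 * a' + length es''" "T' \<subseteq> {1..n}" "pairs_in n es''" for a' T' es''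
      proof (cases "T' = {}")
        case True
        have "expandable K (cav0 \<beta> a' n es'')"
        proof (cases "2 * a' + length es'' = w")
          case True
          then show ?thesis using less.prems that by (intro less.hyps) auto
        next
          case False
          then show ?thesis using G that unfolding expandable_from_def by auto
        qed
        from expandable_add[OF cav1_empty[OF G that(4), of a'] this] that(2) True show ?thesis by simp
      next
        case False
        then show ?thesis using that by (intro cav1_nonempty[OF G])
      qed
      have A: "expandable K (\<lambda>N. cav1 \<beta> a n ?T es' N - \<beta>\<^sup>2 * cav0 \<beta> a n es N)"
        using cav1_pair[OF G es' _ e, of a] less.prems Cons by simp
      have B: "expandable K (\<lambda>N. mixed \<beta> a n ?T [] es' N - cav1 \<beta> a n ?T es' N)"
        using mixed_eq_cav1[OF H, where es = "[]" and es' = es' and T = ?T] less.prems Cons e es' by simp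
      have D: "expandable K (\<lambda>N. mixed \<beta> a n {} [] es N - cav1 \<beta> a n {} es N)"
        using mixed_eq_cav1[OF H, where es = "[]" and es' = es and T = "{}"] less.prems by simp
      have E: "expandable K (\<lambda>N. cav1 \<beta> a n {} es N - cav0 \<beta> a n es N)"
        using cav1_empty[OF G less.prems(2), of a] less.prems by simp
      have \<beta>2: "\<beta>\<^sup>2 < 1" using \<beta> by (simp add: power_less_one_iff)
      \<comment> \<open>The two \<open>mixed\<close> terms agree by symmetry between sites. One is
        \<beta>^2 X and the other X, up to expandable terms, with X the unknown \<open>cav0\<close>;
        their difference is solved for X by dividing by 1 - \<beta>^2.\<close>
      have "expandable K (\<lambda>N. 1 / (1 - \<beta>\<^sup>2) *
          (((mixed \<beta> a n ?T [] es' N - cav1 \<beta> a n ?T es' N)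
            + (cav1 \<beta> a n ?T es' N - \<beta>\<^sup>2 * cav0 \<beta> a n es N))
          - ((mixed \<beta> a n {} [] es N - cav1 \<beta> a n {} es N)
            + (cav1 \<beta> a n {} es N - cav0 \<beta> a n es N))))"
        by (intro expandable_cmult expandable_diff expandable_add A B D E)
      then show ?thesis
      proof (rule expandable_cong)
        show "\<forall>\<^sub>F N in sequentially. 1 / (1 - \<beta>\<^sup>2) *
          (((mixed \<beta> a n ?T [] es' N - cav1 \<beta> a n ?T es' N)
            + (cav1 \<beta> a n ?T es' N - \<beta>\<^sup>2 * cav0 \<beta> a n es N))
          - ((mixed \<beta> a n {} [] es N - cav1 \<beta> a n {} es N)
            + (cav1 \<beta> a n {} es N - cav0 \<beta> a n es N))) = cav0 \<beta> a n es N"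
          using eventually_ge_at_top[of 1]
        proof eventually_elim
          case (elim N)
          have "mixed \<beta> a n ?T [] es' N = mixed \<beta> a n {} [] es N"
            using mixed_last_spin[OF elim, of n e es'] less.prems Cons by simp
          then show ?case using \<beta>2 by (simp add: field_simps)
        qed
      qed
    qed
  qed
  show ?thesis
    unfolding expandable_from_def
  proof (intro allI impI)
    fix a n es assume *: "pairs_in n es" "w \<le> 2 * a + length es"
    show "expandable K (cav0 \<beta> a n es)"
    proof (cases "2 * a + length es = w")
      case True
      then show ?thesis using exact * by blast
    next
      case False
      then show ?thesis using G * unfolding expandable_from_def by auto
    qed
  qed
qed

text \<open>Start of the downward induction: by the moment bound a term of weight at least
  \<open>2 * (K + 1)\<close> belongs to the remainder.\<close>

lemma expandable_from_large: "expandable_from \<beta> K (2 * (K + 1))"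
  unfolding expandable_from_def
proof (intro allI impI)
  fix a n and es :: "(nat \<times> nat) list" assume es: "pairs_in n es" "2 * (K + 1) \<le> 2 * a + length es"
  obtain C where "\<And>N T es' u. 1 \<le> N \<Longrightarrow> T \<subseteq> {1..n} \<Longrightarrow> pairs_in n es' \<Longrightarrow> length es' = length es \<Longrightarrow>
      u \<in> {0..1} \<Longrightarrow> \<bar>path_derivs 0 \<beta> N n T es' u\<bar> \<le> C / sqrt (real N) ^ (length es + 0)"
    using path_derivs_bound[OF \<beta>, of n "length es" 0] by blast
  from this[of _ "{}" es 0] es
  have C: "\<bar>nu_path \<beta> N 0 n (cav_mono N {} es)\<bar> \<le> C / sqrt (real N) ^ length es" if "1 \<le> N" for N
    using that by simp
  have "cav0 \<beta> a n es \<in> O(\<lambda>N. 1 / sqrt (real N) ^ (2 * a + length es))"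
  proof (rule bigoI[where c = "\<bar>C\<bar>"])
    show "\<forall>\<^sub>F N in sequentially. norm (cav0 \<beta> a n es N) \<le> \<bar>C\<bar> * norm (1 / sqrt (real N) ^ (2 * a + length es))"
      using eventually_ge_at_top[of 1]
    proof eventually_elim
      case (elim N)
      have "C / sqrt (real N) ^ length es \<le> \<bar>C\<bar> / sqrt (real N) ^ length es"
        by (intro divide_right_mono) auto
      with C[OF elim] have "\<bar>nu_path \<beta> N 0 n (cav_mono N {} es)\<bar> / real N ^ a
          \<le> \<bar>C\<bar> / sqrt (real N) ^ length es / real N ^ a"
        by (intro divide_right_mono) auto
      moreover have "sqrt (real N) ^ (2 * a + length es) = real N ^ a * sqrt (real N) ^ length es"
        by (simp only: power_add sqrt_power_even)
      ultimately show ?case by (simp add: cav0_def mult.commute)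
    qed
  qed
  also have "(\<lambda>N. 1 / sqrt (real N) ^ (2 * a + length es)) \<in> O(\<lambda>N. 1 / sqrt (real N) ^ (2 * (K + 1)))"
    by (rule inverse_power_bigo) (rule es)
  finally show "expandable K (cav0 \<beta> a n es)"
    unfolding sqrt_power_even by (rule expandable_bigo)
qed

lemma expandable_from_zero: "expandable_from \<beta> K 0"
proof -
  \<comment> \<open>Here d counts downward steps; subtraction is truncated, so the bound stays 0
    once it is reached.\<close>
  have "expandable_from \<beta> K (2 * (K + 1) - d)" for d
  proof (induction d)
    case 0
    then show ?case using expandable_from_large by simp
  next
    case (Suc d)
    show ?case
    proof (cases "d < 2 * (K + 1)")
      case True
      then have "2 * (K + 1) - d = Suc (2 * (K + 1) - Suc d)" by simp
      with Suc show ?thesis by (metis expandable_from_step)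
    next
      case False
      with Suc show ?thesis by simp
    qed
  qed
  from this[of "2 * (K + 1)"] show ?thesis by simp
qed

lemma overlap_product_expandable:
  assumes "T \<subseteq> {1..n}" "pairs_in n es"
  shows "expandable K (\<lambda>N. nu_path \<beta> N 1 n (\<lambda>t. spin_prod N T t * pair_prod (sk_overlap N) es t))"
proof -
  have G0: "expandable K (cav0 \<beta> a n es')" if "pairs_in n es'" for a n es'
    using expandable_from_zero that unfolding expandable_from_def by simp
  then have G: "expandable_from \<beta> K (Suc 0)" unfolding expandable_from_def by blast
  have "expandable K (cav1 \<beta> a n T' es')" if "T' \<subseteq> {1..n}" "pairs_in n es'" for a T' es'
  proof (cases "T' = {}")
    case True
    from expandable_add[OF cav1_empty[OF G that(2), of a] G0[OF that(2), of a]] True show ?thesis by simp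
  next
    case False
    then show ?thesis using that by (intro cav1_nonempty[OF G]) auto
  qed
  \<comment> \<open>No overlap is converted yet, so this is the average of the statement; the
    conversion goes through with the trivial bound \<open>w = 0\<close>.\<close>
  then have "expandable K (mixed \<beta> 0 n T [] es)"
    by (rule mixed_expandable[where w = 0 and ?a0.0 = 0]) (use assms in auto)
  then show ?thesis unfolding mixed_def cav_mono_def by simp
qed

end

text \<open>T collects the replicas that occur an odd number of times. It depends on the pairs
  alone, so one set serves every N.\<close>

lemma spin_pairs_prod:
  fixes j l :: "nat \<Rightarrow> nat"
  assumes "\<And>i. i \<in> {1..k} \<Longrightarrow> j i \<in> {1..n} \<and> l i \<in> {1..n} \<and> j i \<noteq> l i"
  shows "\<exists>T\<subseteq>{1..n}. \<forall>N\<ge>1. \<forall>t\<in>{1..n} \<rightarrow>\<^sub>E sk_configs N.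
    (\<Prod>i = 1..k. t (j i) N * t (l i) N) = spin_prod N T t"
  using assms
proof (induction k)
  case 0
  then show ?case by (intro exI[of _ "{}"]) (simp add: spin_prod_def)
next
  case (Suc k)
  obtain T where T: "T \<subseteq> {1..n}" "\<forall>N\<ge>1. \<forall>t\<in>{1..n} \<rightarrow>\<^sub>E sk_configs N.
      (\<Prod>i = 1..k. t (j i) N * t (l i) N) = spin_prod N T t"
    using Suc by auto
  let ?e = "{j (Suc k), l (Suc k)}"
  have e: "?e \<subseteq> {1..n}" "j (Suc k) \<noteq> l (Suc k)" using Suc.prems[of "Suc k"] by auto
  have "(\<Prod>i = 1..Suc k. t (j i) N * t (l i) N) = spin_prod N (symdiff T ?e) t"
    if N: "1 \<le> N" and t: "t \<in> {1..n} \<rightarrow>\<^sub>E sk_configs N" for N t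
    using T(2) N t spin_prod_mult[OF N t T(1) e(1)] by (simp add: spin_prod_pair[OF e(2)])
  moreover have "symdiff T ?e \<subseteq> {1..n}" using T(1) e(1) by auto
  ultimately show ?case by blast
qed

theorem theorem1p1:
  fixes \<beta> :: real and k n :: nat and j l :: "nat \<Rightarrow> nat"
  assumes "0 < \<beta>" and "\<beta> < 1"
    and "1 \<le> k"
    and "\<And>i. i \<in> {1..k} \<Longrightarrow> 1 \<le> j i \<and> j i < l i"
    and "(k + 1) div 2 \<le> n"
  shows "\<exists>C :: nat \<Rightarrow> real.
    \<forall>(m :: nat) (M :: 'w measure) (g :: nat \<times> nat \<Rightarrow> 'w \<Rightarrow> real).
      (\<forall>i \<in> {1..k}. l i \<le> m) \<longrightarrow> (\<forall>N \<ge> 1. sk_disorder N M g) \<longrightarrow>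
      (\<lambda>N. sk_nu M g \<beta> N m
              (\<lambda>s. \<Prod>i = 1..k. s (j i) N * s (l i) N * sk_overlap N s (j i) (l i))
            - (\<Sum>r = (k + 1) div 2..n. C r / real N ^ r))
        \<in> O(\<lambda>N. 1 / real N ^ (n + 1))"
proof -
  \<comment> \<open>The largest replica index. The coefficients are taken from the average over n0
    replicas, so that they depend neither on m nor on the probability space; a larger m is reduced
    to n0 by summing out replicas.\<close>
  define n0 where "n0 = Max (l ` {1..k})"
  define es where "es = map (\<lambda>i. (j i, l i)) [1..<Suc k]"
  define F where "F N s = (\<Prod>i = 1..k. s (j i) N * s (l i) N * sk_overlap N s (j i) (l i))" for N s
  have l: "j i \<in> {1..n0} \<and> l i \<in> {1..n0} \<and> j i \<noteq> l i" if "i \<in> {1..k}" for i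
  proof -
    have "l i \<le> n0" unfolding n0_def using that by (intro Max_ge) auto
    then show ?thesis using assms(4)[OF that] by auto
  qed
  have "pairs_in n0 es"
    unfolding pairs_in_def
  proof
    fix e assume "e \<in> set es"
    also have "set es = (\<lambda>i. (j i, l i)) ` {1..k}"
      by (simp only: es_def set_map set_upt atLeastLessThanSuc_atLeastAtMost)
    finally obtain i where i: "i \<in> {1..k}" "e = (j i, l i)" by blast
    from l[OF i(1)] show "fst e \<in> {1..n0} \<and> snd e \<in> {1..n0} \<and> fst e \<noteq> snd e"
      unfolding i(2) by simp
  qed
  moreover have "length es = k" by (simp add: es_def)
  ultimately have es: "pairs_in n0 es" "length es = k" by blast+
  obtain T where T: "T \<subseteq> {1..n0}" and T_eq: "\<And>N t. 1 \<le> N \<Longrightarrow> t \<in> {1..n0} \<rightarrow>\<^sub>E sk_configs N \<Longrightarrow>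
      (\<Prod>i = 1..k. t (j i) N * t (l i) N) = spin_prod N T t"
    using spin_pairs_prod[of k j n0 l] l by blast
  have pair_eq: "pair_prod R (map (\<lambda>i. (j i, l i)) [1..<Suc k']) t = (\<Prod>i = 1..k'. R t (j i) (l i))" for R t k'
    by (induction k') (simp_all add: pair_prod_append mult.commute)
  have mean_F: "sk.mean N (\<lambda>_. \<beta>) n0 (F N) = nu_path \<beta> N 1 n0 (\<lambda>t. spin_prod N T t * pair_prod (sk_overlap N) es t)"
    if "1 \<le> N" for N
    unfolding path_coupling_one F_def es_def pair_eq
  proof (rule sk.mean_cong)
    fix s assume "s \<in> {1..n0} \<rightarrow>\<^sub>E sk_configs N"
    from T_eq[OF that this]
    show "(\<Prod>i = 1..k. s (j i) N * s (l i) N * sk_overlap N s (j i) (l i))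
        = spin_prod N T s * (\<Prod>i = 1..k. sk_overlap N s (j i) (l i))"
      by (simp only: prod.distrib)
  qed
  have depends_F: "depends_on {1..n0} (F N)" for N
    unfolding depends_on_def F_def sk_overlap_def using l by (auto intro!: prod.cong)
  obtain c where c: "(\<lambda>N. nu_path \<beta> N 1 n0 (\<lambda>t. spin_prod N T t * pair_prod (sk_overlap N) es t)
      - (\<Sum>r\<le>n. c r / real N ^ r)) \<in> O(\<lambda>N. 1 / real N ^ (n + 1))"
    using overlap_product_expandable[OF assms(1,2) T es(1)] unfolding expandable_def by blast
  have lead: "(\<lambda>N. nu_path \<beta> N 1 n0 (\<lambda>t. spin_prod N T t * pair_prod (sk_overlap N) es t))
      \<in> O(\<lambda>N. 1 / sqrt (real N) ^ k)"
  proof -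
    obtain D where D: "\<And>N. 1 \<le> N \<Longrightarrow>
        nu_path \<beta> N 1 n0 (\<lambda>t. \<bar>pair_prod (sk_overlap N) es t\<bar>) \<le> D / sqrt (real N) ^ k"
      using overlap_moments[OF assms(1,2), of n0 k] es by blast
    show ?thesis
    proof (rule bigoI[where c = "\<bar>D\<bar>"])
      show "\<forall>\<^sub>F N in sequentially. norm (nu_path \<beta> N 1 n0 (\<lambda>t. spin_prod N T t * pair_prod (sk_overlap N) es t))
          \<le> \<bar>D\<bar> * norm (1 / sqrt (real N) ^ k)"
        using eventually_ge_at_top[of 1]
      proof eventually_elim
        case (elim N)
        have "\<bar>nu_path \<beta> N 1 n0 (\<lambda>t. spin_prod N T t * pair_prod (sk_overlap N) es t)\<bar>
          \<le> nu_path \<beta> N 1 n0 (\<lambda>t. \<bar>spin_prod N T t * pair_prod (sk_overlap N) es t\<bar>)"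
          by (rule sk.mean_abs)
        also have "\<dots> = nu_path \<beta> N 1 n0 (\<lambda>t. \<bar>pair_prod (sk_overlap N) es t\<bar>)"
          by (rule sk.mean_cong) (simp add: abs_mult spin_prod_abs[OF elim _ T])
        also have "\<dots> \<le> D / sqrt (real N) ^ k" by (rule D[OF elim])
        also have "\<dots> \<le> \<bar>D\<bar> / sqrt (real N) ^ k" by (intro divide_right_mono) auto
        finally show ?case by simp
      qed
    qed
  qed
  \<comment> \<open>For r below \<open>(k + 1) div 2\<close> one has \<open>2 * r < k\<close>: these
    orders are larger than the a priori bound N^(-k/2) allows.\<close>
  have sum_c: "(\<Sum>r\<le>n. c r / real N ^ r) = (\<Sum>r = (k + 1) div 2..n. c r / real N ^ r)" for N
  proof (rule sum.mono_neutral_right)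
    show "\<forall>r\<in>{..n} - {(k + 1) div 2..n}. c r / real N ^ r = 0"
    proof
      fix r assume "r \<in> {..n} - {(k + 1) div 2..n}"
      then have "r \<le> n" "2 * r < k" by auto
      then have "c r = 0" by (rule expansion_coeff_zero[OF c lead])
      then show "c r / real N ^ r = 0" by simp
    qed
  qed auto
  show ?thesis
  proof (intro exI[of _ c] allI impI)
    fix m and M :: "'w measure" and g :: "nat \<times> nat \<Rightarrow> 'w \<Rightarrow> real"
    assume m: "\<forall>i\<in>{1..k}. l i \<le> m" and dis: "\<forall>N\<ge>1. sk_disorder N M g"
    have n0m: "n0 \<le> m" unfolding n0_def using m assms(3) by (intro Max.boundedI) auto
    have "\<forall>\<^sub>F N in sequentially. sk_nu M g \<beta> N m (F N) - (\<Sum>r = (k + 1) div 2..n. c r / real N ^ r)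
      = nu_path \<beta> N 1 n0 (\<lambda>t. spin_prod N T t * pair_prod (sk_overlap N) es t) - (\<Sum>r\<le>n. c r / real N ^ r)"
      using eventually_ge_at_top[of 2]
    proof eventually_elim
      case (elim N)
      have "sk_nu M g \<beta> N m (F N) = sk.mean N (\<lambda>_. \<beta>) m (F N)"
        using dis elim by (intro sk_nu_eq_mean) auto
      also have "\<dots> = sk.mean N (\<lambda>_. \<beta>) n0 (F N)" by (rule sk.mean_marginal[OF depends_F n0m])
      finally show ?case using mean_F[of N] elim sum_c[of N] by simp
    qed
    from landau_o.big.in_cong[OF this] c
    show "(\<lambda>N. sk_nu M g \<beta> N m
              (\<lambda>s. \<Prod>i = 1..k. s (j i) N * s (l i) N * sk_overlap N s (j i) (l i))
            - (\<Sum>r = (k + 1) div 2..n. c r / real N ^ r))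
        \<in> O(\<lambda>N. 1 / real N ^ (n + 1))"
      unfolding F_def by blast
  qed
qed

end
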